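(* Let $\epsilon$ be the observer error, i.e. the solution of $$\begin{cases}\partial_t\epsilon(x,t)=\Delta\epsilon(x,t)+f_p(x,t), & t>0,\ x\in\Omega,\\ \epsilon(x,t)=0,& t>0,\ x\in\partial\Omega,\\ \epsilon(x,t)=0,& t>0,\ x\in\bigcup_{1\le i<j\le M}\varGamma_{ij},\\ \epsilon(x,0)=p^0(x)-\hat p^0(x),& x\in\Omega,\end{cases}$$ where $$f_p=f\Big(\hat p+\sum_{i=1}^N\mathscr D_iU_i+\epsilon\Big)-f\Big(\hat p+\sum_{i=1}^N\mathscr D_iU_i\Big),$$ that is, on each subdomain $\Omega_i$, $\epsilon|_{\Omega_i}$ solves this semilinear heat equation with homogeneous Dirichlet condition on $\partial\Omega_i$. Assume that the partition $\{\Omega_i\}_{i=1}^M$ of $\Omega$ satisfies $$\max_{1\le i\le M}\operatorname{Vol}_d(\Omega_i)<C_d^{-1}\Big(\frac{d}{L(d+2)}\Big)^{d/2},\qquad C_d=(4\pi)^{-d/2}\,[\Gamma(d/2+1)]^{-1}.$$ Then there exist positive constants $\kappa_1,\kappa_2$ such that $$\|\epsilon(\cdot,t)\|\le\kappa_1e^{-\kappa_2t}\,\|p^0-\hat p^0\|\qquad\text{for all }t\ge0.$$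
   Context: $\Omega\subset\mathbb R^d$, $d\in\mathbb N^+$, is a smooth bounded domain with $\partial\Omega=\varGamma_1\cup\varGamma_2$, where $\varGamma_1,\varGamma_2$ are disjoint and $\varGamma_1$ has positive measure. $\|\cdot\|$ and $\langle\cdot,\cdot\rangle$ are the norm and inner product of $L^2(\Omega)$. $f:\mathbb R\to\mathbb R$ is globally Lipschitz with constant $L>0$ and $f(0)=0$. $\Gamma(\cdot)$ is the Gamma function and $\operatorname{Vol}_d$ is $d$-dimensional Lebesgue measure. Partition: $\Omega_1,\dots,\Omega_M$ are disjoint Lipschitz subdomains of $\Omega$ such that $\Omega$ is the interior of the closure of $\bigcup_{i=1}^M\Omega_i$. $\varGamma_{ij}=\overline{\Omega_i}\cap\overline{\Omega_j}$ is the interface between adjacent subdomains. The available measurement of the plant state $z$ is its restriction to $\bigcup_{i<j}\varGamma_{ij}$. Plant: $\partial_tz=\Delta z+f(z)$ in $\Omega$, $z=U=\sum_{i=1}^NU_i$ on $\varGamma_1$ (boundary control), $z=0$ on $\varGamma_2$, $z(\cdot,0)=z^0\in L^2(\Omega)$. Lifting: let $(\lambda_n,\phi_n)_{n\ge1}$ be the eigenvalues (nondecreasing, repeated with multiplicity) and $L^2(\Omega)$-orthonormal eigenfunctions of the Dirichlet Laplacian: $-\Delta\phi_n=\lambda_n\phi_n$ in $\Omega$, $\phi_n=0$ on $\partial\Omega$. Let $\bm n$ be the unit outward normal, and $k_i=\lambda_i-\|\partial_{\bm n}\phi_i\|_{L^2(\varGamma_1)}\lambda_N^{-3/4}$, $i=1,\dots,N$.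 For $\alpha\in L^2(\varGamma_1)$, $\mathscr D_i\alpha=w_i$ is the unique solution of $\Delta w_i+2\sum_{l=1}^N\lambda_l\langle w_i,\phi_l\rangle\phi_l-k_iw_i=0$ in $\Omega$, $w_i=\alpha$ on $\varGamma_1$, $w_i=0$ on $\varGamma_2$. Put $p=z-\sum_{i=1}^N\mathscr D_iU_i$, with initial value $p^0\in L^2(\Omega)$. Then $p=0$ on $\partial\Omega$ and $$\partial_tp=\Delta p+f\Big(p+\sum_{i=1}^N\mathscr D_iU_i\Big)-\sum_{i=1}^N\Big[\mathscr D_i(\dot U_i-k_iU_i)+2\sum_{l=1}^N\lambda_l\langle\mathscr D_iU_i,\phi_l\rangle\phi_l\Big].$$ Observer: $\hat p$ satisfies the same equation in $\Omega$ with $p$ replaced by $\hat p$, with $\hat p=0$ on $\partial\Omega$, $\hat p=z-\sum_{i=1}^N\mathscr D_iU_i$ on $\bigcup_{i<j}\varGamma_{ij}$, and arbitrary initial value $\hat p(\cdot,0)=\hat p^0\in L^2(\Omega)$. The observer error is $\epsilon=p-\hat p$. *)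

theory Defs
  imports "HOL-Analysis.Analysis"
begin

section \<open>Smooth functions and domains\<close>

text \<open>Only real-valued functions on the whole space are needed: by extension, a function that is
  smooth up to the boundary of a smooth bounded domain is the restriction of a globally smooth one.\<close>

primrec C_k :: "nat \<Rightarrow> ('a::euclidean_space \<Rightarrow> real) \<Rightarrow> bool" where
  "C_k 0 f \<longleftrightarrow> continuous_on UNIV f"
| "C_k (Suc k) f \<longleftrightarrow>
     (\<forall>x. f differentiable (at x)) \<and> (\<forall>v. C_k k (\<lambda>x. frechet_derivative f (at x) v))"

definition smooth :: "('a::euclidean_space \<Rightarrow> real) \<Rightarrow> bool" where
  "smooth f \<longleftrightarrow> (\<forall>k. C_k k f)"

definition gradient :: "('a::euclidean_space \<Rightarrow> real) \<Rightarrow> 'a \<Rightarrow> 'a" where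
  "gradient f x = (\<Sum>b\<in>Basis. frechet_derivative f (at x) b *\<^sub>R b)"

definition laplacian :: "('a::euclidean_space \<Rightarrow> real) \<Rightarrow> 'a \<Rightarrow> real" where
  "laplacian f x =
     (\<Sum>b\<in>Basis. frechet_derivative (\<lambda>y. frechet_derivative f (at y) b) (at x) b)"

definition domain :: "'a::euclidean_space set \<Rightarrow> bool" where
  "domain S \<longleftrightarrow> open S \<and> connected S \<and> S \<noteq> {}"

text \<open>Near every boundary point \<open>S\<close> is the region above the graph of a function
  in the class \<open>P\<close>, after choosing a vertical direction \<open>e\<close>. The function is evaluated
  only on the hyperplane orthogonal to \<open>e\<close>.\<close>

definition graph_boundary :: "(('a::euclidean_space \<Rightarrow> real) \<Rightarrow> bool) \<Rightarrow> 'a set \<Rightarrow> bool" where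
  "graph_boundary P S \<longleftrightarrow>
     (\<forall>x\<in>frontier S. \<exists>r>0. \<exists>e g. norm e = 1 \<and> P g \<and>
        S \<inter> ball x r = {y \<in> ball x r. g (y - (y \<bullet> e) *\<^sub>R e) < y \<bullet> e})"

definition smooth_bounded_domain :: "'a::euclidean_space set \<Rightarrow> bool" where
  "smooth_bounded_domain S \<longleftrightarrow> domain S \<and> bounded S \<and> graph_boundary smooth S"

definition lipschitz_domain :: "'a::euclidean_space set \<Rightarrow> bool" where
  "lipschitz_domain S \<longleftrightarrow> domain S \<and> bounded S \<and> graph_boundary (\<lambda>g. \<exists>C. C-lipschitz_on UNIV g) S"

text \<open>The outward unit normal at a boundary point of a smooth domain, computed from any
  local defining function that is negative inside.\<close>

definition outward_normal :: "'a::euclidean_space set \<Rightarrow> 'a \<Rightarrow> 'a" where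
  "outward_normal S x = (THE \<nu>. \<exists>\<rho>. smooth \<rho> \<and> gradient \<rho> x \<noteq> 0 \<and>
     (\<exists>r>0. S \<inter> ball x r = {y \<in> ball x r. \<rho> y < 0}) \<and> \<nu> = sgn (gradient \<rho> x))"

definition normal_derivative ::
  "'a::euclidean_space set \<Rightarrow> ('a \<Rightarrow> real) \<Rightarrow> 'a \<Rightarrow> real" where
  "normal_derivative S f x = gradient f x \<bullet> outward_normal S x"


section \<open>Surface measure\<close>

text \<open>Normalized Hausdorff outer measure. In dimension \<open>0\<close> the convention \<open>0 ^ 0 = 1\<close> makes
  nonempty sets of diameter \<open>0\<close> count \<open>1\<close>, so the case of \<open>DIM('a) = 1\<close> gives counting measure
  on the boundary.\<close>

definition hausdorff_content :: "nat \<Rightarrow> real \<Rightarrow> 'a::euclidean_space set \<Rightarrow> ennreal" where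
  "hausdorff_content s \<delta> A =
     (INF U \<in> {U :: nat \<Rightarrow> 'a set. A \<subseteq> (\<Union>n. U n) \<and> (\<forall>n. bounded (U n) \<and> diameter (U n) \<le> \<delta>)}.
        \<Sum>n. if U n = {} then 0 else ennreal (unit_ball_vol (real s) * (diameter (U n) / 2) ^ s))"

definition hausdorff_outer :: "nat \<Rightarrow> 'a::euclidean_space set \<Rightarrow> ennreal" where
  "hausdorff_outer s A = (SUP \<delta>\<in>{0<..}. hausdorff_content s \<delta> A)"

text \<open>The outer measure is a measure on the Borel sets by Caratheodory's criterion for metric
  outer measures, so \<^const>\<open>measure_of\<close> does not degenerate here.\<close>

definition surface_measure :: "'a::euclidean_space measure" where
  "surface_measure = measure_of UNIV (sets borel) (hausdorff_outer (DIM('a) - 1))"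

abbreviation surface_on :: "'a::euclidean_space set \<Rightarrow> 'a measure" where
  "surface_on A \<equiv> restrict_space surface_measure A"


section \<open>Function spaces\<close>

text \<open>Elements of \<open>L\<^sup>2\<close> are represented by functions; all notions below are invariant under changes
  on null sets.\<close>

definition L2 :: "'a measure \<Rightarrow> ('a \<Rightarrow> 'b::euclidean_space) \<Rightarrow> bool" where
  "L2 M u \<longleftrightarrow> u \<in> borel_measurable M \<and> integrable M (\<lambda>x. (norm (u x))\<^sup>2)"

definition l2_inner :: "'a measure \<Rightarrow> ('a \<Rightarrow> 'b::euclidean_space) \<Rightarrow> ('a \<Rightarrow> 'b) \<Rightarrow> real" where
  "l2_inner M u v = (\<integral>x. u x \<bullet> v x \<partial>M)"

definition l2_norm :: "'a measure \<Rightarrow> ('a \<Rightarrow> 'b::euclidean_space) \<Rightarrow> real" where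
  "l2_norm M u = sqrt (\<integral>x. (norm (u x))\<^sup>2 \<partial>M)"

definition test_function :: "'a::euclidean_space set \<Rightarrow> ('a \<Rightarrow> real) \<Rightarrow> bool" where
  "test_function S \<psi> \<longleftrightarrow> smooth \<psi> \<and>
     compact (closure {x. \<psi> x \<noteq> 0}) \<and> closure {x. \<psi> x \<noteq> 0} \<subseteq> S"

definition has_weak_gradient ::
  "'a::euclidean_space set \<Rightarrow> ('a \<Rightarrow> real) \<Rightarrow> ('a \<Rightarrow> 'a) \<Rightarrow> bool" where
  "has_weak_gradient S u G \<longleftrightarrow> L2 (lebesgue_on S) G \<and>
     (\<forall>\<psi>. test_function S \<psi> \<longrightarrow> (\<forall>b\<in>Basis.
        l2_inner (lebesgue_on S) u (\<lambda>x. gradient \<psi> x \<bullet> b) =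
          - l2_inner (lebesgue_on S) (\<lambda>x. G x \<bullet> b) \<psi>))"

definition H1 :: "'a::euclidean_space set \<Rightarrow> ('a \<Rightarrow> real) \<Rightarrow> bool" where
  "H1 S u \<longleftrightarrow> L2 (lebesgue_on S) u \<and> (\<exists>G. has_weak_gradient S u G)"

definition weak_gradient :: "'a::euclidean_space set \<Rightarrow> ('a \<Rightarrow> real) \<Rightarrow> 'a \<Rightarrow> 'a" where
  "weak_gradient S u = (SOME G. has_weak_gradient S u G)"

definition H10 :: "'a::euclidean_space set \<Rightarrow> ('a \<Rightarrow> real) \<Rightarrow> bool" where
  "H10 S u \<longleftrightarrow> H1 S u \<and> (\<exists>\<psi> :: nat \<Rightarrow> 'a \<Rightarrow> real. (\<forall>n. test_function S (\<psi> n)) \<and>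
     (\<lambda>n. l2_norm (lebesgue_on S) (\<lambda>x. \<psi> n x - u x)) \<longlonglongrightarrow> 0 \<and>
     (\<lambda>n. l2_norm (lebesgue_on S) (\<lambda>x. gradient (\<psi> n) x - weak_gradient S u x)) \<longlonglongrightarrow> 0)"

definition C_L2 :: "'a measure \<Rightarrow> (real \<Rightarrow> 'a \<Rightarrow> real) \<Rightarrow> bool" where
  "C_L2 M u \<longleftrightarrow> (\<forall>t\<ge>0. L2 M (u t)) \<and>
     (\<forall>t\<ge>0. ((\<lambda>s. l2_norm M (\<lambda>x. u s x - u t x)) \<longlongrightarrow> 0) (at t within {0..}))"

text \<open>\<open>L\<^sup>1_loc([0,\<infinity>); L\<^sup>2(M))\<close>, measurability being imposed weakly.\<close>

definition L1loc_L2 :: "'a measure \<Rightarrow> (real \<Rightarrow> 'a \<Rightarrow> real) \<Rightarrow> bool" where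
  "L1loc_L2 M F \<longleftrightarrow> (AE t in lebesgue_on {0..}. L2 M (F t)) \<and>
     (\<forall>v. L2 M v \<longrightarrow> (\<lambda>t. l2_inner M (F t) v) \<in> borel_measurable (lebesgue_on {0..})) \<and>
     (\<forall>T\<ge>0. integrable (lebesgue_on {0..T}) (\<lambda>t. l2_norm M (F t)))"

text \<open>\<open>dU\<close> is the time derivative of \<open>U\<close> in \<open>L\<^sup>2(M)\<close>, with \<open>U\<close> of class
  \<open>W\<^sup>1\<^sup>,\<^sup>1_loc([0,\<infinity>); L\<^sup>2(M))\<close>.\<close>

definition has_L2_time_derivative ::
  "'a measure \<Rightarrow> (real \<Rightarrow> 'a \<Rightarrow> real) \<Rightarrow> (real \<Rightarrow> 'a \<Rightarrow> real) \<Rightarrow> bool" where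
  "has_L2_time_derivative M U dU \<longleftrightarrow> C_L2 M U \<and> L1loc_L2 M dU \<and>
     (\<forall>v. L2 M v \<longrightarrow> (\<forall>t\<ge>0. l2_inner M (U t) v - l2_inner M (U 0) v =
        (\<integral>s. l2_inner M (dU s) v \<partial>(lebesgue_on {0..t}))))"


section \<open>Parabolic problems\<close>

text \<open>Weak solution on \<open>S\<close>, in \<open>C([0,\<infinity>); L\<^sup>2) \<inter> L\<^sup>2_loc([0,\<infinity>); H\<^sup>1)\<close>, of
  \<open>\<partial>\<^sub>t u = \<Delta> u + F\<close> with \<open>u = h\<close> on the boundary of \<open>S\<close> (in the trace sense) and initial value
  \<open>u0\<close>. The equation is integrated in time. For semilinear equations \<open>F\<close> is built from \<open>u\<close>.\<close>

definition weak_heat_solution ::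
  "'a::euclidean_space set \<Rightarrow> (real \<Rightarrow> 'a \<Rightarrow> real) \<Rightarrow> (real \<Rightarrow> 'a \<Rightarrow> real) \<Rightarrow> ('a \<Rightarrow> real) \<Rightarrow>
     (real \<Rightarrow> 'a \<Rightarrow> real) \<Rightarrow> bool" where
  "weak_heat_solution S h F u0 u \<longleftrightarrow>
     L2 (lebesgue_on S) u0 \<and> C_L2 (lebesgue_on S) u \<and> L1loc_L2 (lebesgue_on S) F \<and>
     (AE t in lebesgue_on {0..}. H1 S (u t) \<and> H10 S (\<lambda>x. u t x - h t x)) \<and>
     (\<forall>T\<ge>0. integrable (lebesgue_on {0..T})
        (\<lambda>t. (l2_norm (lebesgue_on S) (weak_gradient S (u t)))\<^sup>2)) \<and>
     (\<forall>v. H10 S v \<longrightarrow> (\<forall>t\<ge>0.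
        l2_inner (lebesgue_on S) (u t) v - l2_inner (lebesgue_on S) u0 v =
          (\<integral>s. (- l2_inner (lebesgue_on S) (weak_gradient S (u s)) (weak_gradient S v)
                + l2_inner (lebesgue_on S) (F s) v) \<partial>(lebesgue_on {0..t}))))"

text \<open>The boundary datum of the plant lies only in \<open>L\<^sup>2(\<Gamma>\<^sub>1)\<close>, so the solution is defined by
  transposition: Green's formula moves both derivatives onto test functions vanishing on the
  boundary, and the datum appears against their normal derivative.\<close>

definition plant_solution ::
  "'a::euclidean_space set \<Rightarrow> 'a set \<Rightarrow> (real \<Rightarrow> real) \<Rightarrow> (real \<Rightarrow> 'a \<Rightarrow> real) \<Rightarrow> ('a \<Rightarrow> real) \<Rightarrow>
     (real \<Rightarrow> 'a \<Rightarrow> real) \<Rightarrow> bool" where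
  "plant_solution \<Omega> \<Gamma>1 f U z0 z \<longleftrightarrow>
     L2 (lebesgue_on \<Omega>) z0 \<and> C_L2 (lebesgue_on \<Omega>) z \<and>
     (\<forall>\<psi>. smooth \<psi> \<and> (\<forall>x\<in>frontier \<Omega>. \<psi> x = 0) \<longrightarrow> (\<forall>t\<ge>0.
        l2_inner (lebesgue_on \<Omega>) (z t) \<psi> - l2_inner (lebesgue_on \<Omega>) z0 \<psi> =
          (\<integral>s. (l2_inner (lebesgue_on \<Omega>) (z s) (laplacian \<psi>)
                - l2_inner (surface_on \<Gamma>1) (U s) (normal_derivative \<Omega> \<psi>)
                + l2_inner (lebesgue_on \<Omega>) (\<lambda>x. f (z s x)) \<psi>) \<partial>(lebesgue_on {0..t}))))"


section \<open>Dirichlet eigenpairs and lifting of the controls\<close>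

definition dirichlet_eigenfunction ::
  "'a::euclidean_space set \<Rightarrow> real \<Rightarrow> ('a \<Rightarrow> real) \<Rightarrow> bool" where
  "dirichlet_eigenfunction \<Omega> \<mu> \<psi> \<longleftrightarrow> smooth \<psi> \<and>
     (\<forall>x\<in>\<Omega>. - laplacian \<psi> x = \<mu> * \<psi> x) \<and> (\<forall>x\<in>frontier \<Omega>. \<psi> x = 0)"

text \<open>Indices start at 1. The last clause says that all eigenvalues are listed, with multiplicity.\<close>

definition dirichlet_eigensystem ::
  "'a::euclidean_space set \<Rightarrow> (nat \<Rightarrow> real) \<Rightarrow> (nat \<Rightarrow> 'a \<Rightarrow> real) \<Rightarrow> bool" where
  "dirichlet_eigensystem \<Omega> lam phi \<longleftrightarrow>
     (\<forall>n\<ge>1. dirichlet_eigenfunction \<Omega> (lam n) (phi n)) \<and>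
     (\<forall>m n. 1 \<le> m \<longrightarrow> m \<le> n \<longrightarrow> lam m \<le> lam n) \<and>
     (\<forall>m\<ge>1. \<forall>n\<ge>1. l2_inner (lebesgue_on \<Omega>) (phi m) (phi n) = (if m = n then 1 else 0)) \<and>
     (\<forall>\<mu> \<psi>. dirichlet_eigenfunction \<Omega> \<mu> \<psi> \<longrightarrow>
        (\<exists>A c. finite A \<and> A \<subseteq> {n. 1 \<le> n \<and> lam n = \<mu>} \<and>
           (\<forall>x\<in>\<Omega>. \<psi> x = (\<Sum>n\<in>A. c n * phi n x))))"

definition lift_rate ::
  "'a::euclidean_space set \<Rightarrow> 'a set \<Rightarrow> (nat \<Rightarrow> real) \<Rightarrow> (nat \<Rightarrow> 'a \<Rightarrow> real) \<Rightarrow> nat \<Rightarrow> nat \<Rightarrow> real" where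
  "lift_rate \<Omega> \<Gamma>1 lam phi N i =
     lam i - l2_norm (surface_on \<Gamma>1) (normal_derivative \<Omega> (phi i)) * lam N powr (- 3 / 4)"

definition spectral_shift ::
  "'a::euclidean_space set \<Rightarrow> (nat \<Rightarrow> real) \<Rightarrow> (nat \<Rightarrow> 'a \<Rightarrow> real) \<Rightarrow> nat \<Rightarrow> ('a \<Rightarrow> real) \<Rightarrow> 'a \<Rightarrow> real" where
  "spectral_shift \<Omega> lam phi N w x =
     2 * (\<Sum>l=1..N. lam l * l2_inner (lebesgue_on \<Omega>) w (phi l) * phi l x)"

text \<open>Solution by transposition, for the datum \<open>\<alpha>\<close> in \<open>L\<^sup>2(\<Gamma>\<^sub>1)\<close> and zero datum on the
  rest of the boundary.\<close>

definition lift_solution ::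
  "'a::euclidean_space set \<Rightarrow> 'a set \<Rightarrow> (nat \<Rightarrow> real) \<Rightarrow> (nat \<Rightarrow> 'a \<Rightarrow> real) \<Rightarrow> nat \<Rightarrow> nat \<Rightarrow>
     ('a \<Rightarrow> real) \<Rightarrow> ('a \<Rightarrow> real) \<Rightarrow> bool" where
  "lift_solution \<Omega> \<Gamma>1 lam phi N i \<alpha> w \<longleftrightarrow> L2 (lebesgue_on \<Omega>) w \<and>
     (\<forall>\<psi>. smooth \<psi> \<and> (\<forall>x\<in>frontier \<Omega>. \<psi> x = 0) \<longrightarrow>
        l2_inner (lebesgue_on \<Omega>) w (laplacian \<psi>)
        - l2_inner (surface_on \<Gamma>1) \<alpha> (normal_derivative \<Omega> \<psi>)
        + l2_inner (lebesgue_on \<Omega>) (spectral_shift \<Omega> lam phi N w) \<psi>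
        - lift_rate \<Omega> \<Gamma>1 lam phi N i * l2_inner (lebesgue_on \<Omega>) w \<psi> = 0)"

text \<open>The solution is unique only up to null sets, hence \<open>SOME\<close>.\<close>

definition lift ::
  "'a::euclidean_space set \<Rightarrow> 'a set \<Rightarrow> (nat \<Rightarrow> real) \<Rightarrow> (nat \<Rightarrow> 'a \<Rightarrow> real) \<Rightarrow> nat \<Rightarrow> nat \<Rightarrow>
     ('a \<Rightarrow> real) \<Rightarrow> 'a \<Rightarrow> real" where
  "lift \<Omega> \<Gamma>1 lam phi N i \<alpha> = (SOME w. lift_solution \<Omega> \<Gamma>1 lam phi N i \<alpha> w)"

definition lifted_control ::
  "'a::euclidean_space set \<Rightarrow> 'a set \<Rightarrow> (nat \<Rightarrow> real) \<Rightarrow> (nat \<Rightarrow> 'a \<Rightarrow> real) \<Rightarrow> nat \<Rightarrow>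
     (nat \<Rightarrow> real \<Rightarrow> 'a \<Rightarrow> real) \<Rightarrow> real \<Rightarrow> 'a \<Rightarrow> real" where
  "lifted_control \<Omega> \<Gamma>1 lam phi N U t x = (\<Sum>i=1..N. lift \<Omega> \<Gamma>1 lam phi N i (U i t) x)"

text \<open>The right-hand side, apart from the Laplacian, of the homogenized plant and of its observer,
  evaluated along \<open>q\<close>.\<close>

definition lifted_source ::
  "'a::euclidean_space set \<Rightarrow> 'a set \<Rightarrow> (real \<Rightarrow> real) \<Rightarrow> (nat \<Rightarrow> real) \<Rightarrow> (nat \<Rightarrow> 'a \<Rightarrow> real) \<Rightarrow> nat \<Rightarrow>
     (nat \<Rightarrow> real \<Rightarrow> 'a \<Rightarrow> real) \<Rightarrow> (nat \<Rightarrow> real \<Rightarrow> 'a \<Rightarrow> real) \<Rightarrow> (real \<Rightarrow> 'a \<Rightarrow> real) \<Rightarrow> real \<Rightarrow> 'a \<Rightarrow> real"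
  where
  "lifted_source \<Omega> \<Gamma>1 f lam phi N U dU q t x =
     f (q t x + lifted_control \<Omega> \<Gamma>1 lam phi N U t x)
     - (\<Sum>i=1..N.
          lift \<Omega> \<Gamma>1 lam phi N i (\<lambda>y. dU i t y - lift_rate \<Omega> \<Gamma>1 lam phi N i * U i t y) x
          + spectral_shift \<Omega> lam phi N (lift \<Omega> \<Gamma>1 lam phi N i (U i t)) x)"


section \<open>Partition, observer and observer error\<close>

definition lipschitz_partition ::
  "'a::euclidean_space set \<Rightarrow> nat \<Rightarrow> (nat \<Rightarrow> 'a set) \<Rightarrow> bool" where
  "lipschitz_partition \<Omega> M \<Omega>s \<longleftrightarrow> M \<ge> 1 \<and>
     (\<forall>i\<in>{1..M}. lipschitz_domain (\<Omega>s i) \<and> \<Omega>s i \<subseteq> \<Omega>) \<and>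
     (\<forall>i\<in>{1..M}. \<forall>j\<in>{1..M}. i \<noteq> j \<longrightarrow> \<Omega>s i \<inter> \<Omega>s j = {}) \<and>
     \<Omega> = interior (closure (\<Union>i\<in>{1..M}. \<Omega>s i))"

text \<open>For such a partition every \<open>\<Omega>s i\<close> has its boundary inside the union of the outer boundary and the
  interfaces \<open>closure (\<Omega>s i) \<inter> closure (\<Omega>s j)\<close>; conversely, the points of that union lying in the
  closure of \<open>\<Omega>s i\<close> belong to its boundary. Conditions on the outer boundary and on all interfaces
  are therefore Dirichlet conditions on the boundary of each \<open>\<Omega>s i\<close>. The observer takes the datum
  \<open>z - lifted_control\<close>, which vanishes on the outer boundary.\<close>

definition observer_solution ::
  "'a::euclidean_space set \<Rightarrow> 'a set \<Rightarrow> (real \<Rightarrow> real) \<Rightarrow> (nat \<Rightarrow> real) \<Rightarrow> (nat \<Rightarrow> 'a \<Rightarrow> real) \<Rightarrow> nat \<Rightarrow>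
     (nat \<Rightarrow> real \<Rightarrow> 'a \<Rightarrow> real) \<Rightarrow> (nat \<Rightarrow> real \<Rightarrow> 'a \<Rightarrow> real) \<Rightarrow>
     nat \<Rightarrow> (nat \<Rightarrow> 'a set) \<Rightarrow> (real \<Rightarrow> 'a \<Rightarrow> real) \<Rightarrow> ('a \<Rightarrow> real) \<Rightarrow> (real \<Rightarrow> 'a \<Rightarrow> real) \<Rightarrow> bool"
  where
  "observer_solution \<Omega> \<Gamma>1 f lam phi N U dU M \<Omega>s z phat0 phat \<longleftrightarrow>
     L2 (lebesgue_on \<Omega>) phat0 \<and>
     (\<forall>i\<in>{1..M}. weak_heat_solution (\<Omega>s i)
        (\<lambda>t x. z t x - lifted_control \<Omega> \<Gamma>1 lam phi N U t x)
        (lifted_source \<Omega> \<Gamma>1 f lam phi N U dU phat) phat0 phat)"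

text \<open>\<open>g\<close> is \<open>phat + lifted_control\<close>.\<close>

definition error_solution ::
  "(real \<Rightarrow> real) \<Rightarrow> nat \<Rightarrow> (nat \<Rightarrow> 'a::euclidean_space set) \<Rightarrow> (real \<Rightarrow> 'a \<Rightarrow> real) \<Rightarrow> ('a \<Rightarrow> real) \<Rightarrow>
     (real \<Rightarrow> 'a \<Rightarrow> real) \<Rightarrow> bool" where
  "error_solution f M \<Omega>s g e0 e \<longleftrightarrow>
     (\<forall>i\<in>{1..M}. weak_heat_solution (\<Omega>s i) (\<lambda>t x. 0)
        (\<lambda>t x. f (g t x + e t x) - f (g t x)) e0 e)"

definition C_dim :: "nat \<Rightarrow> real" where
  "C_dim d = (4 * pi) powr (- real d / 2) * inverse (Gamma (real d / 2 + 1))"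

end

theory Submission
  imports Defs "HOL-Probability.Characteristic_Functions"
begin

text \<open>
  On each subdomain the error solves a semilinear heat equation with zero Dirichlet data, and the
  reaction term contributes at most \<open>L\<close> times the energy, so the energy decays exponentially as soon as
  the first Dirichlet eigenvalue exceeds \<open>L\<close>. The volume condition is exactly what the Berezin--Li--Yau
  bound for the first eigenvalue needs: if \<open>\<psi>\<close> is supported in \<open>S\<close>, its Fourier transform satisfies
  \<open>\<bar>\<psi>^(\<xi>)\<bar>\<^sup>2 \<le> \<bar>S\<bar> \<parallel>\<psi>\<parallel>\<^sup>2\<close>, and
  \<open>R\<^sup>2 \<parallel>\<psi>\<parallel>\<^sup>2 - \<parallel>\<nabla>\<psi>\<parallel>\<^sup>2 = (2\<pi>)\<^sup>-\<^sup>d \<integral> (R\<^sup>2 - \<bar>\<xi>\<bar>\<^sup>2) \<bar>\<psi>^(\<xi>)\<bar>\<^sup>2 d\<xi>\<close> is then bounded by integrating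
  the positive part of \<open>R\<^sup>2 - \<bar>\<xi>\<bar>\<^sup>2\<close>. Instead of Plancherel's theorem, a Gaussian factor
  \<open>exp (- \<tau> \<bar>\<xi>\<bar>\<^sup>2)\<close> is inserted and \<open>\<tau> \<rightarrow> 0\<close>.

  A weak solution \<open>u\<close> is only tested against time-independent functions. Testing with \<open>u(t)\<close> on
  \<open>[t - h, t]\<close> bounds the increment of the energy by the time integral of \<open>- \<langle>\<nabla>u(s), \<nabla>u(t)\<rangle>\<close>, in which
  \<open>u(s)\<close> must be replaced by \<open>u(t)\<close> although \<open>\<nabla>u\<close> need not be continuous in time. The Gaussian-damped
  Dirichlet form is continuous on \<open>L\<^sup>2\<close>, so the replacement is possible there, and the difference of the two
  forms is positive semidefinite and small in the mean over time.
\<close>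

section \<open>The space \<open>L\<^sup>2\<close>\<close>

text \<open>The threshold is where the eigenvalue bound meets the Lipschitz constant. On a set of
  volume at most m the Fourier argument yields the constant R^2 - C_d m 2 R^(d+2) / (d+2). It is
  largest when C_d m R^d = 1, where it equals K = R^2 d / (d+2), and K > L is a rearrangement of the
  volume condition. The norm then decays at rate K - L with factor 1. As K depends only on the
  largest volume, the rate is common to all subdomains and the squared norms can be added. The
  obstacle on the parabolic side is that the energy of a weak solution is only known to be
  continuous in time. What can be extracted is a bound on its left increments at almost every time,
  with an error of small integral. This suffices because the increments are averaged in time before
  the step tends to 0. The damping parameter has to be fixed before the time step, since the
  continuity constant of the damped form depends on it.\<close>

lemma L2_D: "L2 M u \<Longrightarrow> u \<in> borel_measurable M" "L2 M u \<Longrightarrow> integrable M (\<lambda>x. (norm (u x))\<^sup>2)"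
  by (auto simp: L2_def)

lemma L2_inner_integrable:
  assumes "L2 M u" "L2 M v"
  shows "integrable M (\<lambda>x. u x \<bullet> v x)"
proof (rule Bochner_Integration.integrable_bound)
  show "integrable M (\<lambda>x. (norm (u x))\<^sup>2 + (norm (v x))\<^sup>2)"
    using assms by (auto simp: L2_def)
  show "(\<lambda>x. u x \<bullet> v x) \<in> borel_measurable M"
    using assms by (auto simp: L2_def)
  show "AE x in M. norm (u x \<bullet> v x) \<le> norm ((norm (u x))\<^sup>2 + (norm (v x))\<^sup>2)"
  proof (rule AE_I2)
    fix x
    have "\<bar>u x \<bullet> v x\<bar> \<le> norm (u x) * norm (v x)" by (rule Cauchy_Schwarz_ineq2)
    moreover have "2 * (norm (u x) * norm (v x)) \<le> (norm (u x))\<^sup>2 + (norm (v x))\<^sup>2"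
      using sum_squares_bound[of "norm (u x)" "norm (v x)"] by simp
    moreover have "0 \<le> norm (u x) * norm (v x)" by simp
    ultimately show "norm (u x \<bullet> v x) \<le> norm ((norm (u x))\<^sup>2 + (norm (v x))\<^sup>2)"
      unfolding real_norm_def by linarith
  qed
qed

lemma L2_lincomb:
  assumes "L2 M u" "L2 M v"
  shows "L2 M (\<lambda>x. a *\<^sub>R u x + b *\<^sub>R v x)"
proof -
  have i: "integrable M (\<lambda>x. a\<^sup>2 * (norm (u x))\<^sup>2 + 2 * a * b * (u x \<bullet> v x) + b\<^sup>2 * (norm (v x))\<^sup>2)"
    using L2_inner_integrable[OF assms] assms by (intro Bochner_Integration.integrable_add) (auto simp: L2_def)
  have e: "(norm (a *\<^sub>R u x + b *\<^sub>R v x))\<^sup>2 =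
     a\<^sup>2 * (norm (u x))\<^sup>2 + 2 * a * b * (u x \<bullet> v x) + b\<^sup>2 * (norm (v x))\<^sup>2" for x
    unfolding power2_norm_eq_inner
    by (simp add: inner_add_left inner_add_right algebra_simps power2_eq_square inner_commute)
  show ?thesis
    using assms i unfolding L2_def e by auto
qed

lemma L2_diff: "L2 M u \<Longrightarrow> L2 M v \<Longrightarrow> L2 M (\<lambda>x. u x - v x)"
  using L2_lincomb[of M u v 1 "-1"] by simp

lemma l2_inner_commute: "l2_inner M u v = l2_inner M v u"
  by (simp add: l2_inner_def inner_commute)

lemma l2_inner_diff_left:
  "L2 M u \<Longrightarrow> L2 M v \<Longrightarrow> L2 M w \<Longrightarrow> l2_inner M (\<lambda>x. u x - v x) w = l2_inner M u w - l2_inner M v w"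
  unfolding l2_inner_def inner_diff_left
  by (intro Bochner_Integration.integral_diff L2_inner_integrable)

lemma l2_inner_diff_right:
  "L2 M u \<Longrightarrow> L2 M v \<Longrightarrow> L2 M w \<Longrightarrow> l2_inner M w (\<lambda>x. u x - v x) = l2_inner M w u - l2_inner M w v"
  using l2_inner_diff_left[of M u v w] by (simp add: l2_inner_commute)

lemma l2_norm_nonneg [simp]: "0 \<le> l2_norm M u"
  by (simp add: l2_norm_def)

lemma l2_norm_minus_commute: "l2_norm M (\<lambda>x. u x - v x) = l2_norm M (\<lambda>x. v x - u x)"
  by (simp add: l2_norm_def norm_minus_commute)

lemma l2_norm_power2: "(l2_norm M u)\<^sup>2 = l2_inner M u u"
  by (simp add: l2_norm_def l2_inner_def power2_norm_eq_inner)

lemma l2_norm_diff_power2: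
  assumes "L2 M u" "L2 M v"
  shows "(l2_norm M (\<lambda>x. u x - v x))\<^sup>2 = (l2_norm M u)\<^sup>2 - 2 * l2_inner M u v + (l2_norm M v)\<^sup>2"
  using assms unfolding l2_norm_power2
  by (simp add: l2_inner_diff_left l2_inner_diff_right L2_diff l2_inner_commute[of M v u])

lemma l2_cauchy_schwarz:
  assumes "L2 M u" "L2 M v"
  shows "\<bar>l2_inner M u v\<bar> \<le> l2_norm M u * l2_norm M v"
proof -
  have q: "0 \<le> a\<^sup>2 * (l2_norm M u)\<^sup>2 - 2 * a * b * l2_inner M u v + b\<^sup>2 * (l2_norm M v)\<^sup>2" for a b
  proof -
    have s: "L2 M (\<lambda>x. a *\<^sub>R u x)" "L2 M (\<lambda>x. b *\<^sub>R v x)"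
      using L2_lincomb[of M u v a 0] L2_lincomb[of M u v 0 b] assms by auto
    show ?thesis
      using l2_norm_diff_power2[OF s] zero_le_power2[of "l2_norm M (\<lambda>x. a *\<^sub>R u x - b *\<^sub>R v x)"]
      unfolding l2_norm_power2 by (simp add: l2_inner_def power2_eq_square algebra_simps)
  qed
  define A where "A = l2_norm M u" define B where "B = l2_norm M v" define I where "I = l2_inner M u v"
  have AB: "0 \<le> A" "0 \<le> B" by (auto simp: A_def B_def)
  have q': "0 \<le> a\<^sup>2 * A\<^sup>2 - 2 * a * b * I + b\<^sup>2 * B\<^sup>2" for a b
    using q unfolding A_def B_def I_def .
  have "I\<^sup>2 \<le> (A * B)\<^sup>2"
  proof (cases "A = 0")
    case True
    have "I = 0"
    proof (rule ccontr)
      assume "I \<noteq> 0"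
      \<comment> \<open>For \<open>A = 0\<close> the quadratic form is affine in its first argument,
        and this choice gives it the value -1.\<close>
      then show False using q'[of "(B\<^sup>2 + 1) / (2 * I)" 1] True by (simp add: field_simps)
    qed
    then show ?thesis by simp
  next
    case False
    \<comment> \<open>The arguments \<open>I\<close> and \<open>A\<close> squared are the minimiser
      of the quadratic form up to a common factor.\<close>
    have "0 \<le> I\<^sup>2 * A\<^sup>2 - 2 * I * A\<^sup>2 * I + (A\<^sup>2)\<^sup>2 * B\<^sup>2" using q'[of I "A\<^sup>2"] by simp
    then have "0 \<le> A\<^sup>2 * ((A*B)\<^sup>2 - I\<^sup>2)" by (simp add: algebra_simps power2_eq_square)
    then show ?thesis using False by (simp add: zero_le_mult_iff)
  qed
  then show ?thesis
    using AB abs_le_square_iff[of I "A*B"] by (auto simp: A_def B_def I_def)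
qed

lemma l2_norm_triangle:
  assumes "L2 M u" "L2 M v" "L2 M w"
  shows "l2_norm M (\<lambda>x. u x - w x) \<le> l2_norm M (\<lambda>x. u x - v x) + l2_norm M (\<lambda>x. v x - w x)"
proof (rule power2_le_imp_le)
  have d: "L2 M (\<lambda>x. u x - v x)" "L2 M (\<lambda>x. w x - v x)" using assms by (auto intro: L2_diff)
  have sw: "l2_norm M (\<lambda>x. w x - v x) = l2_norm M (\<lambda>x. v x - w x)"
    by (rule l2_norm_minus_commute)
  show "(l2_norm M (\<lambda>x. u x - w x))\<^sup>2 \<le> (l2_norm M (\<lambda>x. u x - v x) + l2_norm M (\<lambda>x. v x - w x))\<^sup>2"
    using l2_norm_diff_power2[OF d] l2_cauchy_schwarz[OF d] sw by (simp add: power2_sum)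
qed auto

lemma l2_norm_le_diff:
  assumes "L2 M u" "L2 M v"
  shows "\<bar>l2_norm M u - l2_norm M v\<bar> \<le> l2_norm M (\<lambda>x. u x - v x)"
proof -
  have z: "L2 M (\<lambda>x. 0 :: 'b)" by (simp add: L2_def)
  have sw: "l2_norm M (\<lambda>x. v x - u x) = l2_norm M (\<lambda>x. u x - v x)"
    by (rule l2_norm_minus_commute)
  show ?thesis
    using l2_norm_triangle[OF assms(1,2) z] l2_norm_triangle[OF assms(2,1) z] sw by simp
qed

lemma tendsto_l2_norm:
  assumes "\<And>i. L2 M (U i)" "L2 M u" "((\<lambda>i. l2_norm M (\<lambda>x. U i x - u x)) \<longlongrightarrow> 0) F"
  shows "((\<lambda>i. l2_norm M (U i)) \<longlongrightarrow> l2_norm M u) F"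
proof (rule Lim_transform_bound[OF _ assms(3), THEN LIM_zero_cancel], rule always_eventually, rule allI)
qed (use l2_norm_le_diff[OF assms(1,2)] in simp)

lemma l2_inner_diff_bound:
  assumes "L2 M u" "L2 M v" "L2 M u'" "L2 M v'"
  shows "\<bar>l2_inner M u' v' - l2_inner M u v\<bar> \<le>
    l2_norm M (\<lambda>x. u' x - u x) * l2_norm M v' + l2_norm M u * l2_norm M (\<lambda>x. v' x - v x)"
proof -
  have "l2_inner M u' v' - l2_inner M u v =
    l2_inner M (\<lambda>x. u' x - u x) v' + l2_inner M u (\<lambda>x. v' x - v x)"
    using assms by (simp add: l2_inner_diff_left l2_inner_diff_right)
  moreover have "\<bar>l2_inner M (\<lambda>x. u' x - u x) v'\<bar> \<le> l2_norm M (\<lambda>x. u' x - u x) * l2_norm M v'"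
    using assms by (intro l2_cauchy_schwarz L2_diff)
  moreover have "\<bar>l2_inner M u (\<lambda>x. v' x - v x)\<bar> \<le> l2_norm M u * l2_norm M (\<lambda>x. v' x - v x)"
    using assms by (intro l2_cauchy_schwarz L2_diff)
  ultimately show ?thesis by linarith
qed

lemma tendsto_l2_inner:
  assumes "\<And>i. L2 M (U i)" "\<And>i. L2 M (V i)" "L2 M u" "L2 M v"
    and "((\<lambda>i. l2_norm M (\<lambda>x. U i x - u x)) \<longlongrightarrow> 0) F"
    and "((\<lambda>i. l2_norm M (\<lambda>x. V i x - v x)) \<longlongrightarrow> 0) F"
  shows "((\<lambda>i. l2_inner M (U i) (V i)) \<longlongrightarrow> l2_inner M u v) F"
proof (rule LIM_zero_cancel, rule Lim_null_comparison)
  show "\<forall>\<^sub>F i in F. norm (l2_inner M (U i) (V i) - l2_inner M u v) \<le>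
    l2_norm M (\<lambda>x. U i x - u x) * l2_norm M (V i) + l2_norm M u * l2_norm M (\<lambda>x. V i x - v x)"
    using l2_inner_diff_bound[OF assms(3,4,1,2)] by simp
  show "((\<lambda>i. l2_norm M (\<lambda>x. U i x - u x) * l2_norm M (V i) + l2_norm M u * l2_norm M (\<lambda>x. V i x - v x)) \<longlongrightarrow> 0) F"
    using tendsto_add[OF tendsto_mult[OF assms(5) tendsto_l2_norm[OF assms(2,4,6)]]
        tendsto_mult[OF tendsto_const assms(6), of "l2_norm M u"]] by simp
qed

section \<open>Gaussian integrals\<close>

text \<open>Rescaling by \<open>c = sqrt (2 * \<tau>)\<close> turns the Gaussian into a multiple of
  the standard normal density, so the value is read off from the characteristic function of the
  standard normal distribution at \<open>z / c\<close>.\<close>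

lemma gaussian_cis_real:
  fixes \<tau> z :: real
  assumes "\<tau> > 0"
  shows "integrable lborel (\<lambda>x::real. exp (- \<tau> * x\<^sup>2) *\<^sub>R cis (x * z))"
    and "(\<integral>x. exp (- \<tau> * x\<^sup>2) *\<^sub>R cis (x * z) \<partial>lborel)
      = complex_of_real (sqrt (pi / \<tau>) * exp (- z\<^sup>2 / (4 * \<tau>)))"
proof -
  define c where "c = sqrt (2 * \<tau>)"
  have c: "c > 0" "c\<^sup>2 = 2 * \<tau>" using assms by (auto simp: c_def)
  define s where "s = z / c"
  let ?g = "\<lambda>x. std_normal_density x *\<^sub>R cis (s * x)"
  have e: "std_normal_density (0 + c * x) *\<^sub>R cis (s * (0 + c * x))
      = (1 / sqrt (2 * pi)) *\<^sub>R (exp (- \<tau> * x\<^sup>2) *\<^sub>R cis (x * z))" for x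
  proof -
    have 1: "s * (c * x) = x * z" using c by (simp add: s_def)
    have 2: "(c * x)\<^sup>2 / 2 = \<tau> * x\<^sup>2" using c by (simp add: power_mult_distrib)
    show ?thesis unfolding std_normal_density_def add_0 1 by (simp add: 2)
  qed
  have "integrable lborel std_normal_density" by simp
  then have i: "integrable lborel ?g"
    by (rule Bochner_Integration.integrable_bound) (auto simp: norm_mult cis_conv_exp)
  show "integrable lborel (\<lambda>x::real. exp (- \<tau> * x\<^sup>2) *\<^sub>R cis (x * z))"
  proof -
    have "c \<noteq> 0" using c by simp
    from integrable_scaleR_right[OF lborel_integrable_real_affine[OF i this, of 0, unfolded e], of "sqrt (2 * pi)"]
    have "integrable lborel (\<lambda>x. sqrt (2 * pi) *\<^sub>R ((1 / sqrt (2 * pi)) *\<^sub>R (exp (- \<tau> * x\<^sup>2) *\<^sub>R cis (x * z))))" .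
    moreover have "sqrt (2 * pi) * (1 / sqrt (2 * pi)) = 1" by simp
    ultimately show ?thesis unfolding scaleR_scaleR[of "sqrt (2 * pi)"] by (simp only: scaleR_one)
  qed
  have "char std_normal_distribution s = integral\<^sup>L lborel ?g"
    unfolding char_def by (subst integral_density) (auto simp: cis_conv_exp mult_ac)
  then have "complex_of_real (exp (- (s\<^sup>2) / 2)) = integral\<^sup>L lborel ?g"
    by (simp add: char_std_normal_distribution)
  also have "\<dots> = \<bar>c\<bar> *\<^sub>R (\<integral>x. std_normal_density (0 + c * x) *\<^sub>R cis (s * (0 + c * x)) \<partial>lborel)"
    using c by (intro lborel_integral_real_affine) auto
  also have "\<dots> = (c / sqrt (2 * pi)) *\<^sub>R (\<integral>x. exp (- \<tau> * x\<^sup>2) *\<^sub>R cis (x * z) \<partial>lborel)"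
    unfolding e integral_scaleR_right using c by simp
  finally have "(sqrt (2 * pi) / c) *\<^sub>R complex_of_real (exp (- (s\<^sup>2) / 2))
      = (\<integral>x. exp (- \<tau> * x\<^sup>2) *\<^sub>R cis (x * z) \<partial>lborel)"
    using c by simp
  moreover have "sqrt (2 * pi) / c = sqrt (pi / \<tau>)" unfolding c_def by (simp add: real_sqrt_divide real_sqrt_mult)
  moreover have "(s\<^sup>2) / 2 = z\<^sup>2 / (4 * \<tau>)" using c by (simp add: s_def power_divide)
  ultimately show "(\<integral>x. exp (- \<tau> * x\<^sup>2) *\<^sub>R cis (x * z) \<partial>lborel)
      = complex_of_real (sqrt (pi / \<tau>) * exp (- z\<^sup>2 / (4 * \<tau>)))"
    by (simp add: scaleR_conv_of_real)
qed

lemma integral_lborel_prod: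
  fixes f :: "'a::euclidean_space \<Rightarrow> real \<Rightarrow> complex"
  assumes i: "\<And>b. b \<in> Basis \<Longrightarrow> integrable lborel (f b)"
  shows "integrable (lborel :: 'a measure) (\<lambda>x. \<Prod>b\<in>Basis. f b (x \<bullet> b))"
    and "(\<integral>x. (\<Prod>b\<in>Basis. f b (x \<bullet> b)) \<partial>(lborel :: 'a measure)) = (\<Prod>b\<in>Basis. (\<integral>x. f b x \<partial>lborel))"
proof -
  interpret product_sigma_finite "\<lambda>b::'a. lborel :: real measure" ..
  have [measurable]: "\<And>b. b \<in> Basis \<Longrightarrow> f b \<in> borel_measurable borel" using i by auto
  have m: "(\<lambda>x::'a. \<Prod>b\<in>Basis. f b (x \<bullet> b)) \<in> borel_measurable borel" by measurable
  have m2: "(\<lambda>f. \<Sum>b\<in>Basis. f b *\<^sub>R b) \<in> measurable (\<Pi>\<^sub>M b\<in>(Basis::'a set). lborel) borel" by measurable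
  have e: "(\<Prod>b\<in>Basis. f b ((\<Sum>b\<in>Basis. x b *\<^sub>R b) \<bullet> b)) = (\<Prod>b\<in>(Basis::'a set). f b (x b))" for x
    by (intro prod.cong) auto
  show "integrable (lborel :: 'a measure) (\<lambda>x. \<Prod>b\<in>Basis. f b (x \<bullet> b))"
    by (subst lborel_eq, subst integrable_distr_eq[OF m2 m]) (use i in \<open>auto simp: e intro!: product_integrable_prod\<close>)
  show "(\<integral>x. (\<Prod>b\<in>Basis. f b (x \<bullet> b)) \<partial>(lborel :: 'a measure)) = (\<Prod>b\<in>Basis. (\<integral>x. f b x \<partial>lborel))"
    by (subst lborel_eq, subst integral_distr[OF m2 m]) (use i in \<open>auto simp: e intro!: product_integral_prod\<close>)
qed

lemma gaussian_cis:
  fixes z :: "'a::euclidean_space"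
  assumes "\<tau> > 0"
  shows "integrable lborel (\<lambda>\<xi>::'a. exp (- \<tau> * (norm \<xi>)\<^sup>2) *\<^sub>R cis (\<xi> \<bullet> z))"
    and "(\<integral>\<xi>. exp (- \<tau> * (norm \<xi>)\<^sup>2) *\<^sub>R cis (\<xi> \<bullet> z) \<partial>lborel)
      = complex_of_real (sqrt (pi / \<tau>) ^ DIM('a) * exp (- (norm z)\<^sup>2 / (4 * \<tau>)))"
proof -
  have n: "(norm x)\<^sup>2 = (\<Sum>b\<in>Basis. (x \<bullet> b)\<^sup>2)" for x :: 'a
    unfolding power2_norm_eq_inner by (subst euclidean_inner) (simp add: power2_eq_square)
  have e: "exp (- \<tau> * (norm \<xi>)\<^sup>2) *\<^sub>R cis (\<xi> \<bullet> z)
      = (\<Prod>b\<in>Basis. exp (- \<tau> * (\<xi> \<bullet> b)\<^sup>2) *\<^sub>R cis ((\<xi> \<bullet> b) * (z \<bullet> b)))" for \<xi> :: 'a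
  proof -
    have 1: "exp (- \<tau> * (norm \<xi>)\<^sup>2) = (\<Prod>b\<in>Basis. exp (- \<tau> * (\<xi> \<bullet> b)\<^sup>2))"
      unfolding n sum_distrib_left by (simp add: exp_sum)
    have 2: "cis (\<xi> \<bullet> z) = (\<Prod>b\<in>Basis. cis ((\<xi> \<bullet> b) * (z \<bullet> b)))"
      unfolding euclidean_inner[of \<xi> z] cis_conv_exp of_real_sum sum_distrib_left by (simp add: exp_sum)
    show ?thesis unfolding 1 2 scaleR_conv_of_real of_real_prod by (simp add: prod.distrib)
  qed
  note g = gaussian_cis_real[OF assms]
  show "integrable lborel (\<lambda>\<xi>::'a. exp (- \<tau> * (norm \<xi>)\<^sup>2) *\<^sub>R cis (\<xi> \<bullet> z))"
    unfolding e by (rule integral_lborel_prod(1)) (rule g(1))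
  have "(\<integral>\<xi>. exp (- \<tau> * (norm \<xi>)\<^sup>2) *\<^sub>R cis (\<xi> \<bullet> z) \<partial>lborel)
      = (\<Prod>b\<in>Basis. complex_of_real (sqrt (pi / \<tau>) * exp (- (z \<bullet> b)\<^sup>2 / (4 * \<tau>))))"
    unfolding e integral_lborel_prod(2)[OF g(1)] g(2) ..
  also have "\<dots> = complex_of_real (sqrt (pi / \<tau>) ^ DIM('a) * exp (- (norm z)\<^sup>2 / (4 * \<tau>)))"
  proof -
    have "exp (- (norm z)\<^sup>2 / (4 * \<tau>)) = (\<Prod>b\<in>Basis. exp (- (z \<bullet> b)\<^sup>2 / (4 * \<tau>)))"
      unfolding n by (simp add: exp_sum sum_negf sum_divide_distrib flip: sum_negf)
    then show ?thesis by (simp add: prod.distrib flip: of_real_prod)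
  qed
  finally show "(\<integral>\<xi>. exp (- \<tau> * (norm \<xi>)\<^sup>2) *\<^sub>R cis (\<xi> \<bullet> z) \<partial>lborel)
      = complex_of_real (sqrt (pi / \<tau>) ^ DIM('a) * exp (- (norm z)\<^sup>2 / (4 * \<tau>)))" .
qed

lemma gaussian_cos:
  fixes z :: "'a::euclidean_space"
  assumes "\<tau> > 0"
  shows "integrable lborel (\<lambda>\<xi>::'a. exp (- \<tau> * (norm \<xi>)\<^sup>2) * cos (\<xi> \<bullet> z))"
    and "(\<integral>\<xi>. exp (- \<tau> * (norm \<xi>)\<^sup>2) * cos (\<xi> \<bullet> z) \<partial>lborel)
      = sqrt (pi / \<tau>) ^ DIM('a) * exp (- (norm z)\<^sup>2 / (4 * \<tau>))"
  using integrable_Re[OF gaussian_cis(1)[OF assms, of z]]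
    integral_Re[OF gaussian_cis(1)[OF assms, of z]] unfolding gaussian_cis(2)[OF assms]
  by (simp_all del: of_real_mult)

lemma integrable_gaussian:
  assumes "\<tau> > 0"
  shows "integrable lborel (\<lambda>\<xi>::'a::euclidean_space. exp (- \<tau> * (norm \<xi>)\<^sup>2))"
    and "(\<integral>\<xi>. exp (- \<tau> * (norm \<xi>)\<^sup>2) \<partial>(lborel::'a measure)) = sqrt (pi / \<tau>) ^ DIM('a)"
  using gaussian_cos[OF assms, of "0::'a"] by simp_all

text \<open>Half of the exponent absorbs the quadratic factor, by y \<le> exp y.\<close>

lemma integrable_gaussian_power2:
  assumes "\<tau> > 0"
  shows "integrable lborel (\<lambda>\<xi>::'a::euclidean_space. (norm \<xi>)\<^sup>2 * exp (- \<tau> * (norm \<xi>)\<^sup>2))"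
proof (rule Bochner_Integration.integrable_bound)
  show "integrable lborel (\<lambda>\<xi>::'a. (2/\<tau>) * exp (- (\<tau>/2) * (norm \<xi>)\<^sup>2))"
    using integrable_gaussian(1)[of "\<tau>/2", where 'a='a] assms by simp
  show "AE \<xi> in lborel. norm ((norm (\<xi>::'a))\<^sup>2 * exp (- \<tau> * (norm \<xi>)\<^sup>2))
      \<le> norm ((2/\<tau>) * exp (- (\<tau>/2) * (norm \<xi>)\<^sup>2))"
  proof (rule AE_I2)
    fix \<xi> :: 'a
    have "(\<tau>/2) * (norm \<xi>)\<^sup>2 \<le> exp ((\<tau>/2) * (norm \<xi>)\<^sup>2)" using exp_ge_add_one_self[of "(\<tau>/2) * (norm \<xi>)\<^sup>2"] by linarith
    then have "(\<tau>/2) * (norm \<xi>)\<^sup>2 * exp (- \<tau> * (norm \<xi>)\<^sup>2)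
        \<le> exp ((\<tau>/2) * (norm \<xi>)\<^sup>2) * exp (- \<tau> * (norm \<xi>)\<^sup>2)" by (intro mult_right_mono) auto
    also have "\<dots> = exp (- (\<tau>/2) * (norm \<xi>)\<^sup>2)" by (simp flip: exp_add)
    finally show "norm ((norm \<xi>)\<^sup>2 * exp (- \<tau> * (norm \<xi>)\<^sup>2)) \<le> norm ((2/\<tau>) * exp (- (\<tau>/2) * (norm \<xi>)\<^sup>2))"
      using assms by (simp add: field_simps)
  qed
qed simp

text \<open>The common form of all exchanges of integrals below: the two integrable factors carry
  the integrability, and the kernel (a cosine, a translate of a bounded function, an indicator)
  needs no more than a bound.\<close>

lemma integrable_lborel_kernel:
  fixes f :: "'a::euclidean_space \<Rightarrow> real" and g :: "'b::euclidean_space \<Rightarrow> real"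
  assumes f: "integrable lborel f" and g: "integrable lborel g"
    and k: "case_prod k \<in> borel_measurable (lborel \<Otimes>\<^sub>M lborel)" and b: "\<And>x y. \<bar>k x y\<bar> \<le> K"
  shows "integrable (lborel \<Otimes>\<^sub>M lborel) (\<lambda>(x, y). f x * g y * k x y)"
proof (rule Bochner_Integration.integrable_bound)
  have [measurable]: "f \<in> borel_measurable lborel" "g \<in> borel_measurable lborel" using f g by auto
  note [measurable] = k
  show "integrable (lborel \<Otimes>\<^sub>M lborel) (\<lambda>(x, y). K * (f x * g y))"
  proof (rule lborel_pair.Fubini_integrable)
    show "integrable lborel (\<lambda>x. \<integral>y. norm (case (x, y) of (x, y) \<Rightarrow> K * (f x * g y)) \<partial>lborel)"
      using f by (simp add: abs_mult)
  qed (use g in \<open>auto\<close>)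
  show "(\<lambda>(x, y). f x * g y * k x y) \<in> borel_measurable (lborel \<Otimes>\<^sub>M lborel)" by measurable
  show "AE p in lborel \<Otimes>\<^sub>M lborel. norm (case p of (x, y) \<Rightarrow> f x * g y * k x y)
      \<le> norm (case p of (x, y) \<Rightarrow> K * (f x * g y))"
  proof (rule AE_I2)
    fix p :: "'a \<times> 'b"
    have "0 \<le> K" using b order_trans[OF abs_ge_zero] by blast
    moreover have "\<bar>f x\<bar> * \<bar>g y\<bar> * \<bar>k x y\<bar> \<le> \<bar>f x\<bar> * \<bar>g y\<bar> * K" for x y
      by (intro mult_left_mono b) auto
    ultimately show "norm (case p of (x, y) \<Rightarrow> f x * g y * k x y) \<le> norm (case p of (x, y) \<Rightarrow> K * (f x * g y))"
      by (cases p) (simp add: abs_mult mult_ac)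
  qed
qed

lemma Fubini_lborel_kernel:
  fixes f :: "'a::euclidean_space \<Rightarrow> real" and g :: "'b::euclidean_space \<Rightarrow> real"
  assumes f: "integrable lborel f" and g: "integrable lborel g"
    and k: "case_prod k \<in> borel_measurable (lborel \<Otimes>\<^sub>M lborel)" and b: "\<And>x y. \<bar>k x y\<bar> \<le> K"
  shows "(\<integral>x. f x * (\<integral>y. g y * k x y \<partial>lborel) \<partial>lborel) = (\<integral>y. g y * (\<integral>x. f x * k x y \<partial>lborel) \<partial>lborel)"
proof -
  have "(\<integral>x. f x * (\<integral>y. g y * k x y \<partial>lborel) \<partial>lborel) = (\<integral>x. (\<integral>y. f x * g y * k x y \<partial>lborel) \<partial>lborel)"
    unfolding mult.assoc by simp
  also have "\<dots> = (\<integral>y. (\<integral>x. g y * (f x * k x y) \<partial>lborel) \<partial>lborel)"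
    using lborel_pair.Fubini_integral[OF integrable_lborel_kernel[OF assms]] by (simp add: mult_ac)
  also have "\<dots> = (\<integral>y. g y * (\<integral>x. f x * k x y \<partial>lborel) \<partial>lborel)"
    by simp
  finally show ?thesis .
qed

section \<open>The Fourier transform and the heat semigroup\<close>

text \<open>Sign and normalisation are those of a characteristic function. The factor
  \<open>(1 / (2 * pi)) ^ DIM('a)\<close> is therefore written out wherever a Plancherel-type
  identity is meant.\<close>

definition fourier :: "('a::euclidean_space \<Rightarrow> real) \<Rightarrow> 'a \<Rightarrow> complex" where
  "fourier w \<xi> = (\<integral>x. w x *\<^sub>R cis (\<xi> \<bullet> x) \<partial>lborel)"

lemma cis_inner_cis: "cis a \<bullet> cis b = cos (a - b)"
  by (simp add: inner_complex_def cos_diff)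

lemma integrable_scaleR_cis:
  assumes "integrable lborel (w :: 'a::euclidean_space \<Rightarrow> real)"
  shows "integrable lborel (\<lambda>x. w x *\<^sub>R cis (\<xi> \<bullet> x))"
  by (rule Bochner_Integration.integrable_bound[OF assms]) (use assms in \<open>auto simp: cis_conv_exp\<close>)

lemma norm_fourier_le:
  assumes "integrable lborel w"
  shows "norm (fourier w \<xi>) \<le> (\<integral>x. \<bar>w x\<bar> \<partial>lborel)"
  unfolding fourier_def using integral_norm_bound[of lborel "\<lambda>x. w x *\<^sub>R cis (\<xi> \<bullet> x)"] by simp

lemma fourier_measurable:
  assumes "integrable lborel w"
  shows "fourier w \<in> borel_measurable borel"
proof -
  have [measurable]: "w \<in> borel_measurable borel" using assms by auto
  have "(\<lambda>(\<xi>, x). w x *\<^sub>R cis (\<xi> \<bullet> x)) \<in> borel_measurable (borel \<Otimes>\<^sub>M lborel)"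
    unfolding cis_conv_exp by measurable
  then show ?thesis
    unfolding fourier_def[abs_def] by (rule lborel.borel_measurable_lebesgue_integral)
qed

text \<open>The two factors of the squared modulus are unfolded one after the other. In the first
  exchange the kernel still contains \<open>fourier w\<close>, which is bounded by the integral of
  the modulus of \<open>w\<close>; in the second it is a cosine. The remaining integral over
  frequencies is Gaussian and produces the heat kernel.\<close>

lemma fourier_gaussian_power2:
  fixes w :: "'a::euclidean_space \<Rightarrow> real"
  assumes w: "integrable lborel w" and "\<tau> > 0"
  shows "(\<integral>\<xi>. exp (- \<tau> * (norm \<xi>)\<^sup>2) * (norm (fourier w \<xi>))\<^sup>2 \<partial>lborel) =
    (\<integral>x. w x * (\<integral>y. w y * (sqrt (pi / \<tau>) ^ DIM('a) * exp (- (norm (x - y))\<^sup>2 / (4 * \<tau>))) \<partial>lborel) \<partial>lborel)"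
proof -
  note [measurable] = fourier_measurable[OF w]
  have [measurable]: "w \<in> borel_measurable borel" using w by auto
  let ?e = "\<lambda>\<xi>::'a. exp (- \<tau> * (norm \<xi>)\<^sup>2)"
  note g = integrable_gaussian(1)[OF assms(2), where 'a='a]
  have 1: "z \<bullet> fourier w \<xi> = (\<integral>x. w x * (z \<bullet> cis (\<xi> \<bullet> x)) \<partial>lborel)" for \<xi> z
    unfolding fourier_def using integral_inner_right[OF integrable_scaleR_cis[OF w], of z \<xi>] by simp
  have "(\<integral>\<xi>. ?e \<xi> * (norm (fourier w \<xi>))\<^sup>2 \<partial>lborel)
      = (\<integral>\<xi>. ?e \<xi> * (\<integral>x. w x * (fourier w \<xi> \<bullet> cis (\<xi> \<bullet> x)) \<partial>lborel) \<partial>lborel)"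
    unfolding power2_norm_eq_inner 1 ..
  also have "\<dots> = (\<integral>x. w x * (\<integral>\<xi>. ?e \<xi> * (fourier w \<xi> \<bullet> cis (\<xi> \<bullet> x)) \<partial>lborel) \<partial>lborel)"
  proof (rule Fubini_lborel_kernel[OF g w])
    show "(\<lambda>(\<xi>, x). fourier w \<xi> \<bullet> cis (\<xi> \<bullet> x)) \<in> borel_measurable (lborel \<Otimes>\<^sub>M lborel)"
      unfolding cis_conv_exp by measurable
    show "\<bar>fourier w \<xi> \<bullet> cis (\<xi> \<bullet> x)\<bar> \<le> (\<integral>x. \<bar>w x\<bar> \<partial>lborel)" for \<xi> x
      using Cauchy_Schwarz_ineq2[of "fourier w \<xi>" "cis (\<xi> \<bullet> x)"] norm_fourier_le[OF w, of \<xi>] by simp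
  qed
  also have "\<dots> = (\<integral>x. w x * (\<integral>\<xi>. ?e \<xi> * (\<integral>y. w y * cos (\<xi> \<bullet> (x - y)) \<partial>lborel) \<partial>lborel) \<partial>lborel)"
    unfolding inner_commute[of "fourier w _"] 1 cis_inner_cis by (simp add: inner_diff_right)
  also have "\<dots> = (\<integral>x. w x * (\<integral>y. w y * (\<integral>\<xi>. ?e \<xi> * cos (\<xi> \<bullet> (x - y)) \<partial>lborel) \<partial>lborel) \<partial>lborel)"
    by (subst Fubini_lborel_kernel[OF g w, of _ 1]) auto
  finally show ?thesis unfolding gaussian_cos(2)[OF assms(2)] .
qed

section \<open>Changes of variables and the heat kernel\<close>

lemma lborel_integral_affine:
  fixes f :: "'a::euclidean_space \<Rightarrow> real"
  assumes [measurable]: "f \<in> borel_measurable borel" and "s > 0"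
  shows "(\<integral>y. f y \<partial>lborel) = s ^ DIM('a) * (\<integral>v. f (x + s *\<^sub>R v) \<partial>lborel)"
  by (subst lborel_affine[of s x]) (use assms in \<open>auto simp: integral_density integral_distr\<close>)

lemma lborel_integral_translate:
  fixes f :: "'a::euclidean_space \<Rightarrow> 'b::{banach, second_countable_topology}"
  assumes [measurable]: "f \<in> borel_measurable borel"
  shows "(\<integral>x. f (x + a) \<partial>lborel) = (\<integral>x. f x \<partial>lborel)"
  by (subst (2) lborel_distr_plus[of a, symmetric], subst integral_distr) (auto simp: add.commute)

lemma lborel_integrable_translate:
  fixes f :: "'a::euclidean_space \<Rightarrow> 'b::{banach, second_countable_topology}"
  assumes "integrable lborel f"
  shows "integrable lborel (\<lambda>x. f (x + a))"
proof -
  have "integrable (distr lborel borel ((+) a)) f" using assms by (simp add: lborel_distr_plus)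
  then show ?thesis using assms by (subst (asm) integrable_distr_eq) (auto simp: add.commute)
qed

text \<open>The heat kernel at time 1, of variance 2 in each coordinate. The substitution y = x +
  sqrt \<tau> v reduces every other time to it, leaving \<tau> only in the translation.\<close>

definition std_gaussian :: "'a::euclidean_space \<Rightarrow> real" where
  "std_gaussian v = sqrt (1 / (4 * pi)) ^ DIM('a) * exp (- (1/4) * (norm v)\<^sup>2)"

lemma std_gaussian:
  "integrable lborel (std_gaussian :: 'a::euclidean_space \<Rightarrow> real)"
  "(\<integral>v. std_gaussian v \<partial>(lborel :: 'a measure)) = 1"
  "0 \<le> std_gaussian v"
proof -
  have k: "sqrt (1 / (4 * pi)) ^ DIM('a) * sqrt (pi / (1/4)) ^ DIM('a) = 1"
    unfolding power_mult_distrib[symmetric] by (simp add: real_sqrt_divide mult.commute)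
  show "integrable lborel (std_gaussian :: 'a \<Rightarrow> real)"
    unfolding std_gaussian_def by (intro integrable_mult_right integrable_gaussian) auto
  show "(\<integral>v. std_gaussian v \<partial>(lborel :: 'a measure)) = 1"
    unfolding std_gaussian_def integral_mult_right_zero using k integrable_gaussian(2)[of "1/4", where 'a='a] by simp
  show "0 \<le> std_gaussian v" by (simp add: std_gaussian_def)
qed

text \<open>The heat semigroup at time \<open>\<tau>\<close>, as a Fourier multiplier and as an average over translations.\<close>

lemma fourier_gaussian_eq_average:
  fixes w :: "'a::euclidean_space \<Rightarrow> real"
  assumes w: "integrable lborel w" and b: "\<And>x. \<bar>w x\<bar> \<le> B" and t: "\<tau> > 0"
  shows "(1 / (2 * pi)) ^ DIM('a) * (\<integral>\<xi>. exp (- \<tau> * (norm \<xi>)\<^sup>2) * (norm (fourier w \<xi>))\<^sup>2 \<partial>lborel) =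
    (\<integral>v. std_gaussian v * (\<integral>x. w x * w (x + sqrt \<tau> *\<^sub>R v) \<partial>lborel) \<partial>lborel)"
proof -
  have [measurable]: "w \<in> borel_measurable borel" using w by auto
  have [measurable]: "(std_gaussian :: 'a \<Rightarrow> real) \<in> borel_measurable borel" using std_gaussian(1) by auto
  have k: "(1 / (2 * pi)) ^ DIM('a) * sqrt (pi / \<tau>) ^ DIM('a) * sqrt \<tau> ^ DIM('a) = sqrt (1 / (4 * pi)) ^ DIM('a)"
  proof -
    have "(1 / (2 * pi)) * sqrt (pi / \<tau>) * sqrt \<tau> = sqrt (1 / (4 * pi))"
      using t by (simp add: real_sqrt_divide real_sqrt_mult field_simps)
    then show ?thesis by (metis power_mult_distrib)
  qed
  have 1: "(1 / (2 * pi)) ^ DIM('a) * (\<integral>y. w y * (sqrt (pi / \<tau>) ^ DIM('a) * exp (- (norm (x - y))\<^sup>2 / (4 * \<tau>))) \<partial>lborel)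
    = (\<integral>v. std_gaussian v * w (x + sqrt \<tau> *\<^sub>R v) \<partial>lborel)" for x
  proof -
    let ?J = "\<integral>y. w y * (sqrt (pi / \<tau>) ^ DIM('a) * exp (- (norm (x - y))\<^sup>2 / (4 * \<tau>))) \<partial>lborel"
    have "?J = sqrt \<tau> ^ DIM('a) * (\<integral>v. w (x + sqrt \<tau> *\<^sub>R v) * (sqrt (pi / \<tau>) ^ DIM('a) *
           exp (- (norm (x - (x + sqrt \<tau> *\<^sub>R v)))\<^sup>2 / (4 * \<tau>))) \<partial>lborel)"
      using t by (intro lborel_integral_affine) auto
    also have "\<dots> = sqrt \<tau> ^ DIM('a) * (sqrt (pi / \<tau>) ^ DIM('a) * (\<integral>v. w (x + sqrt \<tau> *\<^sub>R v) * exp (- (1/4) * (norm v)\<^sup>2) \<partial>lborel))"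
      using t by (simp add: power_mult_distrib mult.left_commute[of "w _"])
    finally have "?J = sqrt \<tau> ^ DIM('a) * (sqrt (pi / \<tau>) ^ DIM('a) * (\<integral>v. w (x + sqrt \<tau> *\<^sub>R v) * exp (- (1/4) * (norm v)\<^sup>2) \<partial>lborel))" .
    moreover have "(\<integral>v. std_gaussian v * w (x + sqrt \<tau> *\<^sub>R v) \<partial>lborel)
      = sqrt (1 / (4 * pi)) ^ DIM('a) * (\<integral>v. w (x + sqrt \<tau> *\<^sub>R v) * exp (- (1/4) * (norm v)\<^sup>2) \<partial>lborel)"
      unfolding std_gaussian_def mult.assoc integral_mult_right_zero by (simp add: mult.commute)
    ultimately show ?thesis
      unfolding k[symmetric] by (simp only: mult_ac)
  qed
  have "(1 / (2 * pi)) ^ DIM('a) * (\<integral>\<xi>. exp (- \<tau> * (norm \<xi>)\<^sup>2) * (norm (fourier w \<xi>))\<^sup>2 \<partial>lborel)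
    = (\<integral>x. w x * ((1 / (2 * pi)) ^ DIM('a) * (\<integral>y. w y * (sqrt (pi / \<tau>) ^ DIM('a) * exp (- (norm (x - y))\<^sup>2 / (4 * \<tau>))) \<partial>lborel)) \<partial>lborel)"
    unfolding fourier_gaussian_power2[OF w t] by (simp only: integral_mult_right_zero mult.left_commute[of "w _"])
  also have "\<dots> = (\<integral>v. std_gaussian v * (\<integral>x. w x * w (x + sqrt \<tau> *\<^sub>R v) \<partial>lborel) \<partial>lborel)"
    unfolding 1 by (rule Fubini_lborel_kernel[OF w std_gaussian(1)]) (use b in auto)
  finally show ?thesis .
qed

lemma integrable_power2_of_bounded:
  fixes w :: "'a \<Rightarrow> real"
  assumes w: "integrable M w" and b: "\<And>x. \<bar>w x\<bar> \<le> B"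
  shows "integrable M (\<lambda>x. (w x)\<^sup>2)"
proof (rule Bochner_Integration.integrable_bound)
  show "integrable M (\<lambda>x. B * w x)" using w by simp
  show "AE x in M. norm ((w x)\<^sup>2) \<le> norm (B * w x)"
  proof (rule AE_I2)
    fix x
    have "\<bar>w x\<bar> * \<bar>w x\<bar> \<le> \<bar>B\<bar> * \<bar>w x\<bar>"
      using b[of x] by (intro mult_right_mono) auto
    then show "norm ((w x)\<^sup>2) \<le> norm (B * w x)" by (simp add: power2_eq_square abs_mult)
  qed
qed (use w in auto)

lemma autocorrelation_le:
  fixes w :: "'a::euclidean_space \<Rightarrow> real"
  assumes w: "integrable lborel w" and b: "\<And>x. \<bar>w x\<bar> \<le> B"
  shows "\<bar>\<integral>x. w x * w (x + a) \<partial>lborel\<bar> \<le> (\<integral>x. (w x)\<^sup>2 \<partial>lborel)"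
proof -
  have [measurable]: "w \<in> borel_measurable borel" using w by auto
  have "L2 lborel w" "L2 lborel (\<lambda>x. w (x + a))"
    using integrable_power2_of_bounded[OF w b] lborel_integrable_translate[OF integrable_power2_of_bounded[OF w b]]
    by (auto simp: L2_def)
  from l2_cauchy_schwarz[OF this]
  show ?thesis
    using lborel_integral_translate[of "\<lambda>x. (w x)\<^sup>2" a]
    by (simp add: l2_inner_def l2_norm_def)
qed

text \<open>The autocorrelation of \<open>w\<close> is largest at shift 0, and
  \<open>std_gaussian\<close> is a probability density. This half of Plancherel later bounds the
  damped form by the Dirichlet form, for every \<tau>.\<close>

lemma fourier_gaussian_le:
  fixes w :: "'a::euclidean_space \<Rightarrow> real"
  assumes w: "integrable lborel w" and b: "\<And>x. \<bar>w x\<bar> \<le> B" and t: "\<tau> > 0"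
  shows "(1 / (2 * pi)) ^ DIM('a) * (\<integral>\<xi>. exp (- \<tau> * (norm \<xi>)\<^sup>2) * (norm (fourier w \<xi>))\<^sup>2 \<partial>lborel)
    \<le> (\<integral>x. (w x)\<^sup>2 \<partial>lborel)"
proof -
  have [measurable]: "w \<in> borel_measurable borel" using w by auto
  let ?I = "\<lambda>v. \<integral>x. w x * w (x + sqrt \<tau> *\<^sub>R v) \<partial>lborel"
  have "(\<integral>v. std_gaussian v * ?I v \<partial>lborel) \<le> (\<integral>v. std_gaussian (v::'a) * (\<integral>x. (w x)\<^sup>2 \<partial>lborel) \<partial>lborel)"
  proof (rule integral_mono_AE')
    show "integrable lborel (\<lambda>v. std_gaussian (v::'a) * (\<integral>x. (w x)\<^sup>2 \<partial>lborel))"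
      by (intro integrable_mult_left std_gaussian)
    show "AE v in lborel. std_gaussian v * ?I v \<le> std_gaussian (v::'a) * (\<integral>x. (w x)\<^sup>2 \<partial>lborel)"
      using autocorrelation_le[OF w b] by (intro AE_I2 mult_left_mono std_gaussian(3)) (auto intro: order_trans[OF abs_ge_self])
    show "AE v in lborel. 0 \<le> std_gaussian (v::'a) * (\<integral>x. (w x)\<^sup>2 \<partial>lborel)"
      by (intro AE_I2 mult_nonneg_nonneg std_gaussian(3)) auto
  qed
  then show ?thesis
    unfolding fourier_gaussian_eq_average[OF w b t] by (simp add: std_gaussian)
qed

text \<open>The substitute for Plancherel's identity. Continuity of \<open>w\<close> makes the
  translates converge pointwise as the shift tends to 0; dominated convergence is applied first to
  the autocorrelation, with majorant \<open>B * \<bar>w x\<bar>\<close>, and then to the Gaussian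
  average.\<close>

lemma fourier_gaussian_tendsto:
  fixes w :: "'a::euclidean_space \<Rightarrow> real"
  assumes w: "integrable lborel w" and b: "\<And>x. \<bar>w x\<bar> \<le> B" and c: "continuous_on UNIV w"
    and t: "\<And>n. \<tau> n > 0" "\<tau> \<longlonglongrightarrow> 0"
  shows "(\<lambda>n. (1 / (2 * pi)) ^ DIM('a) * (\<integral>\<xi>. exp (- \<tau> n * (norm \<xi>)\<^sup>2) * (norm (fourier w \<xi>))\<^sup>2 \<partial>lborel))
    \<longlonglongrightarrow> (\<integral>x. (w x)\<^sup>2 \<partial>lborel)"
proof -
  have [measurable]: "w \<in> borel_measurable borel" using w by auto
  have [measurable]: "(std_gaussian :: 'a \<Rightarrow> real) \<in> borel_measurable borel" using std_gaussian(1) by auto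
  let ?I = "\<lambda>n v. \<integral>x. w x * w (x + sqrt (\<tau> n) *\<^sub>R v) \<partial>lborel"
  have I: "(\<lambda>n. ?I n v) \<longlonglongrightarrow> (\<integral>x. w x * w x \<partial>lborel)" for v
  proof (rule integral_dominated_convergence)
    show "integrable lborel (\<lambda>x. B * \<bar>w x\<bar>)" using w by simp
    show "AE x in lborel. (\<lambda>n. w x * w (x + sqrt (\<tau> n) *\<^sub>R v)) \<longlonglongrightarrow> w x * w x"
    proof (rule AE_I2)
      fix x
      have "(\<lambda>n. x + sqrt (\<tau> n) *\<^sub>R v) \<longlonglongrightarrow> x + sqrt 0 *\<^sub>R v"
        by (intro tendsto_intros t)
      then have "(\<lambda>n. x + sqrt (\<tau> n) *\<^sub>R v) \<longlonglongrightarrow> x" by simp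
      from continuous_on_tendsto_compose[OF c this] have "(\<lambda>n. w (x + sqrt (\<tau> n) *\<^sub>R v)) \<longlonglongrightarrow> w x"
        by simp
      then show "(\<lambda>n. w x * w (x + sqrt (\<tau> n) *\<^sub>R v)) \<longlonglongrightarrow> w x * w x" by (intro tendsto_mult tendsto_const)
    qed
    show "AE x in lborel. norm (w x * w (x + sqrt (\<tau> n) *\<^sub>R v)) \<le> B * \<bar>w x\<bar>" for n
      using b by (auto simp: abs_mult mult.commute[of B] intro!: AE_I2 mult_left_mono)
  qed auto
  have "(\<lambda>n. \<integral>v. std_gaussian v * ?I n v \<partial>lborel) \<longlonglongrightarrow> (\<integral>v. std_gaussian (v::'a) * (\<integral>x. w x * w x \<partial>lborel) \<partial>lborel)"
  proof (rule integral_dominated_convergence)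
    show "integrable lborel (\<lambda>v. std_gaussian (v::'a) * (\<integral>x. (w x)\<^sup>2 \<partial>lborel))"
      by (intro integrable_mult_left std_gaussian)
    show "AE v in lborel. (\<lambda>n. std_gaussian v * ?I n v) \<longlonglongrightarrow> std_gaussian v * (\<integral>x. w x * w x \<partial>lborel)"
      by (intro AE_I2 tendsto_mult tendsto_const I)
    show "AE v in lborel. norm (std_gaussian v * ?I n v) \<le> std_gaussian (v::'a) * (\<integral>x. (w x)\<^sup>2 \<partial>lborel)" for n
      unfolding real_norm_def abs_mult abs_of_nonneg[OF std_gaussian(3)]
      by (intro AE_I2 mult_left_mono autocorrelation_le[OF w b] std_gaussian(3))
  qed (auto intro!: lborel.borel_measurable_lebesgue_integral)
  then show ?thesis
    unfolding fourier_gaussian_eq_average[OF w b t(1)] by (simp add: std_gaussian power2_eq_square)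
qed

section \<open>Test functions\<close>

lemma smooth_differentiable: "smooth f \<Longrightarrow> f differentiable (at x)"
  unfolding smooth_def by (metis C_k.simps(2))

lemma smooth_has_derivative: "smooth f \<Longrightarrow> (f has_derivative frechet_derivative f (at x)) (at x)"
  using smooth_differentiable frechet_derivative_works by blast

lemma smooth_directional_derivative: "smooth f \<Longrightarrow> smooth (\<lambda>x. frechet_derivative f (at x) v)"
  unfolding smooth_def by (metis C_k.simps(2))

lemma smooth_continuous: "smooth f \<Longrightarrow> continuous_on UNIV f"
  unfolding smooth_def by (metis C_k.simps(1))

lemma C_k_diff: "C_k k f \<Longrightarrow> C_k k g \<Longrightarrow> C_k k (\<lambda>x. f x - g x)"
proof (induction k arbitrary: f g)
  case 0
  then show ?case by (auto intro: continuous_intros)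
next
  case (Suc k)
  then have d: "f differentiable (at x)" "g differentiable (at x)" for x by auto
  have "frechet_derivative (\<lambda>x. f x - g x) (at x) = (\<lambda>v. frechet_derivative f (at x) v - frechet_derivative g (at x) v)" for x
    by (intro frechet_derivative_at[symmetric] has_derivative_diff) (use d frechet_derivative_works in auto)
  with Suc d show ?case by (auto intro: differentiable_diff)
qed

lemma smooth_diff: "smooth f \<Longrightarrow> smooth g \<Longrightarrow> smooth (\<lambda>x. f x - g x)"
  unfolding smooth_def by (auto intro: C_k_diff)

lemma gradient_inner_Basis: "b \<in> Basis \<Longrightarrow> gradient f x \<bullet> b = frechet_derivative f (at x) b"
  unfolding gradient_def by simp

lemma gradient_diff:
  assumes "smooth f" "smooth g"
  shows "gradient (\<lambda>x. f x - g x) x = gradient f x - gradient g x"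
proof -
  have "frechet_derivative (\<lambda>x. f x - g x) (at x) = (\<lambda>v. frechet_derivative f (at x) v - frechet_derivative g (at x) v)"
    by (intro frechet_derivative_at[symmetric] has_derivative_diff smooth_has_derivative assms)
  then show ?thesis
    by (simp add: gradient_def scaleR_diff_left sum_subtractf)
qed

lemma continuous_gradient: "smooth f \<Longrightarrow> continuous_on UNIV (gradient f)"
  unfolding gradient_def[abs_def]
  by (intro continuous_intros smooth_continuous smooth_directional_derivative)

lemma frechet_derivative_eq_0_outside:
  fixes f :: "'a::real_normed_vector \<Rightarrow> 'b::real_normed_vector"
  assumes "x \<notin> closure {x. f x \<noteq> 0}"
  shows "frechet_derivative f (at x) v = 0"
proof -
  have "(f has_derivative (\<lambda>_. 0)) (at x)"
  proof (rule has_derivative_transform_within_open)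
    show "((\<lambda>_. 0) has_derivative (\<lambda>_. 0)) (at x)" by simp
    show "open (- closure {x. f x \<noteq> 0})" by (intro open_Compl closed_closure)
    show "x \<in> - closure {x. f x \<noteq> 0}" using assms by simp
    show "0 = f y" if "y \<in> - closure {x. f x \<noteq> 0}" for y
      using that closure_subset[of "{x. f x \<noteq> 0}"] by auto
  qed
  from frechet_derivative_at[OF this, symmetric] show ?thesis by simp
qed

lemma test_function_subsetI:
  assumes "smooth g" "test_function S f" "\<And>x. x \<notin> closure {x. f x \<noteq> 0} \<Longrightarrow> g x = 0"
  shows "test_function S g"
proof -
  have "closure {x. g x \<noteq> 0} \<subseteq> closure {x. f x \<noteq> 0}"
    using assms(3) by (intro closure_minimal) auto
  then show ?thesis
    using assms(1,2) unfolding test_function_def compact_eq_bounded_closed by (auto intro: bounded_subset)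
qed

lemma test_function_smooth: "test_function S f \<Longrightarrow> smooth f"
  by (simp add: test_function_def)

lemma test_function_directional_derivative:
  assumes "test_function S f"
  shows "test_function S (\<lambda>x. frechet_derivative f (at x) v)"
  by (rule test_function_subsetI[OF _ assms])
    (use assms in \<open>auto simp: frechet_derivative_eq_0_outside test_function_smooth smooth_directional_derivative\<close>)

lemma test_function_eq_0:
  assumes "test_function S f" "x \<notin> S"
  shows "f x = 0"
  using assms closure_subset[of "{x. f x \<noteq> 0}"] unfolding test_function_def by auto

lemma test_function_diff:
  assumes "test_function S f" "test_function S g"
  shows "test_function S (\<lambda>x. f x - g x)"
proof -
  have sub: "closure {x. f x - g x \<noteq> 0} \<subseteq> closure {x. f x \<noteq> 0} \<union> closure {x. g x \<noteq> 0}"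
    unfolding closure_Un[symmetric] by (intro closure_mono) auto
  have K: "compact (closure {x. f x \<noteq> 0} \<union> closure {x. g x \<noteq> 0})"
    "closure {x. f x \<noteq> 0} \<union> closure {x. g x \<noteq> 0} \<subseteq> S"
    using assms by (auto simp: test_function_def)
  have "bounded (closure {x. f x - g x \<noteq> 0})"
    by (rule bounded_subset[OF compact_imp_bounded[OF K(1)] sub])
  then have "compact (closure {x. f x - g x \<noteq> 0})" by (simp add: compact_eq_bounded_closed)
  moreover have "smooth (\<lambda>x. f x - g x)" using assms by (intro smooth_diff test_function_smooth)
  ultimately show ?thesis
    using order_trans[OF sub K(2)] unfolding test_function_def by blast
qed

section \<open>Integrals of compactly supported functions and integration by parts\<close>

lemma integrable_compact_support:
  fixes f :: "'a::euclidean_space \<Rightarrow> 'b::euclidean_space"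
  assumes c: "continuous_on UNIV f" and K: "compact K" and z: "\<And>x. x \<notin> K \<Longrightarrow> f x = 0"
  shows "integrable lborel f"
proof -
  have "integrable lborel (\<lambda>x. indicator K x *\<^sub>R f x)"
    using borel_integrable_compact[OF K continuous_on_subset[OF c]] by simp
  moreover have "(\<lambda>x. indicator K x *\<^sub>R f x) = f"
    using z by (auto simp: indicator_def fun_eq_iff)
  ultimately show ?thesis by simp
qed

lemma bounded_compact_support:
  fixes f :: "'a::euclidean_space \<Rightarrow> 'b::euclidean_space"
  assumes c: "continuous_on UNIV f" and K: "compact K" and z: "\<And>x. x \<notin> K \<Longrightarrow> f x = 0"
  obtains B where "B > 0" "\<And>x. norm (f x) \<le> B"
proof -
  have "bounded (f ` K)" using continuous_on_subset[OF c, of K] K by (auto intro: compact_imp_bounded compact_continuous_image)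
  then obtain B where B: "B > 0" "\<And>x. x \<in> K \<Longrightarrow> norm (f x) \<le> B" unfolding bounded_pos by auto
  then show ?thesis using z that[of B] by (metis less_imp_le norm_zero)
qed

text \<open>Integration by parts without iterated integrals: the difference quotients have integral
  0 by translation invariance, and dominated convergence passes to the derivative. Vector values are
  allowed because the result is applied to a complex-valued product.\<close>

lemma integral_directional_derivative_eq_0:
  fixes h :: "'a::euclidean_space \<Rightarrow> 'b::euclidean_space"
  assumes D: "\<And>x. (h has_derivative D x) (at x)"
    and c: "continuous_on UNIV (\<lambda>x. D x b)"
    and K: "compact K" and h0: "\<And>x. x \<notin> K \<Longrightarrow> h x = 0" and D0: "\<And>x. x \<notin> K \<Longrightarrow> D x b = 0"
  shows "(\<integral>x. D x b \<partial>lborel) = 0"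
proof -
  have ch: "continuous_on UNIV h" using D has_derivative_continuous_on by blast
  have hi: "integrable lborel h" by (rule integrable_compact_support[OF ch K h0])
  have [measurable]: "h \<in> borel_measurable borel" "(\<lambda>x. D x b) \<in> borel_measurable borel"
    using ch c by (auto intro: borel_measurable_continuous_onI)
  obtain B where B: "B > 0" "\<And>x. norm (D x b) \<le> B"
    using bounded_compact_support[OF c K D0] by blast
  define s where "s n = inverse (real (Suc n))" for n
  have s: "0 < s n" "s n \<le> 1" for n by (auto simp: s_def divide_simps)
  have s0: "s \<longlonglongrightarrow> 0" unfolding s_def using LIMSEQ_inverse_real_of_nat .
  let ?q = "\<lambda>n x. (1 / s n) *\<^sub>R (h (x + s n *\<^sub>R b) - h x)"
  \<comment> \<open>All points from which \<open>K\<close> is reached by adding a multiple r in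
    \<open>{0..1}\<close> of \<open>b\<close>. Since \<open>s n \<le> 1\<close>, every difference
    quotient vanishes off this compact set, so \<open>B * indicator K'\<close> is an integrable
    majorant for all n.\<close>
  define K' where "K' = (\<lambda>(x, r). x - r *\<^sub>R b) ` (K \<times> {0..1})"
  have K': "compact K'" unfolding K'_def
    by (intro compact_continuous_image compact_Times K) (auto simp: case_prod_unfold intro!: continuous_intros)
  have lim: "(\<lambda>n. ?q n x) \<longlonglongrightarrow> D x b" for x
  proof -
    have "((\<lambda>r. h (x + r *\<^sub>R b)) has_derivative (\<lambda>r. D x (r *\<^sub>R b))) (at 0)"
      by (rule has_derivative_compose[of "\<lambda>r. x + r *\<^sub>R b" _ 0 UNIV h, simplified])
         (auto intro!: derivative_eq_intros D)
    then have "((\<lambda>r. norm (h (x + r *\<^sub>R b) - h (x + 0 *\<^sub>R b) - D x ((r - 0) *\<^sub>R b)) / norm (r - 0)) \<longlongrightarrow> 0) (at 0)"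
      by (simp only: has_derivative_iff_norm)
    moreover have "filterlim s (at 0) sequentially"
      using s0 s(1) by (auto simp: filterlim_at intro!: always_eventually) (metis less_irrefl)
    ultimately have "(\<lambda>n. norm (h (x + s n *\<^sub>R b) - h (x + 0 *\<^sub>R b) - D x ((s n - 0) *\<^sub>R b)) / norm (s n - 0)) \<longlonglongrightarrow> 0"
      by (rule filterlim_compose)
    moreover have "norm (h (x + s n *\<^sub>R b) - h (x + 0 *\<^sub>R b) - D x ((s n - 0) *\<^sub>R b)) / norm (s n - 0)
       = norm (?q n x - D x b)" for n
    proof -
      have "h (x + s n *\<^sub>R b) - h (x + 0 *\<^sub>R b) - D x ((s n - 0) *\<^sub>R b) = s n *\<^sub>R (?q n x - D x b)"
        using s[of n] linear_scale[OF has_derivative_linear[OF D]] by (simp add: scaleR_diff_right)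
      then show ?thesis using s[of n] by simp
    qed
    ultimately have "(\<lambda>n. norm (?q n x - D x b)) \<longlonglongrightarrow> 0" by simp
    from tendsto_norm_zero_cancel[OF this] show ?thesis by (rule LIM_zero_cancel)
  qed
  have bd: "norm (?q n x) \<le> B * indicator K' x" for n x
  proof (cases "x \<in> K'")
    case True
    have "\<exists>r\<in>{0<..<s n}. norm (h (x + s n *\<^sub>R b) - h (x + 0 *\<^sub>R b)) \<le> norm (D (x + r *\<^sub>R b) ((s n - 0) *\<^sub>R b))"
    proof (rule mvt_general[OF s(1)])
      show "continuous_on {0..s n} (\<lambda>r. h (x + r *\<^sub>R b))"
        by (intro continuous_on_compose2[OF ch] continuous_intros) auto
      show "((\<lambda>r. h (x + r *\<^sub>R b)) has_derivative (\<lambda>y. D (x + r *\<^sub>R b) (y *\<^sub>R b))) (at r)" for r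
        by (rule has_derivative_compose[of "\<lambda>r. x + r *\<^sub>R b" _ r UNIV h, simplified])
         (auto intro!: derivative_eq_intros D)
    qed
    then obtain r where "norm (h (x + s n *\<^sub>R b) - h x) \<le> norm (D (x + r *\<^sub>R b) (s n *\<^sub>R b))" by auto
    also have "\<dots> = s n * norm (D (x + r *\<^sub>R b) b)"
      using s linear_scale[OF has_derivative_linear[OF D]] by (simp add: less_imp_le)
    also have "\<dots> \<le> s n * B" using s B by (intro mult_left_mono) (auto simp: less_imp_le)
    finally have "norm (h (x + s n *\<^sub>R b) - h x) / s n \<le> B" using s[of n] by (simp add: field_simps)
    moreover have "norm (?q n x) = norm (h (x + s n *\<^sub>R b) - h x) / s n" using s[of n] by simp
    ultimately have "norm (?q n x) \<le> B" by (simp only:)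
    then show ?thesis unfolding indicator_simps(1)[OF True] mult_1_right .
  next
    case False
    have "x + r *\<^sub>R b \<notin> K" if "0 \<le> r" "r \<le> 1" for r
    proof
      assume "x + r *\<^sub>R b \<in> K"
      then have "(x + r *\<^sub>R b, r) \<in> K \<times> {0..1}" using that by simp
      from imageI[OF this, of "\<lambda>(x, r). x - r *\<^sub>R b"] False show False by (simp add: K'_def)
    qed
    from this[of 0] this[of "s n"] have "x \<notin> K" "x + s n *\<^sub>R b \<notin> K"
      using s[of n] by (simp_all add: less_imp_le)
    then show ?thesis using h0 B(1) by simp
  qed
  have "(\<lambda>n. \<integral>x. ?q n x \<partial>lborel) \<longlonglongrightarrow> (\<integral>x. D x b \<partial>lborel)"
  proof (rule integral_dominated_convergence)
    show "integrable lborel (\<lambda>x. B * indicator K' x :: real)"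
      by (intro integrable_mult_right integrable_real_indicator emeasure_compact_finite K') (use K' in \<open>simp add: compact_imp_closed\<close>)
  qed (use lim bd in auto)
  moreover have "(\<integral>x. ?q n x \<partial>lborel) = 0" for n
    using lborel_integral_translate[of h "s n *\<^sub>R b"] lborel_integrable_translate[OF hi, of "s n *\<^sub>R b"] hi by simp
  ultimately have "(\<lambda>_. 0) \<longlonglongrightarrow> (\<integral>x. D x b \<partial>lborel)" by (simp only:)
  then show ?thesis by (simp only: LIMSEQ_const_iff)
qed

lemma test_function_compact_support:
  assumes "test_function S f"
  obtains K where "compact K" "K \<subseteq> S" "\<And>x. x \<notin> K \<Longrightarrow> f x = 0"
proof (rule that)
  show "compact (closure {x. f x \<noteq> 0})" "closure {x. f x \<noteq> 0} \<subseteq> S"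
    using assms by (simp_all add: test_function_def)
  show "f x = 0" if "x \<notin> closure {x. f x \<noteq> 0}" for x
    using that closure_subset[of "{x. f x \<noteq> 0}"] by auto
qed

lemma test_function_continuous: "test_function S f \<Longrightarrow> continuous_on UNIV f"
  by (simp add: test_function_smooth smooth_continuous)

lemma test_function_integrable:
  assumes "test_function S f"
  shows "integrable lborel f"
proof -
  obtain K where K: "compact K" "K \<subseteq> S" "\<And>x. x \<notin> K \<Longrightarrow> f x = 0"
    by (rule test_function_compact_support[OF assms]) (rule that)
  from K(1,3) show ?thesis by (rule integrable_compact_support[OF test_function_continuous[OF assms]])
qed

lemma test_function_bounded:
  assumes "test_function S f"
  obtains B where "B > 0" "\<And>x. \<bar>f x\<bar> \<le> B"
proof -
  obtain K where K: "compact K" "K \<subseteq> S" "\<And>x. x \<notin> K \<Longrightarrow> f x = 0"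
    by (rule test_function_compact_support[OF assms]) (rule that)
  show ?thesis
    by (rule bounded_compact_support[OF test_function_continuous[OF assms] K(1,3)]) (auto intro: that)
qed

section \<open>Test functions and their derivatives as elements of the space L2 over S\<close>

lemma integral_lebesgue_on_eq_lborel:
  fixes f :: "'a::euclidean_space \<Rightarrow> 'b::euclidean_space"
  assumes "S \<in> sets lebesgue" and [measurable]: "f \<in> borel_measurable borel" and z: "\<And>x. x \<notin> S \<Longrightarrow> f x = 0"
  shows "integral\<^sup>L (lebesgue_on S) f = integral\<^sup>L lborel f"
proof -
  have "(\<lambda>x. indicator S x *\<^sub>R f x) = f" using z by (auto simp: indicator_def fun_eq_iff)
  then have "integral\<^sup>L (lebesgue_on S) f = integral\<^sup>L lebesgue f"
    using assms(1) by (simp add: integral_restrict_space)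
  then show ?thesis by (simp add: integral_completion)
qed

lemma integrable_lebesgue_on_of_lborel:
  fixes f :: "'a::euclidean_space \<Rightarrow> 'b::euclidean_space"
  assumes "S \<in> sets lebesgue" "integrable lborel f"
  shows "integrable (lebesgue_on S) f"
proof -
  have "integrable lebesgue f" using assms(2) by (simp add: integrable_completion)
  then have "set_integrable lebesgue S f" unfolding set_integrable_def
    using assms(1) integrable_mult_indicator by blast
  then show ?thesis using assms(1) by (simp add: integrable_restrict_space set_integrable_def)
qed

lemma L2_compact_support:
  fixes f :: "'a::euclidean_space \<Rightarrow> 'b::euclidean_space"
  assumes c: "continuous_on UNIV f" and K: "compact K" and z: "\<And>x. x \<notin> K \<Longrightarrow> f x = 0" and S: "S \<in> sets lebesgue"
  shows "L2 (lebesgue_on S) f"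
proof -
  have "integrable lborel (\<lambda>x. (norm (f x))\<^sup>2)"
    by (rule integrable_compact_support[OF _ K]) (use z in \<open>auto intro!: continuous_intros c\<close>)
  moreover have "f \<in> borel_measurable (lebesgue_on S)"
    using integrable_lebesgue_on_of_lborel[OF S integrable_compact_support[OF c K z]] by auto
  ultimately show ?thesis unfolding L2_def using S integrable_lebesgue_on_of_lborel by blast
qed

lemma test_function_L2:
  assumes "test_function S f" "S \<in> sets lebesgue"
  shows "L2 (lebesgue_on S) f"
proof -
  obtain K where K: "compact K" "K \<subseteq> S" "\<And>x. x \<notin> K \<Longrightarrow> f x = 0"
    by (rule test_function_compact_support[OF assms(1)]) (rule that)
  from K(1,3) show ?thesis by (rule L2_compact_support[OF test_function_continuous[OF assms(1)] _ _ assms(2)])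
qed

lemma gradient_compact_support:
  assumes "test_function S f"
  obtains K where "compact K" "K \<subseteq> S" "\<And>x. x \<notin> K \<Longrightarrow> gradient f x = 0"
proof (rule that)
  show "compact (closure {x. f x \<noteq> 0})" "closure {x. f x \<noteq> 0} \<subseteq> S"
    using assms by (simp_all add: test_function_def)
  show "gradient f x = 0" if "x \<notin> closure {x. f x \<noteq> 0}" for x
    using that by (simp add: gradient_def frechet_derivative_eq_0_outside)
qed

lemma test_function_gradient_L2:
  assumes "test_function S f" "S \<in> sets lebesgue"
  shows "L2 (lebesgue_on S) (gradient f)"
proof -
  obtain K where K: "compact K" "K \<subseteq> S" "\<And>x. x \<notin> K \<Longrightarrow> gradient f x = 0"
    by (rule gradient_compact_support[OF assms(1)]) (rule that)
  show ?thesis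
    by (rule L2_compact_support[OF continuous_gradient[OF test_function_smooth[OF assms(1)]] K(1,3) assms(2)])
qed

lemma test_function_power2_eq:
  assumes "test_function S f" "S \<in> sets lebesgue"
  shows "(\<integral>x. (f x)\<^sup>2 \<partial>lborel) = (l2_norm (lebesgue_on S) f)\<^sup>2"
proof -
  have "f \<in> borel_measurable borel" using test_function_integrable[OF assms(1)] by auto
  then show ?thesis unfolding l2_norm_power2 l2_inner_def
    by (subst integral_lebesgue_on_eq_lborel[OF assms(2)])
       (use test_function_eq_0[OF assms(1)] in \<open>auto simp: power2_eq_square\<close>)
qed

lemma sum_directional_derivatives_power2:
  assumes f: "test_function S f" and S: "S \<in> sets lebesgue"
  shows "(\<Sum>b\<in>Basis. \<integral>x. (frechet_derivative f (at x) b)\<^sup>2 \<partial>lborel) = (l2_norm (lebesgue_on S) (gradient f))\<^sup>2"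
proof -
  have L: "L2 (lebesgue_on S) (\<lambda>x. frechet_derivative f (at x) b)" for b
    by (rule test_function_L2[OF test_function_directional_derivative[OF f] S])
  have i: "integrable (lebesgue_on S) (\<lambda>x. (frechet_derivative f (at x) b)\<^sup>2)" for b
    using L2_D(2)[OF L[of b]] by simp
  have g: "gradient f x \<bullet> gradient f x = (\<Sum>b\<in>Basis. (frechet_derivative f (at x) b)\<^sup>2)" for x
    by (subst euclidean_inner) (simp add: gradient_inner_Basis power2_eq_square)
  have "(\<Sum>b\<in>Basis. \<integral>x. (frechet_derivative f (at x) b)\<^sup>2 \<partial>lborel)
      = (\<Sum>b\<in>Basis. \<integral>x. (frechet_derivative f (at x) b)\<^sup>2 \<partial>lebesgue_on S)"
    unfolding test_function_power2_eq[OF test_function_directional_derivative[OF f] S] l2_norm_power2 l2_inner_def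
    by (simp add: power2_eq_square)
  also have "\<dots> = (l2_norm (lebesgue_on S) (gradient f))\<^sup>2"
    unfolding l2_norm_power2 l2_inner_def g using i by simp
  finally show ?thesis .
qed

text \<open>\<open>D\<close> is the derivative of the compactly supported product of
  \<open>f\<close> with the character, so \<open>D x b\<close> integrates to 0. Its two terms say
  that the transform of the derivative is -i (\<xi> \<bullet> b) times that of
  \<open>f\<close>.\<close>

lemma norm_fourier_directional_derivative:
  assumes f: "test_function S f" and b: "b \<in> Basis"
  shows "(norm (fourier (\<lambda>x. frechet_derivative f (at x) b) \<xi>))\<^sup>2 = (\<xi> \<bullet> b)\<^sup>2 * (norm (fourier f \<xi>))\<^sup>2"
proof -
  note sm = test_function_smooth[OF f]
  let ?f' = "\<lambda>x. frechet_derivative f (at x) b"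
  define D where "D x v = frechet_derivative f (at x) v *\<^sub>R cis (\<xi> \<bullet> x) + f x *\<^sub>R ((\<xi> \<bullet> v) *\<^sub>R (\<i> * cis (\<xi> \<bullet> x)))" for x v
  let ?K = "closure {x. f x \<noteq> 0}"
  have c: "continuous_on UNIV f" "continuous_on UNIV ?f'"
    by (auto intro: smooth_continuous sm smooth_directional_derivative)
  have i: "integrable lborel f" "integrable lborel ?f'"
    using test_function_integrable[OF f] test_function_integrable[OF test_function_directional_derivative[OF f]] by auto
  have "(\<integral>x. D x b \<partial>lborel) = 0"
  proof (rule integral_directional_derivative_eq_0)
    show "((\<lambda>x. f x *\<^sub>R cis (\<xi> \<bullet> x)) has_derivative D x) (at x)" for x
      unfolding D_def[abs_def]
      by (auto intro!: derivative_eq_intros smooth_has_derivative[OF sm])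
    show "continuous_on UNIV (\<lambda>x. D x b)"
      unfolding D_def by (intro continuous_intros c)
    show "compact ?K" using f by (simp add: test_function_def)
    show "f x *\<^sub>R cis (\<xi> \<bullet> x) = 0" if "x \<notin> ?K" for x
      using that closure_subset[of "{x. f x \<noteq> 0}"] by auto
    show "D x b = 0" if "x \<notin> ?K" for x
      using that closure_subset[of "{x. f x \<noteq> 0}"] by (auto simp: D_def frechet_derivative_eq_0_outside)
  qed
  moreover have De: "D x b = ?f' x *\<^sub>R cis (\<xi> \<bullet> x) + (\<i> * complex_of_real (\<xi> \<bullet> b)) * (f x *\<^sub>R cis (\<xi> \<bullet> x))" for x
    by (simp add: D_def scaleR_conv_of_real)
  ultimately have "fourier ?f' \<xi> + (\<i> * complex_of_real (\<xi> \<bullet> b)) * fourier f \<xi> = 0"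
    by (simp only: De fourier_def integral_mult_right_zero Bochner_Integration.integral_add[OF integrable_scaleR_cis[OF i(2)]
        integrable_mult_right[OF integrable_scaleR_cis[OF i(1)]]])
  then have "fourier ?f' \<xi> = - (\<i> * complex_of_real (\<xi> \<bullet> b)) * fourier f \<xi>"
    by (simp add: eq_neg_iff_add_eq_0)
  then show ?thesis by (simp add: norm_mult power_mult_distrib)
qed

text \<open>Layer cake: inside the ball, R^2 - |\<xi>|^2 is the integral of 2 s over s between
  |\<xi>| and R. After the exchange, the inner integral is the volume of the ball of radius s, and 2
  s^(d+1) remains to be integrated over \<open>{0..R}\<close>.\<close>

lemma integral_bathtub:
  fixes R :: real
  assumes R: "R > 0"
  shows "integrable lborel (\<lambda>\<xi>::'a::euclidean_space. max 0 (R\<^sup>2 - (norm \<xi>)\<^sup>2))"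
    and "(\<integral>\<xi>. max 0 (R\<^sup>2 - (norm \<xi>)\<^sup>2) \<partial>(lborel :: 'a measure))
      = unit_ball_vol (real DIM('a)) * (2 * R ^ (DIM('a) + 2) / (real DIM('a) + 2))"
proof -
  let ?f = "indicator (ball 0 R) :: 'a \<Rightarrow> real"
  define g :: "real \<Rightarrow> real" where "g s = (2 * s) * indicator {0..R} s" for s
  define k :: "'a \<Rightarrow> real \<Rightarrow> real" where "k \<xi> s = (if norm \<xi> < s then 1 else 0)" for \<xi> s
  have f: "integrable lborel ?f" by (intro integrable_real_indicator) (auto simp: emeasure_ball R less_imp_le)
  have g: "integrable lborel g"
    unfolding g_def[abs_def] mult.assoc by (intro integrable_mult_right) 
      (use borel_integrable_compact[of "{0..R}" "\<lambda>x. x"] in \<open>simp add: mult.commute\<close>)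
  have k: "case_prod k \<in> borel_measurable (lborel \<Otimes>\<^sub>M lborel)"
    unfolding k_def by measurable
  have F: "?f \<xi> * (\<integral>s. g s * k \<xi> s \<partial>lborel) = max 0 (R\<^sup>2 - (norm \<xi>)\<^sup>2)" for \<xi>
  proof (cases "norm \<xi> < R")
    case True
    have "(\<integral>s. g s * k \<xi> s \<partial>lborel) = (\<integral>s. 2 * (s ^ 1 * indicator {norm \<xi>..R} s) \<partial>lborel)"
    proof (rule integral_cong_AE)
      have "AE s in lborel. s \<noteq> norm \<xi>" by (rule AE_lborel_singleton)
      then show "AE s in lborel. g s * k \<xi> s = 2 * (s ^ 1 * indicator {norm \<xi>..R} s)"
        by eventually_elim (auto simp: g_def k_def indicator_def dest: le_less_trans[OF norm_ge_zero])
    qed (auto simp: g_def k_def)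
    also have "\<dots> = R\<^sup>2 - (norm \<xi>)\<^sup>2"
      using integral_power[of "norm \<xi>" R 1] True by (simp add: power2_eq_square)
    finally show ?thesis using True by (simp add: power_mono)
  next
    case False
    then have "R\<^sup>2 \<le> (norm \<xi>)\<^sup>2" using R by (intro power_mono) auto
    then show ?thesis using False by simp
  qed
  have "integrable lborel (\<lambda>\<xi>. ?f \<xi> * (\<integral>s. g s * k \<xi> s \<partial>lborel))"
    using lborel_pair.integrable_fst[OF integrable_lborel_kernel[OF f g k, of 1]]
    by (simp add: k_def mult.assoc)
  then show "integrable lborel (\<lambda>\<xi>::'a. max 0 (R\<^sup>2 - (norm \<xi>)\<^sup>2))" unfolding F .
  have G: "g s * (\<integral>\<xi>. ?f \<xi> * k \<xi> s \<partial>lborel)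
      = (2 * unit_ball_vol (real DIM('a))) * (s ^ (DIM('a) + 1) * indicator {0..R} s)" for s
  proof (cases "s \<in> {0..R}")
    case True
    have "(\<lambda>\<xi>. ?f \<xi> * k \<xi> s) = indicator (ball 0 s)"
      using True by (auto simp: k_def indicator_def fun_eq_iff)
    then have "(\<integral>\<xi>. ?f \<xi> * k \<xi> s \<partial>lborel) = unit_ball_vol (real DIM('a)) * s ^ DIM('a)"
      using True content_ball[of s "0::'a"] by simp
    then show ?thesis using True by (simp add: g_def)
  qed (simp add: g_def)
  have "(\<integral>\<xi>. max 0 (R\<^sup>2 - (norm \<xi>)\<^sup>2) \<partial>(lborel :: 'a measure)) = (\<integral>\<xi>. ?f \<xi> * (\<integral>s. g s * k \<xi> s \<partial>lborel) \<partial>lborel)"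
    unfolding F ..
  also have "\<dots> = (\<integral>s. g s * (\<integral>\<xi>. ?f \<xi> * k \<xi> s \<partial>lborel) \<partial>lborel)"
    by (rule Fubini_lborel_kernel[OF f g k, of 1]) (simp add: k_def)
  also have "\<dots> = (2 * unit_ball_vol (real DIM('a))) * (R ^ (DIM('a) + 2) / (real DIM('a) + 2))"
    unfolding G using integral_power[of 0 R "DIM('a) + 1"] R by (simp add: add.commute)
  finally show "(\<integral>\<xi>. max 0 (R\<^sup>2 - (norm \<xi>)\<^sup>2) \<partial>(lborel :: 'a measure))
      = unit_ball_vol (real DIM('a)) * (2 * R ^ (DIM('a) + 2) / (real DIM('a) + 2))" by simp
qed

section \<open>The damped Dirichlet form and the Berezin--Li--Yau inequality\<close>

text \<open>A solution is controlled on \<open>S\<close> alone and is only Lebesgue measurable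
  there, while \<open>fourier\<close> integrates Borel functions over the whole space. For test
  functions of \<open>S\<close> the two agree.\<close>

definition fourier_on :: "'a::euclidean_space set \<Rightarrow> ('a \<Rightarrow> real) \<Rightarrow> 'a \<Rightarrow> complex" where
  "fourier_on S w \<xi> = (\<integral>x. w x *\<^sub>R cis (\<xi> \<bullet> x) \<partial>(lebesgue_on S))"

text \<open>The Dirichlet form damped at high frequencies. Unlike the Dirichlet form it is continuous
  on \<open>L\<^sup>2\<close>, and it increases to the Dirichlet form as \<open>\<tau>\<close> tends to \<open>0\<close>.\<close>

definition damped_form :: "'a::euclidean_space set \<Rightarrow> real \<Rightarrow> ('a \<Rightarrow> real) \<Rightarrow> ('a \<Rightarrow> real) \<Rightarrow> real" where
  "damped_form S \<tau> u v = (1 / (2 * pi)) ^ DIM('a) *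
     (\<integral>\<xi>. (norm \<xi>)\<^sup>2 * exp (- \<tau> * (norm \<xi>)\<^sup>2) * (fourier_on S u \<xi> \<bullet> fourier_on S v \<xi>) \<partial>lborel)"

lemma integrable_L2_on:
  assumes "S \<in> lmeasurable" "L2 (lebesgue_on S) u"
  shows "integrable (lebesgue_on S) u" and "(\<integral>x. \<bar>u x\<bar> \<partial>(lebesgue_on S)) \<le> sqrt (measure lebesgue S) * l2_norm (lebesgue_on S) (u :: 'a::euclidean_space \<Rightarrow> real)"
proof -
  interpret finite_measure "lebesgue_on S" using assms(1) by (rule finite_measure_lebesgue_on)
  have 1: "L2 (lebesgue_on S) (\<lambda>x. 1 :: real)" by (simp add: L2_def)
  have a: "L2 (lebesgue_on S) (\<lambda>x. \<bar>u x\<bar>)" using assms(2) by (auto simp: L2_def)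
  show "integrable (lebesgue_on S) u"
    using L2_inner_integrable[OF assms(2) 1] by simp
  have "l2_norm (lebesgue_on S) (\<lambda>x. 1 :: real) = sqrt (measure lebesgue S)"
    using assms(1) by (simp add: l2_norm_def measure_restrict_space fmeasurableD)
  moreover have "l2_norm (lebesgue_on S) (\<lambda>x. \<bar>u x\<bar>) = l2_norm (lebesgue_on S) u"
    by (simp add: l2_norm_def)
  ultimately show "(\<integral>x. \<bar>u x\<bar> \<partial>(lebesgue_on S)) \<le> sqrt (measure lebesgue S) * l2_norm (lebesgue_on S) u"
    using l2_cauchy_schwarz[OF 1 a] by (simp add: l2_inner_def)
qed

lemma integrable_fourier_on:
  assumes "S \<in> lmeasurable" "L2 (lebesgue_on S) u"
  shows "integrable (lebesgue_on S) (\<lambda>x. u x *\<^sub>R cis (\<xi> \<bullet> x))"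
proof (rule Bochner_Integration.integrable_bound[OF integrable_L2_on(1)[OF assms]])
  have [measurable]: "u \<in> borel_measurable (lebesgue_on S)" using assms by (simp add: L2_def)
  have [measurable]: "(\<lambda>x. cis (\<xi> \<bullet> x)) \<in> borel_measurable (lebesgue_on S)"
    unfolding cis_conv_exp by (intro measurable_restrict_space1 measurable_completion) simp
  show "(\<lambda>x. u x *\<^sub>R cis (\<xi> \<bullet> x)) \<in> borel_measurable (lebesgue_on S)" by measurable
qed auto

lemma norm_fourier_on_le:
  assumes "S \<in> lmeasurable" "L2 (lebesgue_on S) u"
  shows "norm (fourier_on S u \<xi>) \<le> sqrt (measure lebesgue S) * l2_norm (lebesgue_on S) u"
proof -
  have "norm (fourier_on S u \<xi>) \<le> (\<integral>x. \<bar>u x\<bar> \<partial>(lebesgue_on S))"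
    unfolding fourier_on_def
    using integral_norm_bound[of "lebesgue_on S" "\<lambda>x. u x *\<^sub>R cis (\<xi> \<bullet> x)"] by simp
  with integrable_L2_on(2)[OF assms] show ?thesis by simp
qed

lemma fourier_on_measurable:
  assumes "S \<in> lmeasurable" "L2 (lebesgue_on S) u"
  shows "fourier_on S u \<in> borel_measurable borel"
proof -
  interpret finite_measure "lebesgue_on S" using assms(1) by (rule finite_measure_lebesgue_on)
  have [measurable]: "u \<in> borel_measurable (lebesgue_on S)" using assms by (simp add: L2_def)
  have [measurable]: "(\<lambda>x. x) \<in> borel_measurable (lebesgue_on S)"
    by (intro measurable_restrict_space1 measurable_completion) simp
  have "(\<lambda>(\<xi>, x). u x *\<^sub>R cis (\<xi> \<bullet> x)) \<in> borel_measurable (borel \<Otimes>\<^sub>M lebesgue_on S)"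
    unfolding cis_conv_exp by measurable
  then show ?thesis
    unfolding fourier_on_def[abs_def] by (rule borel_measurable_lebesgue_integral)
qed

lemma fourier_on_diff:
  assumes "S \<in> lmeasurable" "L2 (lebesgue_on S) u" "L2 (lebesgue_on S) v"
  shows "fourier_on S (\<lambda>x. u x - v x) \<xi> = fourier_on S u \<xi> - fourier_on S v \<xi>"
  unfolding fourier_on_def scaleR_diff_left
  by (intro Bochner_Integration.integral_diff integrable_fourier_on assms)

lemma fourier_on_test_function:
  assumes "test_function S f" "S \<in> sets lebesgue"
  shows "fourier_on S f \<xi> = fourier f \<xi>"
  unfolding fourier_on_def fourier_def
proof (rule integral_lebesgue_on_eq_lborel[OF assms(2)])
  show "(\<lambda>x. f x *\<^sub>R cis (\<xi> \<bullet> x)) \<in> borel_measurable borel"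
    using integrable_scaleR_cis[OF test_function_integrable[OF assms(1)]] by auto
qed (simp add: test_function_eq_0[OF assms(1)])

text \<open>On a set of finite measure the transform of an L2 function is bounded by a multiple of
  its L2 norm, so integrability over frequencies comes from the multiplier alone. This is what makes
  the damped form continuous on L2.\<close>

lemma damped_form_integrable:
  fixes S :: "'a::euclidean_space set"
  assumes S: "S \<in> lmeasurable" and u: "L2 (lebesgue_on S) u" and v: "L2 (lebesgue_on S) v" and t: "\<tau> > 0"
  shows "integrable lborel (\<lambda>\<xi>. (norm \<xi>)\<^sup>2 * exp (- \<tau> * (norm \<xi>)\<^sup>2) * (fourier_on S u \<xi> \<bullet> fourier_on S v \<xi>))" (is "integrable _ ?f")
    and "\<bar>damped_form S \<tau> u v\<bar> \<le> (1 / (2 * pi)) ^ DIM('a) * (\<integral>\<xi>. (norm \<xi>)\<^sup>2 * exp (- \<tau> * (norm \<xi>)\<^sup>2) \<partial>(lborel :: 'a measure))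
       * measure lebesgue S * (l2_norm (lebesgue_on S) u * l2_norm (lebesgue_on S) v)"
proof -
  note [measurable] = fourier_on_measurable[OF S u] fourier_on_measurable[OF S v]
  let ?g = "\<lambda>\<xi>::'a. (norm \<xi>)\<^sup>2 * exp (- \<tau> * (norm \<xi>)\<^sup>2)"
  define A where "A = measure lebesgue S * (l2_norm (lebesgue_on S) u * l2_norm (lebesgue_on S) v)"
  have b: "\<bar>fourier_on S u \<xi> \<bullet> fourier_on S v \<xi>\<bar> \<le> A" for \<xi>
  proof -
    have "\<bar>fourier_on S u \<xi> \<bullet> fourier_on S v \<xi>\<bar> \<le> norm (fourier_on S u \<xi>) * norm (fourier_on S v \<xi>)"
      by (rule Cauchy_Schwarz_ineq2)
    also have "\<dots> \<le> (sqrt (measure lebesgue S) * l2_norm (lebesgue_on S) u) * (sqrt (measure lebesgue S) * l2_norm (lebesgue_on S) v)"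
      by (intro mult_mono norm_fourier_on_le S u v) auto
    also have "\<dots> = (sqrt (measure lebesgue S))\<^sup>2 * (l2_norm (lebesgue_on S) u * l2_norm (lebesgue_on S) v)"
      by (simp add: power2_eq_square)
    finally show ?thesis by (simp add: A_def)
  qed
  note g = integrable_gaussian_power2[OF t, where 'a='a]
  have nb: "norm (?f \<xi>) \<le> ?g \<xi> * A" for \<xi>
    using mult_left_mono[OF b, of "?g \<xi>"] by (simp add: abs_mult)
  show i: "integrable lborel ?f"
  proof (rule Bochner_Integration.integrable_bound)
    show "integrable lborel (\<lambda>\<xi>. ?g \<xi> * A)" using g by (intro integrable_mult_left)
    show "AE \<xi> in lborel. norm (?f \<xi>) \<le> norm (?g \<xi> * A)"
      using nb by (intro AE_I2 order_trans[OF nb]) simp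
  qed measurable
  have "norm (integral\<^sup>L lborel ?f) \<le> (\<integral>\<xi>. ?g \<xi> * A \<partial>lborel)"
    by (rule order_trans[OF integral_norm_bound integral_mono[OF integrable_norm[OF i] integrable_mult_left[OF g] nb]])
  then have "\<bar>integral\<^sup>L lborel ?f\<bar> \<le> (\<integral>\<xi>. ?g \<xi> \<partial>lborel) * A" by simp
  then have "(1 / (2 * pi)) ^ DIM('a) * \<bar>integral\<^sup>L lborel ?f\<bar> \<le> (1 / (2 * pi)) ^ DIM('a) * ((\<integral>\<xi>. ?g \<xi> \<partial>lborel) * A)"
    by (rule mult_left_mono) simp
  then show "\<bar>damped_form S \<tau> u v\<bar> \<le> (1 / (2 * pi)) ^ DIM('a) * (\<integral>\<xi>. ?g \<xi> \<partial>lborel)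
       * measure lebesgue S * (l2_norm (lebesgue_on S) u * l2_norm (lebesgue_on S) v)"
    unfolding damped_form_def abs_mult A_def by (simp add: mult.assoc)
qed

lemma damped_form_nonneg: "0 \<le> damped_form S \<tau> u u"
  unfolding damped_form_def by (intro mult_nonneg_nonneg Bochner_Integration.integral_nonneg) auto

lemma damped_form_commute: "damped_form S \<tau> u v = damped_form S \<tau> v u"
  by (simp add: damped_form_def inner_commute)

lemma damped_form_diff_left:
  assumes "S \<in> lmeasurable" "L2 (lebesgue_on S) u" "L2 (lebesgue_on S) v" "L2 (lebesgue_on S) w" "\<tau> > 0"
  shows "damped_form S \<tau> (\<lambda>x. u x - v x) w = damped_form S \<tau> u w - damped_form S \<tau> v w"
  unfolding damped_form_def fourier_on_diff[OF assms(1-3)] inner_diff_left right_diff_distrib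
  by (simp only: Bochner_Integration.integral_diff[OF damped_form_integrable(1)[OF assms(1,2,4,5)]
        damped_form_integrable(1)[OF assms(1,3,4,5)]] right_diff_distrib)

lemma damped_form_diff_right:
  assumes "S \<in> lmeasurable" "L2 (lebesgue_on S) u" "L2 (lebesgue_on S) v" "L2 (lebesgue_on S) w" "\<tau> > 0"
  shows "damped_form S \<tau> w (\<lambda>x. u x - v x) = damped_form S \<tau> w u - damped_form S \<tau> w v"
  using damped_form_diff_left[OF assms] by (simp add: damped_form_commute)

lemma damped_form_bound:
  fixes S :: "'a::euclidean_space set"
  assumes "S \<in> lmeasurable" "\<tau> > 0"
  obtains C where "C > 0" "\<And>u v. L2 (lebesgue_on S) u \<Longrightarrow> L2 (lebesgue_on S) v \<Longrightarrow>
     \<bar>damped_form S \<tau> u v\<bar> \<le> C * (l2_norm (lebesgue_on S) u * l2_norm (lebesgue_on S) v)"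
proof -
  let ?C = "(1 / (2 * pi)) ^ DIM('a) * (\<integral>\<xi>. (norm \<xi>)\<^sup>2 * exp (- \<tau> * (norm \<xi>)\<^sup>2) \<partial>(lborel :: 'a measure)) * measure lebesgue S"
  have pos: "0 \<le> ?C" by simp
  \<comment> \<open>The summand 1 only serves to make the constant strictly positive.\<close>
  have bnd: "\<bar>damped_form S \<tau> u v\<bar> \<le> (?C + 1) * (l2_norm (lebesgue_on S) u * l2_norm (lebesgue_on S) v)"
    if "L2 (lebesgue_on S) u" "L2 (lebesgue_on S) v" for u v
    by (rule order_trans[OF damped_form_integrable(2)[OF assms(1) that assms(2)]]) (intro mult_right_mono, auto)
  show ?thesis by (rule that[OF _ bnd]) (use pos in linarith)
qed

lemma tendsto_damped_form:
  assumes S: "S \<in> lmeasurable" and t: "\<tau> > 0"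
    and L: "\<And>i. L2 (lebesgue_on S) (U i)" "\<And>i. L2 (lebesgue_on S) (V i)" "L2 (lebesgue_on S) u" "L2 (lebesgue_on S) v"
    and lim: "((\<lambda>i. l2_norm (lebesgue_on S) (\<lambda>x. U i x - u x)) \<longlongrightarrow> 0) F"
     "((\<lambda>i. l2_norm (lebesgue_on S) (\<lambda>x. V i x - v x)) \<longlongrightarrow> 0) F"
  shows "((\<lambda>i. damped_form S \<tau> (U i) (V i)) \<longlongrightarrow> damped_form S \<tau> u v) F"
proof -
  let ?n = "l2_norm (lebesgue_on S)"
  obtain C where C: "C > 0" "\<And>u v. L2 (lebesgue_on S) u \<Longrightarrow> L2 (lebesgue_on S) v \<Longrightarrow>
     \<bar>damped_form S \<tau> u v\<bar> \<le> C * (?n u * ?n v)" by (rule damped_form_bound[OF S t]) (rule that)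
  show ?thesis
  proof (rule LIM_zero_cancel, rule Lim_null_comparison)
    have "\<bar>damped_form S \<tau> (U i) (V i) - damped_form S \<tau> u v\<bar> \<le>
      C * (?n (\<lambda>x. U i x - u x) * ?n (V i)) + C * (?n u * ?n (\<lambda>x. V i x - v x))" for i
    proof -
      have "damped_form S \<tau> (U i) (V i) - damped_form S \<tau> u v
        = damped_form S \<tau> (\<lambda>x. U i x - u x) (V i) + damped_form S \<tau> u (\<lambda>x. V i x - v x)"
        using S t L by (simp add: damped_form_diff_left damped_form_diff_right)
      moreover have "\<bar>damped_form S \<tau> (\<lambda>x. U i x - u x) (V i)\<bar> \<le> C * (?n (\<lambda>x. U i x - u x) * ?n (V i))"
        by (intro C L2_diff L)
      moreover have "\<bar>damped_form S \<tau> u (\<lambda>x. V i x - v x)\<bar> \<le> C * (?n u * ?n (\<lambda>x. V i x - v x))"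
        by (intro C L2_diff L)
      ultimately show ?thesis by linarith
    qed
    then show "\<forall>\<^sub>F i in F. norm (damped_form S \<tau> (U i) (V i) - damped_form S \<tau> u v) \<le>
      C * (?n (\<lambda>x. U i x - u x) * ?n (V i)) + C * (?n u * ?n (\<lambda>x. V i x - v x))" by simp
    have "((\<lambda>i. C * (?n (\<lambda>x. U i x - u x) * ?n (V i)) + C * (?n u * ?n (\<lambda>x. V i x - v x))) \<longlongrightarrow>
       C * (0 * ?n v) + C * (?n u * 0)) F"
      by (intro tendsto_intros lim tendsto_l2_norm[OF L(2,4)])
    then show "((\<lambda>i. C * (?n (\<lambda>x. U i x - u x) * ?n (V i)) + C * (?n u * ?n (\<lambda>x. V i x - v x))) \<longlongrightarrow> 0) F"
      by simp
  qed
qed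

text \<open>Splitting |\<xi>|^2 into coordinates and absorbing each square into the transform turns
  the form into a sum of Gaussian-weighted L2 norms of partial derivatives, to which
  \<open>fourier_gaussian_le\<close> and \<open>fourier_gaussian_tendsto\<close> apply.\<close>

lemma damped_form_test_function:
  assumes f: "test_function S f" and S: "S \<in> lmeasurable" and t: "\<tau> > 0"
  shows "damped_form S \<tau> f f = (\<Sum>b\<in>Basis. (1 / (2 * pi)) ^ DIM('a) *
    (\<integral>\<xi>. exp (- \<tau> * (norm \<xi>)\<^sup>2) * (norm (fourier (\<lambda>x. frechet_derivative f (at x) b) \<xi>))\<^sup>2 \<partial>(lborel :: 'a::euclidean_space measure)))"
proof -
  have Sm: "S \<in> sets lebesgue" using S by (rule fmeasurableD)
  have fm[measurable]: "fourier f \<in> borel_measurable borel" by (rule fourier_measurable[OF test_function_integrable[OF f]])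
  have i: "integrable lborel (\<lambda>\<xi>. (norm \<xi>)\<^sup>2 * exp (- \<tau> * (norm \<xi>)\<^sup>2) * (norm (fourier f \<xi>))\<^sup>2)"
    using damped_form_integrable(1)[OF S test_function_L2[OF f Sm] test_function_L2[OF f Sm] t]
    by (simp add: fourier_on_test_function[OF f Sm] power2_norm_eq_inner)
  have ib: "integrable lborel (\<lambda>\<xi>. exp (- \<tau> * (norm \<xi>)\<^sup>2) * ((\<xi> \<bullet> b)\<^sup>2 * (norm (fourier f \<xi>))\<^sup>2))" if "b \<in> Basis" for b
  proof (rule Bochner_Integration.integrable_bound[OF i])
    show "AE \<xi> in lborel. norm (exp (- \<tau> * (norm \<xi>)\<^sup>2) * ((\<xi> \<bullet> b)\<^sup>2 * (norm (fourier f \<xi>))\<^sup>2))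
      \<le> norm ((norm \<xi>)\<^sup>2 * exp (- \<tau> * (norm \<xi>)\<^sup>2) * (norm (fourier f \<xi>))\<^sup>2)"
    proof (rule AE_I2)
      fix \<xi> :: 'a
      have "(\<xi> \<bullet> b)\<^sup>2 \<le> (norm \<xi>)\<^sup>2" using Basis_le_norm[OF that, of \<xi>] by (simp add: abs_le_square_iff[symmetric])
      then have "(\<xi> \<bullet> b)\<^sup>2 * (exp (- \<tau> * (norm \<xi>)\<^sup>2) * (norm (fourier f \<xi>))\<^sup>2) \<le> (norm \<xi>)\<^sup>2 * (exp (- \<tau> * (norm \<xi>)\<^sup>2) * (norm (fourier f \<xi>))\<^sup>2)"
        by (intro mult_right_mono) auto
      then show "norm (exp (- \<tau> * (norm \<xi>)\<^sup>2) * ((\<xi> \<bullet> b)\<^sup>2 * (norm (fourier f \<xi>))\<^sup>2))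
        \<le> norm ((norm \<xi>)\<^sup>2 * exp (- \<tau> * (norm \<xi>)\<^sup>2) * (norm (fourier f \<xi>))\<^sup>2)"
        by (simp add: mult_ac)
    qed
  qed measurable
  have n: "(norm \<xi>)\<^sup>2 = (\<Sum>b\<in>Basis. (\<xi> \<bullet> b)\<^sup>2)" for \<xi> :: 'a
    unfolding power2_norm_eq_inner by (subst euclidean_inner) (simp add: power2_eq_square)
  have "damped_form S \<tau> f f = (1 / (2 * pi)) ^ DIM('a) *
     (\<integral>\<xi>. (\<Sum>b\<in>Basis. exp (- \<tau> * (norm \<xi>)\<^sup>2) * ((\<xi> \<bullet> b)\<^sup>2 * (norm (fourier f \<xi>))\<^sup>2)) \<partial>lborel)"
    unfolding damped_form_def fourier_on_test_function[OF f Sm] power2_norm_eq_inner[symmetric]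
    by (simp add: sum_distrib_right[symmetric] sum_distrib_left[symmetric] n[symmetric] mult.assoc mult.left_commute)
  also have "\<dots> = (\<Sum>b\<in>Basis. (1 / (2 * pi)) ^ DIM('a) *
     (\<integral>\<xi>. exp (- \<tau> * (norm \<xi>)\<^sup>2) * ((\<xi> \<bullet> b)\<^sup>2 * (norm (fourier f \<xi>))\<^sup>2) \<partial>lborel))"
    by (subst Bochner_Integration.integral_sum[OF ib]) (auto simp: sum_distrib_left)
  finally show ?thesis
    by (simp add: norm_fourier_directional_derivative[OF f])
qed

lemma damped_form_test_function_le:
  assumes f: "test_function S f" and S: "S \<in> lmeasurable" and t: "\<tau> > 0"
  shows "damped_form S \<tau> f f \<le> (l2_norm (lebesgue_on S) (gradient f))\<^sup>2"
proof -
  have d: "test_function S (\<lambda>x. frechet_derivative f (at x) b)" for b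
    by (rule test_function_directional_derivative[OF f])
  show ?thesis
    unfolding damped_form_test_function[OF assms] sum_directional_derivatives_power2[OF f fmeasurableD[OF S], symmetric]
  proof (rule sum_mono)
    fix b :: 'a assume "b \<in> Basis"
    obtain B where "B > 0" and B: "\<And>x. \<bar>frechet_derivative f (at x) b\<bar> \<le> B" by (rule test_function_bounded[OF d]) (rule that)
    show "(1 / (2 * pi)) ^ DIM('a) *
         (\<integral>\<xi>. exp (- \<tau> * (norm \<xi>)\<^sup>2) * (norm (fourier (\<lambda>x. frechet_derivative f (at x) b) \<xi>))\<^sup>2 \<partial>lborel)
         \<le> (\<integral>x. (frechet_derivative f (at x) b)\<^sup>2 \<partial>lborel)"
      by (rule fourier_gaussian_le[OF test_function_integrable[OF d] B t])
  qed
qed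

lemma damped_form_test_function_tendsto:
  assumes f: "test_function S f" and S: "S \<in> lmeasurable" and t: "\<And>n. \<tau> n > 0" "\<tau> \<longlonglongrightarrow> 0"
  shows "(\<lambda>n. damped_form S (\<tau> n) f f) \<longlonglongrightarrow> (l2_norm (lebesgue_on S) (gradient f))\<^sup>2"
proof -
  have d: "test_function S (\<lambda>x. frechet_derivative f (at x) b)" for b
    by (rule test_function_directional_derivative[OF f])
  show ?thesis
    unfolding damped_form_test_function[OF f S t(1)] sum_directional_derivatives_power2[OF f fmeasurableD[OF S], symmetric]
  proof (rule tendsto_sum)
    fix b :: 'a assume "b \<in> Basis"
    obtain B where "B > 0" and B: "\<And>x. \<bar>frechet_derivative f (at x) b\<bar> \<le> B" by (rule test_function_bounded[OF d]) (rule that)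
    show "(\<lambda>n. (1 / (2 * pi)) ^ DIM('a) *
         (\<integral>\<xi>. exp (- \<tau> n * (norm \<xi>)\<^sup>2) * (norm (fourier (\<lambda>x. frechet_derivative f (at x) b) \<xi>))\<^sup>2 \<partial>lborel))
         \<longlonglongrightarrow> (\<integral>x. (frechet_derivative f (at x) b)\<^sup>2 \<partial>lborel)"
      by (rule fourier_gaussian_tendsto[OF test_function_integrable[OF d] B test_function_continuous[OF d] t])
  qed
qed

text \<open>Only the mass term \<open>J\<close> needs the limit \<tau> \<rightarrow> 0. The damped
  Dirichlet form is below the squared gradient norm for each \<tau>, and the bathtub bound is
  independent of \<tau> because the Gaussian factor is at most 1.\<close>

lemma berezin_li_yau_test_function:
  assumes f: "test_function S f" and S: "S \<in> lmeasurable" and R: "R > 0"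
  shows "(R\<^sup>2 - (1 / (2 * pi)) ^ DIM('a) * measure lebesgue S *
           (unit_ball_vol (real DIM('a)) * (2 * R ^ (DIM('a) + 2) / (real DIM('a) + 2)))) * (l2_norm (lebesgue_on S) f)\<^sup>2
      \<le> (l2_norm (lebesgue_on S) (gradient (f :: 'a::euclidean_space \<Rightarrow> real)))\<^sup>2"
proof -
  have Sm: "S \<in> sets lebesgue" using S by (rule fmeasurableD)
  note L = test_function_L2[OF f Sm]
  let ?F = "\<lambda>\<xi>. (norm (fourier f \<xi>))\<^sup>2"
  let ?c = "(1 / (2 * pi)) ^ DIM('a)"
  define A where "A = measure lebesgue S * (l2_norm (lebesgue_on S) f)\<^sup>2"
  define b :: "'a \<Rightarrow> real" where "b \<xi> = max 0 (R\<^sup>2 - (norm \<xi>)\<^sup>2)" for \<xi>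
  define J where "J \<tau> = ?c * (\<integral>\<xi>. exp (- \<tau> * (norm \<xi>)\<^sup>2) * ?F \<xi> \<partial>lborel)" for \<tau>
  have fm[measurable]: "fourier f \<in> borel_measurable borel" by (rule fourier_measurable[OF test_function_integrable[OF f]])
  have FA: "?F \<xi> \<le> A" for \<xi>
  proof -
    have "?F \<xi> \<le> (sqrt (measure lebesgue S) * l2_norm (lebesgue_on S) f)\<^sup>2"
      using norm_fourier_on_le[OF S L, of \<xi>] by (intro power_mono) (auto simp: fourier_on_test_function[OF f Sm])
    then show ?thesis by (simp add: A_def power_mult_distrib)
  qed
  have bi: "integrable lborel b" unfolding b_def[abs_def] by (rule integral_bathtub[OF R])
  have key: "R\<^sup>2 * J \<tau> \<le> (l2_norm (lebesgue_on S) (gradient f))\<^sup>2 + ?c * (integral\<^sup>L lborel b * A)" if t: "\<tau> > 0" for \<tau>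
  proof -
    have i1: "integrable lborel (\<lambda>\<xi>. (norm \<xi>)\<^sup>2 * exp (- \<tau> * (norm \<xi>)\<^sup>2) * ?F \<xi>)"
      using damped_form_integrable(1)[OF S L L t] by (simp add: fourier_on_test_function[OF f Sm] power2_norm_eq_inner)
    have i2: "integrable lborel (\<lambda>\<xi>. exp (- \<tau> * (norm \<xi>)\<^sup>2) * ?F \<xi>)"
    proof (rule Bochner_Integration.integrable_bound)
      show "integrable lborel (\<lambda>\<xi>::'a. exp (- \<tau> * (norm \<xi>)\<^sup>2) * A)"
        by (intro integrable_mult_left integrable_gaussian t)
      show "AE \<xi> in lborel. norm (exp (- \<tau> * (norm \<xi>)\<^sup>2) * ?F \<xi>) \<le> norm (exp (- \<tau> * (norm \<xi>)\<^sup>2) * A)"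
        using FA by (auto intro!: AE_I2 mult_left_mono order_trans[OF FA] simp: abs_mult)
    qed measurable
    have "(\<integral>\<xi>. R\<^sup>2 * (exp (- \<tau> * (norm \<xi>)\<^sup>2) * ?F \<xi>) - (norm \<xi>)\<^sup>2 * exp (- \<tau> * (norm \<xi>)\<^sup>2) * ?F \<xi> \<partial>lborel)
      \<le> (\<integral>\<xi>. b \<xi> * A \<partial>lborel)"
    proof (rule integral_mono)
      fix \<xi> :: 'a
      have "R\<^sup>2 * (exp (- \<tau> * (norm \<xi>)\<^sup>2) * ?F \<xi>) - (norm \<xi>)\<^sup>2 * exp (- \<tau> * (norm \<xi>)\<^sup>2) * ?F \<xi>
        = (R\<^sup>2 - (norm \<xi>)\<^sup>2) * (exp (- \<tau> * (norm \<xi>)\<^sup>2) * ?F \<xi>)" by (simp add: algebra_simps)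
      also have "\<dots> \<le> b \<xi> * (exp (- \<tau> * (norm \<xi>)\<^sup>2) * ?F \<xi>)"
        by (intro mult_right_mono) (auto simp: b_def)
      also have "\<dots> \<le> b \<xi> * (1 * A)"
        using t FA by (intro mult_left_mono mult_mono) (auto simp: b_def)
      finally show "R\<^sup>2 * (exp (- \<tau> * (norm \<xi>)\<^sup>2) * ?F \<xi>) - (norm \<xi>)\<^sup>2 * exp (- \<tau> * (norm \<xi>)\<^sup>2) * ?F \<xi> \<le> b \<xi> * A" by simp
    qed (intro Bochner_Integration.integrable_diff integrable_mult_right integrable_mult_left i1 i2 bi)+
    then have "R\<^sup>2 * (\<integral>\<xi>. exp (- \<tau> * (norm \<xi>)\<^sup>2) * ?F \<xi> \<partial>lborel) - (\<integral>\<xi>. (norm \<xi>)\<^sup>2 * exp (- \<tau> * (norm \<xi>)\<^sup>2) * ?F \<xi> \<partial>lborel)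
       \<le> integral\<^sup>L lborel b * A"
      by (simp only: Bochner_Integration.integral_diff[OF integrable_mult_right[OF i2] i1] integral_mult_right_zero integral_mult_left_zero)
    then have "?c * (R\<^sup>2 * (\<integral>\<xi>. exp (- \<tau> * (norm \<xi>)\<^sup>2) * ?F \<xi> \<partial>lborel) - (\<integral>\<xi>. (norm \<xi>)\<^sup>2 * exp (- \<tau> * (norm \<xi>)\<^sup>2) * ?F \<xi> \<partial>lborel))
       \<le> ?c * (integral\<^sup>L lborel b * A)"
      by (rule mult_left_mono) simp
    then have "R\<^sup>2 * J \<tau> - damped_form S \<tau> f f \<le> ?c * (integral\<^sup>L lborel b * A)"
      by (simp add: J_def damped_form_def fourier_on_test_function[OF f Sm] power2_norm_eq_inner algebra_simps)
    with damped_form_test_function_le[OF f S t] show ?thesis by linarith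
  qed
  obtain B where "B > 0" and B: "\<And>x. \<bar>f x\<bar> \<le> B" by (rule test_function_bounded[OF f]) (rule that)
  define s where "s n = inverse (real (Suc n))" for n
  have s: "s n > 0" for n by (simp add: s_def)
  have s0: "s \<longlonglongrightarrow> 0" unfolding s_def using LIMSEQ_inverse_real_of_nat .
  have "(\<lambda>n. J (s n)) \<longlonglongrightarrow> (l2_norm (lebesgue_on S) f)\<^sup>2"
    using fourier_gaussian_tendsto[OF test_function_integrable[OF f] B test_function_continuous[OF f] s s0]
    unfolding test_function_power2_eq[OF f Sm] J_def .
  then have "(\<lambda>n. R\<^sup>2 * J (s n)) \<longlonglongrightarrow> R\<^sup>2 * (l2_norm (lebesgue_on S) f)\<^sup>2" by (intro tendsto_intros)
  then have "R\<^sup>2 * (l2_norm (lebesgue_on S) f)\<^sup>2 \<le> (l2_norm (lebesgue_on S) (gradient f))\<^sup>2 + ?c * (integral\<^sup>L lborel b * A)"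
    by (rule LIMSEQ_le_const2) (use key[OF s] in blast)
  then show ?thesis
    unfolding A_def b_def[abs_def] integral_bathtub(2)[OF R] by (simp add: algebra_simps)
qed

section \<open>Passage to \<open>H\<^sup>1\<^sub>0\<close>\<close>

text \<open>The counterpart of \<open>form_gap\<close> with classical gradients. Bilinearity and the
  inequalities that follow from it are proved for test functions, whose gradients subtract
  pointwise, and reach \<open>H10\<close> by limits. The choice behind \<open>weak_gradient\<close>
  would make additivity available only up to null sets.\<close>

definition test_gap :: "'a::euclidean_space set \<Rightarrow> real \<Rightarrow> ('a \<Rightarrow> real) \<Rightarrow> ('a \<Rightarrow> real) \<Rightarrow> real" where
  "test_gap S \<tau> f g = l2_inner (lebesgue_on S) (gradient f) (gradient g) - damped_form S \<tau> f g"

lemma test_gap_commute: "test_gap S \<tau> f g = test_gap S \<tau> g f"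
  by (simp add: test_gap_def damped_form_commute l2_inner_commute)

lemma test_gap_diff_left:
  assumes S: "S \<in> lmeasurable" and t: "\<tau> > 0" and T: "test_function S f" "test_function S g" "test_function S h"
  shows "test_gap S \<tau> (\<lambda>x. f x - g x) h = test_gap S \<tau> f h - test_gap S \<tau> g h"
proof -
  have Sm: "S \<in> sets lebesgue" using S by (rule fmeasurableD)
  have "gradient (\<lambda>x. f x - g x) = (\<lambda>x. gradient f x - gradient g x)"
    using T by (auto simp: gradient_diff test_function_smooth)
  then show ?thesis
    using T S t Sm unfolding test_gap_def
    by (simp add: l2_inner_diff_left damped_form_diff_left test_function_L2 test_function_gradient_L2)
qed

lemma test_gap_diff_right:
  assumes "S \<in> lmeasurable" "\<tau> > 0" "test_function S f" "test_function S g" "test_function S h"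
  shows "test_gap S \<tau> h (\<lambda>x. f x - g x) = test_gap S \<tau> h f - test_gap S \<tau> h g"
  using test_gap_diff_left[OF assms] by (simp add: test_gap_commute)

lemma test_gap_nonneg:
  assumes "S \<in> lmeasurable" "\<tau> > 0" "test_function S f"
  shows "0 \<le> test_gap S \<tau> f f"
  using damped_form_test_function_le[OF assms(3,1,2)] by (simp add: test_gap_def l2_norm_power2)

text \<open>Positivity of the quadratic form at f + g. It controls a mixed term at two different
  times by the diagonal terms at each of them.\<close>

lemma test_gap_polar:
  assumes S: "S \<in> lmeasurable" and t: "\<tau> > 0" and T: "test_function S f" "test_function S g"
  shows "- test_gap S \<tau> f g \<le> (test_gap S \<tau> f f + test_gap S \<tau> g g) / 2"
proof -
  define z where "z = (\<lambda>x. g x - g x)"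
  define n where "n = (\<lambda>x. z x - g x)" \<comment> \<open>\<open>- g\<close>, written so that closure of test functions under differences suffices\<close>
  define s where "s = (\<lambda>x. f x - n x)"
  have z: "test_function S z" unfolding z_def by (intro test_function_diff T)
  have n: "test_function S n" unfolding n_def by (intro test_function_diff T z)
  have s: "test_function S s" unfolding s_def by (intro test_function_diff T n)
  have gz: "test_gap S \<tau> z w = 0" if "test_function S w" for w
    unfolding z_def test_gap_diff_left[OF S t T(2) T(2) that] by simp
  have gn: "test_gap S \<tau> n w = - test_gap S \<tau> g w" if "test_function S w" for w
    unfolding n_def test_gap_diff_left[OF S t z T(2) that] gz[OF that] by simp
  have "test_gap S \<tau> s s = test_gap S \<tau> f s - test_gap S \<tau> n s"
    unfolding s_def by (rule test_gap_diff_left[OF S t T(1) n s[unfolded s_def]])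
  also have "\<dots> = test_gap S \<tau> f s + test_gap S \<tau> g s" using gn[OF s] by simp
  also have "\<dots> = test_gap S \<tau> f f + 2 * test_gap S \<tau> f g + test_gap S \<tau> g g"
    unfolding s_def test_gap_diff_right[OF S t T(1) n T(1)] test_gap_diff_right[OF S t T(1) n T(2)]
    by (simp add: test_gap_commute[of S \<tau> f n] test_gap_commute[of S \<tau> g n] gn[OF T(1)] gn[OF T(2)] test_gap_commute[of S \<tau> g f])
  finally show ?thesis using test_gap_nonneg[OF S t s] by simp
qed

text \<open>The parallelogram law with f = g + d: the term at g - d is nonnegative and may be
  dropped, and the gap of d is at most its squared gradient norm because the damped form is
  nonnegative. The error term is free of \<tau>.\<close>

lemma test_gap_le:
  assumes S: "S \<in> lmeasurable" and t: "\<tau> > 0" and T: "test_function S f" "test_function S g"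
  shows "test_gap S \<tau> f f \<le> 2 * test_gap S \<tau> g g +
     2 * (l2_norm (lebesgue_on S) (\<lambda>x. gradient f x - gradient g x))\<^sup>2"
proof -
  define d where "d = (\<lambda>x. f x - g x)"
  define e where "e = (\<lambda>x. g x - d x)"
  have d: "test_function S d" unfolding d_def by (intro test_function_diff T)
  have e: "test_function S e" unfolding e_def by (intro test_function_diff T d)
  have "gradient d = (\<lambda>x. gradient f x - gradient g x)"
    unfolding d_def using T by (auto simp: gradient_diff test_function_smooth)
  then have dn: "test_gap S \<tau> d d \<le> (l2_norm (lebesgue_on S) (\<lambda>x. gradient f x - gradient g x))\<^sup>2"
    using damped_form_nonneg[of S \<tau> d] unfolding test_gap_def l2_norm_power2[symmetric] by simp
  have dd: "test_gap S \<tau> d w = test_gap S \<tau> f w - test_gap S \<tau> g w" if "test_function S w" for w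
    unfolding d_def by (rule test_gap_diff_left[OF S t T that])
  have ee: "test_gap S \<tau> e w = test_gap S \<tau> g w - test_gap S \<tau> d w" if "test_function S w" for w
    unfolding e_def by (rule test_gap_diff_left[OF S t T(2) d that])
  have "test_gap S \<tau> e e = test_gap S \<tau> g g - 2 * test_gap S \<tau> g d + test_gap S \<tau> d d"
    using ee[OF e] ee[OF T(2)] ee[OF d] by (simp add: test_gap_commute[of S \<tau> g e] test_gap_commute[of S \<tau> d e] test_gap_commute[of S \<tau> d g])
  also have "\<dots> = 2 * test_gap S \<tau> g g + 2 * test_gap S \<tau> d d - test_gap S \<tau> f f"
    using dd[OF d] dd[OF T(1)] dd[OF T(2)]
    by (simp add: test_gap_commute[of S \<tau> f d] test_gap_commute[of S \<tau> g d] test_gap_commute[of S \<tau> g f])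
  finally show ?thesis using test_gap_nonneg[OF S t e] dn by linarith
qed

lemma H10_D:
  assumes "H10 S v"
  shows "L2 (lebesgue_on S) v" "has_weak_gradient S v (weak_gradient S v)" "L2 (lebesgue_on S) (weak_gradient S v)"
proof -
  show "L2 (lebesgue_on S) v" using assms by (simp add: H10_def H1_def)
  show 1: "has_weak_gradient S v (weak_gradient S v)"
    unfolding weak_gradient_def by (rule someI_ex[where P = "has_weak_gradient S v"]) (use assms in \<open>simp add: H10_def H1_def\<close>)
  then show "L2 (lebesgue_on S) (weak_gradient S v)" by (simp add: has_weak_gradient_def)
qed

lemma H10_approximation:
  assumes "H10 S v"
  obtains \<psi> :: "nat \<Rightarrow> 'a::euclidean_space \<Rightarrow> real"
  where "\<And>n. test_function S (\<psi> n)"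
    "(\<lambda>n. l2_norm (lebesgue_on S) (\<lambda>x. \<psi> n x - v x)) \<longlonglongrightarrow> 0"
    "(\<lambda>n. l2_norm (lebesgue_on S) (\<lambda>x. gradient (\<psi> n) x - weak_gradient S v x)) \<longlonglongrightarrow> 0"
  using assms unfolding H10_def by auto

lemma H10_poincare:
  assumes S: "S \<in> sets lebesgue" and v: "H10 S v"
    and P: "\<And>\<psi>. test_function S \<psi> \<Longrightarrow> K * (l2_norm (lebesgue_on S) \<psi>)\<^sup>2 \<le> (l2_norm (lebesgue_on S) (gradient \<psi>))\<^sup>2"
  shows "K * (l2_norm (lebesgue_on S) v)\<^sup>2 \<le> (l2_norm (lebesgue_on S) (weak_gradient S v))\<^sup>2"
proof -
  obtain \<psi> where p: "\<And>n. test_function S (\<psi> n)"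
    "(\<lambda>n. l2_norm (lebesgue_on S) (\<lambda>x. \<psi> n x - v x)) \<longlonglongrightarrow> 0"
    "(\<lambda>n. l2_norm (lebesgue_on S) (\<lambda>x. gradient (\<psi> n) x - weak_gradient S v x)) \<longlonglongrightarrow> 0"
    by (rule H10_approximation[OF v]) (rule that)
  have "(\<lambda>n. K * (l2_norm (lebesgue_on S) (\<psi> n))\<^sup>2) \<longlonglongrightarrow> K * (l2_norm (lebesgue_on S) v)\<^sup>2"
    by (intro tendsto_intros tendsto_l2_norm test_function_L2 p H10_D[OF v] S)
  moreover have "(\<lambda>n. (l2_norm (lebesgue_on S) (gradient (\<psi> n)))\<^sup>2) \<longlonglongrightarrow> (l2_norm (lebesgue_on S) (weak_gradient S v))\<^sup>2"
    by (intro tendsto_intros tendsto_l2_norm test_function_gradient_L2 p H10_D[OF v] S)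
  ultimately show ?thesis
    by (rule LIMSEQ_le) (use P[OF p(1)] in blast)
qed

definition form_gap :: "'a::euclidean_space set \<Rightarrow> real \<Rightarrow> ('a \<Rightarrow> real) \<Rightarrow> ('a \<Rightarrow> real) \<Rightarrow> real" where
  "form_gap S \<tau> u v = l2_inner (lebesgue_on S) (weak_gradient S u) (weak_gradient S v) - damped_form S \<tau> u v"

lemma test_gap_tendsto:
  assumes S: "S \<in> lmeasurable" and t: "\<tau> > 0" and H: "H10 S u" "H10 S v"
    and p: "\<And>n. test_function S (\<psi> n)" "(\<lambda>n. l2_norm (lebesgue_on S) (\<lambda>x. \<psi> n x - u x)) \<longlonglongrightarrow> 0"
      "(\<lambda>n. l2_norm (lebesgue_on S) (\<lambda>x. gradient (\<psi> n) x - weak_gradient S u x)) \<longlonglongrightarrow> 0"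
    and q: "\<And>n. test_function S (\<theta> n)" "(\<lambda>n. l2_norm (lebesgue_on S) (\<lambda>x. \<theta> n x - v x)) \<longlonglongrightarrow> 0"
      "(\<lambda>n. l2_norm (lebesgue_on S) (\<lambda>x. gradient (\<theta> n) x - weak_gradient S v x)) \<longlonglongrightarrow> 0"
  shows "(\<lambda>n. test_gap S \<tau> (\<psi> n) (\<theta> n)) \<longlonglongrightarrow> form_gap S \<tau> u v"
  unfolding test_gap_def form_gap_def
  by (intro tendsto_diff tendsto_l2_inner tendsto_damped_form test_function_L2 test_function_gradient_L2
      S t p q H10_D H fmeasurableD[OF S])

lemma form_gap_nonneg:
  assumes S: "S \<in> lmeasurable" and t: "\<tau> > 0" and H: "H10 S v"
  shows "0 \<le> form_gap S \<tau> v v"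
proof -
  obtain \<psi> where p: "\<And>n. test_function S (\<psi> n)"
    "(\<lambda>n. l2_norm (lebesgue_on S) (\<lambda>x. \<psi> n x - v x)) \<longlonglongrightarrow> 0"
    "(\<lambda>n. l2_norm (lebesgue_on S) (\<lambda>x. gradient (\<psi> n) x - weak_gradient S v x)) \<longlonglongrightarrow> 0"
    by (rule H10_approximation[OF H]) (rule that)
  show ?thesis
    by (rule LIMSEQ_le_const[OF test_gap_tendsto[OF S t H H p p]]) (use test_gap_nonneg[OF S t p(1)] in blast)
qed

lemma form_gap_polar:
  assumes S: "S \<in> lmeasurable" and t: "\<tau> > 0" and H: "H10 S u" "H10 S v"
  shows "- form_gap S \<tau> u v \<le> (form_gap S \<tau> u u + form_gap S \<tau> v v) / 2"
proof -
  obtain \<psi> where p: "\<And>n. test_function S (\<psi> n)"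
    "(\<lambda>n. l2_norm (lebesgue_on S) (\<lambda>x. \<psi> n x - u x)) \<longlonglongrightarrow> 0"
    "(\<lambda>n. l2_norm (lebesgue_on S) (\<lambda>x. gradient (\<psi> n) x - weak_gradient S u x)) \<longlonglongrightarrow> 0"
    by (rule H10_approximation[OF H(1)]) (rule that)
  obtain \<theta> where q: "\<And>n. test_function S (\<theta> n)"
    "(\<lambda>n. l2_norm (lebesgue_on S) (\<lambda>x. \<theta> n x - v x)) \<longlonglongrightarrow> 0"
    "(\<lambda>n. l2_norm (lebesgue_on S) (\<lambda>x. gradient (\<theta> n) x - weak_gradient S v x)) \<longlonglongrightarrow> 0"
    by (rule H10_approximation[OF H(2)]) (rule that)
  show ?thesis
  proof (rule LIMSEQ_le)
    show "(\<lambda>n. - test_gap S \<tau> (\<psi> n) (\<theta> n)) \<longlonglongrightarrow> - form_gap S \<tau> u v"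
      by (intro tendsto_minus test_gap_tendsto S t H p q)
    show "(\<lambda>n. (test_gap S \<tau> (\<psi> n) (\<psi> n) + test_gap S \<tau> (\<theta> n) (\<theta> n)) / 2) \<longlonglongrightarrow> (form_gap S \<tau> u u + form_gap S \<tau> v v) / 2"
      by (intro tendsto_divide tendsto_add tendsto_const test_gap_tendsto S t H p q) simp
    show "\<exists>N. \<forall>n\<ge>N. - test_gap S \<tau> (\<psi> n) (\<theta> n) \<le> (test_gap S \<tau> (\<psi> n) (\<psi> n) + test_gap S \<tau> (\<theta> n) (\<theta> n)) / 2"
      using test_gap_polar[OF S t p(1) q(1)] by blast
  qed
qed

text \<open>The function is replaced by one fixed approximant, at a cost that does not depend on
  \<tau>. For this test function the damped form converges to the Dirichlet form.\<close>

lemma form_gap_tendsto_0: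
  assumes S: "S \<in> lmeasurable" and t: "\<And>n. \<tau> n > 0" "\<tau> \<longlonglongrightarrow> 0" and H: "H10 S v"
  shows "(\<lambda>n. form_gap S (\<tau> n) v v) \<longlonglongrightarrow> 0"
proof -
  have Sm: "S \<in> sets lebesgue" using S by (rule fmeasurableD)
  obtain \<psi> where p: "\<And>n. test_function S (\<psi> n)"
    "(\<lambda>n. l2_norm (lebesgue_on S) (\<lambda>x. \<psi> n x - v x)) \<longlonglongrightarrow> 0"
    "(\<lambda>n. l2_norm (lebesgue_on S) (\<lambda>x. gradient (\<psi> n) x - weak_gradient S v x)) \<longlonglongrightarrow> 0"
    by (rule H10_approximation[OF H]) (rule that)
  let ?d = "\<lambda>k. l2_norm (lebesgue_on S) (\<lambda>x. weak_gradient S v x - gradient (\<psi> k) x)"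
  have dsw: "?d k = l2_norm (lebesgue_on S) (\<lambda>x. gradient (\<psi> k) x - weak_gradient S v x)" for k
    by (rule l2_norm_minus_commute)
  have le: "form_gap S (\<tau> n) v v \<le> 2 * test_gap S (\<tau> n) (\<psi> k) (\<psi> k) + 2 * (?d k)\<^sup>2" for n k
  proof (rule LIMSEQ_le[OF test_gap_tendsto[OF S t(1) H H p p]])
    have L: "L2 (lebesgue_on S) (gradient (\<psi> m))" for m by (rule test_function_gradient_L2[OF p(1) Sm])
    have "(\<lambda>m. l2_norm (lebesgue_on S) (\<lambda>x. gradient (\<psi> m) x - gradient (\<psi> k) x)) \<longlonglongrightarrow> ?d k"
    proof (rule tendsto_l2_norm)
      show "(\<lambda>m. l2_norm (lebesgue_on S) (\<lambda>x. (gradient (\<psi> m) x - gradient (\<psi> k) x) - (weak_gradient S v x - gradient (\<psi> k) x))) \<longlonglongrightarrow> 0"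
        using p(3) by simp
    qed (intro L2_diff L H10_D[OF H])+
    then show "(\<lambda>m. 2 * test_gap S (\<tau> n) (\<psi> k) (\<psi> k) + 2 * (l2_norm (lebesgue_on S) (\<lambda>x. gradient (\<psi> m) x - gradient (\<psi> k) x))\<^sup>2)
       \<longlonglongrightarrow> 2 * test_gap S (\<tau> n) (\<psi> k) (\<psi> k) + 2 * (?d k)\<^sup>2"
      by (intro tendsto_intros)
    show "\<exists>N. \<forall>m\<ge>N. test_gap S (\<tau> n) (\<psi> m) (\<psi> m) \<le> 2 * test_gap S (\<tau> n) (\<psi> k) (\<psi> k) +
        2 * (l2_norm (lebesgue_on S) (\<lambda>x. gradient (\<psi> m) x - gradient (\<psi> k) x))\<^sup>2"
      using test_gap_le[OF S t(1) p(1) p(1)] by blast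
  qed
  have d0: "(\<lambda>k. 2 * (?d k)\<^sup>2) \<longlonglongrightarrow> 2 * 0\<^sup>2"
    unfolding dsw by (intro tendsto_intros p(3))
  show ?thesis
  proof (rule LIMSEQ_I)
    fix e :: real assume e: "e > 0"
    from LIMSEQ_D[OF d0, of "e/2"] e obtain k where k: "2 * (?d k)\<^sup>2 < e/2" by fastforce
    have "(\<lambda>n. test_gap S (\<tau> n) (\<psi> k) (\<psi> k)) \<longlonglongrightarrow>
       l2_inner (lebesgue_on S) (gradient (\<psi> k)) (gradient (\<psi> k)) - (l2_norm (lebesgue_on S) (gradient (\<psi> k)))\<^sup>2"
      unfolding test_gap_def by (intro tendsto_diff tendsto_const damped_form_test_function_tendsto p S t)
    then have "(\<lambda>n. test_gap S (\<tau> n) (\<psi> k) (\<psi> k)) \<longlonglongrightarrow> 0" by (simp add: l2_norm_power2)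
    from LIMSEQ_D[OF this, of "e/4"] e obtain N where N: "\<And>n. n \<ge> N \<Longrightarrow> \<bar>test_gap S (\<tau> n) (\<psi> k) (\<psi> k)\<bar> < e/4"
      by auto
    show "\<exists>N. \<forall>n\<ge>N. norm (form_gap S (\<tau> n) v v - 0) < e"
    proof (intro exI allI impI)
      fix n assume "n \<ge> N"
      from N[OF this] le[of n k] k form_gap_nonneg[OF S t(1) H, of n]
      show "norm (form_gap S (\<tau> n) v v - 0) < e" by simp
    qed
  qed
qed

text \<open>For a solution \<open>u\<close>, this is the source of the measurability of \<open>s \<mapsto> \<langle>\<nabla>u(s), \<nabla>v\<rangle>\<close>: the
  right-hand side is continuous in time.\<close>

lemma l2_inner_weak_gradient_test_function:
  assumes S: "S \<in> lmeasurable" and u: "L2 (lebesgue_on S) u" "has_weak_gradient S u G" and f: "test_function S f"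
  shows "l2_inner (lebesgue_on S) G (gradient f) =
    - l2_inner (lebesgue_on S) u (laplacian f)"
proof -
  have Sm: "S \<in> sets lebesgue" using S by (rule fmeasurableD)
  let ?D = "\<lambda>b x. frechet_derivative f (at x) b"
  have D: "test_function S (?D b)" for b by (rule test_function_directional_derivative[OF f])
  have DD: "test_function S (\<lambda>x. frechet_derivative (?D b) (at x) b)" for b
    by (rule test_function_directional_derivative[OF D])
  have G: "L2 (lebesgue_on S) G" using u by (simp add: has_weak_gradient_def)
  have Gb: "L2 (lebesgue_on S) (\<lambda>x. G x \<bullet> b)" if "b \<in> Basis" for b
    unfolding L2_def
  proof
    show m: "(\<lambda>x. G x \<bullet> b) \<in> borel_measurable (lebesgue_on S)" using L2_D(1)[OF G] by measurable
    show "integrable (lebesgue_on S) (\<lambda>x. (norm (G x \<bullet> b))\<^sup>2)"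
    proof (rule Bochner_Integration.integrable_bound[OF L2_D(2)[OF G]])
      show "AE x in lebesgue_on S. norm ((norm (G x \<bullet> b))\<^sup>2) \<le> norm ((norm (G x))\<^sup>2)"
        unfolding real_norm_def abs_power2 by (intro AE_I2 power_mono Basis_le_norm that) simp
    qed (use m in measurable)
  qed
  have "l2_inner (lebesgue_on S) G (gradient f) = (\<integral>x. (\<Sum>b\<in>Basis. (G x \<bullet> b) * ?D b x) \<partial>lebesgue_on S)"
    unfolding l2_inner_def by (subst euclidean_inner) (simp add: gradient_inner_Basis)
  also have "\<dots> = (\<Sum>b\<in>Basis. l2_inner (lebesgue_on S) (\<lambda>x. G x \<bullet> b) (?D b))"
    using L2_inner_integrable[OF Gb test_function_L2[OF D Sm]] unfolding l2_inner_def
    by (subst Bochner_Integration.integral_sum) auto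
  also have "\<dots> = (\<Sum>b\<in>Basis. - l2_inner (lebesgue_on S) u (\<lambda>x. frechet_derivative (?D b) (at x) b))"
  proof (rule sum.cong[OF refl])
    fix b :: 'a assume b: "b \<in> Basis"
    have "l2_inner (lebesgue_on S) u (\<lambda>x. gradient (?D b) x \<bullet> b) = - l2_inner (lebesgue_on S) (\<lambda>x. G x \<bullet> b) (?D b)"
      using u(2) D b by (simp add: has_weak_gradient_def)
    then show "l2_inner (lebesgue_on S) (\<lambda>x. G x \<bullet> b) (?D b) = - l2_inner (lebesgue_on S) u (\<lambda>x. frechet_derivative (?D b) (at x) b)"
      by (simp add: gradient_inner_Basis[OF b])
  qed
  also have "\<dots> = - (\<Sum>b\<in>Basis. l2_inner (lebesgue_on S) u (\<lambda>x. frechet_derivative (?D b) (at x) b))"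
    by (rule sum_negf)
  also have "(\<Sum>b\<in>Basis. l2_inner (lebesgue_on S) u (\<lambda>x. frechet_derivative (?D b) (at x) b))
     = l2_inner (lebesgue_on S) u (\<lambda>x. \<Sum>b\<in>Basis. frechet_derivative (?D b) (at x) b)"
    using L2_inner_integrable[OF u(1) test_function_L2[OF DD Sm]] unfolding l2_inner_def
    by (simp add: sum_distrib_left)
  finally show ?thesis unfolding laplacian_def[abs_def] .
qed

lemma L2_laplacian_test_function:
  assumes f: "test_function S f" and S: "S \<in> sets lebesgue"
  shows "L2 (lebesgue_on S) (laplacian f)"
  unfolding laplacian_def[abs_def]
proof (rule L2_compact_support[OF _ _ _ S])
  let ?K = "closure {x. f x \<noteq> 0}"
  show "continuous_on UNIV (\<lambda>x. \<Sum>b\<in>Basis. frechet_derivative (\<lambda>y. frechet_derivative f (at y) b) (at x) b)"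
    by (intro continuous_on_sum smooth_continuous smooth_directional_derivative test_function_smooth[OF f])
  show "compact ?K" using f by (simp add: test_function_def)
  fix x assume x: "x \<notin> ?K"
  have "closure {x. frechet_derivative f (at x) b \<noteq> 0} \<subseteq> ?K" for b
    by (intro closure_minimal) (auto intro: ccontr frechet_derivative_eq_0_outside)
  with x show "(\<Sum>b\<in>Basis. frechet_derivative (\<lambda>y. frechet_derivative f (at y) b) (at x) b) = 0"
    by (intro sum.neutral ballI frechet_derivative_eq_0_outside) blast
qed

section \<open>Functions of one real variable with small increments\<close>

text \<open>Both sides are averaged over \<open>t\<close> before \<open>h\<close> tends to \<open>0\<close>, so no differentiability of \<open>H\<close> is needed.\<close>

lemma increment_le_integral:
  fixes H g :: "real \<Rightarrow> real"
  assumes "t1 < t2" "\<delta> > 0" and c: "continuous_on {t1 - \<delta>..t2} H"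
    and g: "integrable (lebesgue_on {t1..t2}) g"
    and le: "AE t in lebesgue_on {t1..t2}. \<forall>h. 0 < h \<longrightarrow> h < \<delta> \<longrightarrow> H t - H (t - h) \<le> h * g t"
  shows "H t2 - H t1 \<le> integral\<^sup>L (lebesgue_on {t1..t2}) g"
proof -
  define a where "a = t1 - \<delta>"
  \<comment> \<open>A primitive of \<open>H\<close>: the mean of \<open>H\<close> over a window of
    length h is a difference quotient of \<open>K\<close>, which converges by continuity of
    \<open>H\<close> alone. Only windows to the left are used, so that the end point
    \<open>t2\<close> is admissible.\<close>
  define K where "K x = integral {a..x} H" for x
  have ca: "continuous_on {a..t2} H" using c by (simp add: a_def)
  have Kd: "(K has_real_derivative H x) (at x within {a..t2})" if "x \<in> {a..t2}" for x
    unfolding K_def[abs_def] by (rule integral_has_real_derivative[OF ca that])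
  have quot: "((\<lambda>h. (K x - K (x - h)) / h) \<longlongrightarrow> H x) (at_right 0)" if x: "a < x" "x \<le> t2" for x
  proof -
    have "(K has_real_derivative H x) (at x within {a..x})"
      using has_field_derivative_subset[OF Kd[of x], of "{a..x}"] x by auto
    then have 1: "((\<lambda>y. (K y - K x) / (y - x)) \<longlongrightarrow> H x) (at x within {a..x})"
      by (simp add: has_field_derivative_iff)
    have "filterlim (\<lambda>h. x - h) (at x within {a..x}) (at_right 0)"
      unfolding filterlim_at
    proof
      show "\<forall>\<^sub>F h in at_right 0. x - h \<in> {a..x} \<and> x - h \<noteq> x"
        using x by (intro eventually_at_rightI[of 0 "x - a"]) auto
      have "((\<lambda>h. x - h) \<longlongrightarrow> x - 0) (at_right 0)" by (intro tendsto_intros)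
      then show "((\<lambda>h. x - h) \<longlongrightarrow> x) (at_right 0)" by simp
    qed
    from filterlim_compose[OF 1 this] have "((\<lambda>h. (K (x - h) - K x) / (x - h - x)) \<longlongrightarrow> H x) (at_right 0)" .
    moreover have "(K (x - h) - K x) / (x - h - x) = (K x - K (x - h)) / h" for h
      by (cases "h = 0") (auto simp: field_simps)
    ultimately show ?thesis by simp
  qed
  \<comment> \<open>Integrating the hypothesis over t telescopes: what is left of
    \<open>H t - H (t - h)\<close> is one window of length h at each end point.\<close>
  have bound: "((K t2 - K (t2 - h)) / h) - ((K t1 - K (t1 - h)) / h) \<le> integral\<^sup>L (lebesgue_on {t1..t2}) g"
    if h: "0 < h" "h < \<delta>" for h
  proof -
    have ci: "continuous_on {t1..t2} H" "continuous_on {t1..t2} (\<lambda>t. H (t - h))"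
      using h assms(1) by (auto intro!: continuous_on_compose2[OF c] continuous_intros continuous_on_subset[OF c])
    have I: "integrable (lebesgue_on {t1..t2}) H" "integrable (lebesgue_on {t1..t2}) (\<lambda>t. H (t - h))"
      using ci by (auto intro: continuous_imp_integrable_real)
    have "integral\<^sup>L (lebesgue_on {t1..t2}) (\<lambda>t. H t - H (t - h)) \<le> integral\<^sup>L (lebesgue_on {t1..t2}) (\<lambda>t. h * g t)"
      using le h by (intro integral_mono_AE Bochner_Integration.integrable_diff I integrable_mult_right g) auto
    then have "integral\<^sup>L (lebesgue_on {t1..t2}) H - integral\<^sup>L (lebesgue_on {t1..t2}) (\<lambda>t. H (t - h)) \<le> h * integral\<^sup>L (lebesgue_on {t1..t2}) g"
      using I by simp
    moreover have "integral\<^sup>L (lebesgue_on {t1..t2}) H = K t2 - K t1"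
    proof -
      have "H integrable_on {a..t2}" using ca by (rule integrable_continuous_real)
      from Henstock_Kurzweil_Integration.integral_combine[OF _ _ this, of t1] assms(1,2)
      have "integral {t1..t2} H = K t2 - K t1" by (simp add: K_def a_def)
      then show ?thesis using lebesgue_integral_eq_integral[OF I(1)] by simp
    qed
    moreover have "integral\<^sup>L (lebesgue_on {t1..t2}) (\<lambda>t. H (t - h)) = K (t2 - h) - K (t1 - h)"
    proof -
      have "H integrable_on {a..t2 - h}"
        using h by (intro integrable_continuous_real continuous_on_subset[OF ca]) auto
      from Henstock_Kurzweil_Integration.integral_combine[OF _ _ this, of "t1 - h"] assms(1,2) h
      have "integral {t1 - h..t2 - h} H = K (t2 - h) - K (t1 - h)" by (simp add: K_def a_def)
      moreover have "integral {t1..t2} (\<lambda>t. H (t - h)) = integral {t1 - h..t2 - h} H"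
        using integral_shift_real_ivl[of "t1 - h" "- h" "t2 - h" H] by simp
      ultimately show ?thesis using lebesgue_integral_eq_integral[OF I(2)] by simp
    qed
    ultimately have "((K t2 - K (t2 - h)) - (K t1 - K (t1 - h))) / h \<le> integral\<^sup>L (lebesgue_on {t1..t2}) g"
      using h by (simp add: field_simps)
    then show ?thesis by (simp add: diff_divide_distrib)
  qed
  show ?thesis
  proof (rule tendsto_upperbound)
    show "((\<lambda>h. ((K t2 - K (t2 - h)) / h) - ((K t1 - K (t1 - h)) / h)) \<longlongrightarrow> H t2 - H t1) (at_right 0)"
      using assms(1,2) by (intro tendsto_diff quot) (auto simp: a_def)
    show "\<forall>\<^sub>F h in at_right 0. ((K t2 - K (t2 - h)) / h) - ((K t1 - K (t1 - h)) / h) \<le> integral\<^sup>L (lebesgue_on {t1..t2}) g"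
      using bound assms(2) by (intro eventually_at_rightI[of 0 \<delta>]) auto
  qed simp
qed

text \<open>The hypothesis is one step of the implicit Euler scheme for E' = - m E. With n equal
  steps on [0, t] it gives the bound with (1 + m t / n)^n, and n tends to infinity.\<close>

lemma exp_decay_of_implicit_step:
  fixes E :: "real \<Rightarrow> real"
  assumes m: "m \<ge> 0" and step: "\<And>s t. 0 \<le> s \<Longrightarrow> s < t \<Longrightarrow> E t * (1 + m * (t - s)) \<le> E s" and t: "t \<ge> 0"
  shows "E t * exp (m * t) \<le> E 0"
proof (cases "t = 0")
  case False
  then have t: "t > 0" using t by simp
  have p: "E t * (1 + (m * t) / real n) ^ n \<le> E 0" if n: "n > 0" for n
  proof -
    define q where "q = 1 + (m * t) / real n"
    have q: "q \<ge> 0" using m t by (simp add: q_def)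
    have "E (real k * (t / real n)) * q ^ k \<le> E 0" for k
    proof (induction k)
      case (Suc k)
      have "E (real (Suc k) * (t / real n)) * (1 + m * (real (Suc k) * (t / real n) - real k * (t / real n))) \<le> E (real k * (t / real n))"
        using t n by (intro step) (auto simp: field_simps)
      moreover have "1 + m * (real (Suc k) * (t / real n) - real k * (t / real n)) = q"
        using n by (simp add: q_def field_simps)
      ultimately have "E (real (Suc k) * (t / real n)) * q \<le> E (real k * (t / real n))" by simp
      then have "E (real (Suc k) * (t / real n)) * q * q ^ k \<le> E (real k * (t / real n)) * q ^ k"
        using q by (intro mult_right_mono) auto
      with Suc show ?case by (simp add: mult.assoc)
    qed simp
    from this[of n] show ?thesis using n by (simp add: q_def)
  qed
  have "(\<lambda>n. E t * (1 + (m * t) / real n) ^ n) \<longlonglongrightarrow> E t * exp (m * t)"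
    by (intro tendsto_mult tendsto_const tendsto_exp_limit_sequentially)
  then show ?thesis by (rule LIMSEQ_le_const2) (use p in \<open>auto intro: exI[of _ 1]\<close>)
qed simp

text \<open>The error \<open>q\<close> may change with \<eta>; only its integral is small. It enters
  at the time t and also through its integral over the window. The latter is removed by subtracting
  the primitive \<open>P\<close> of \<open>q\<close> from the energy, so that
  \<open>increment_le_integral\<close> applies to the difference.\<close>

lemma exp_decay_of_energy_increments:
  fixes E :: "real \<Rightarrow> real"
  assumes c: "continuous_on {0..} E" and nn: "\<And>t. 0 \<le> t \<Longrightarrow> 0 \<le> E t" and m: "m \<ge> 0"
    and inc: "\<And>T \<eta>. 0 < T \<Longrightarrow> 0 < \<eta> \<Longrightarrow> \<exists>\<delta> q. 0 < \<delta> \<and> integrable (lebesgue_on {0..T}) q \<and> (\<forall>t. 0 \<le> q t) \<and>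
       integral\<^sup>L (lebesgue_on {0..T}) q \<le> \<eta> \<and>
       (AE t in lebesgue_on {0..T}. \<forall>h. 0 < h \<longrightarrow> h < \<delta> \<longrightarrow> h \<le> t \<longrightarrow>
          E t - E (t - h) \<le> h * (\<eta> + 3 * q t - m * E t) + integral\<^sup>L (lebesgue_on {t - h..t}) q)"
    and t: "t \<ge> 0"
  shows "E t \<le> exp (- m * t) * E 0"
proof -
  have diss: "E t2 - E t1 \<le> - m * integral\<^sup>L (lebesgue_on {t1..t2}) E" if t12: "0 < t1" "t1 < t2" for t1 t2
  proof -
    have cE: "continuous_on {t1..t2} E" by (rule continuous_on_subset[OF c]) (use t12 in auto)
    have IE: "integrable (lebesgue_on {t1..t2}) E" by (rule continuous_imp_integrable_real[OF cE])
    \<comment> \<open>Of the factor 4, three parts come from the term \<open>3 * q t\<close> and one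
      from the primitive that was subtracted; the length of the interval multiplies the constant
      error \<eta>.\<close>
    have b: "E t2 - E t1 \<le> - m * integral\<^sup>L (lebesgue_on {t1..t2}) E + (4 + (t2 - t1)) * \<eta>" if \<eta>: "\<eta> > 0" for \<eta>
    proof -
      obtain \<delta> q where d: "0 < \<delta>" and q: "integrable (lebesgue_on {0..t2}) q" "\<And>t. 0 \<le> q t" "integral\<^sup>L (lebesgue_on {0..t2}) q \<le> \<eta>"
        and ae: "AE t in lebesgue_on {0..t2}. \<forall>h. 0 < h \<longrightarrow> h < \<delta> \<longrightarrow> h \<le> t \<longrightarrow>
          E t - E (t - h) \<le> h * (\<eta> + 3 * q t - m * E t) + integral\<^sup>L (lebesgue_on {t - h..t}) q"
        using inc[of t2 \<eta>] t12 \<eta> by auto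
      define P where "P x = integral {0..x} q" for x
      have qi: "q integrable_on {0..t2}" by (rule integrable_on_lebesgue_on[OF q(1)]) simp
      have Pc: "continuous_on {0..t2} P" unfolding P_def[abs_def] by (rule indefinite_integral_continuous_1[OF qi])
      have Pd: "integral\<^sup>L (lebesgue_on {r..s}) q = P s - P r" if "0 \<le> r" "r \<le> s" "s \<le> t2" for r s
      proof -
        have "q integrable_on {0..s}" by (rule integrable_on_subinterval[OF qi]) (use that in auto)
        from Henstock_Kurzweil_Integration.integral_combine[OF _ _ this, of r] that
        have "integral {r..s} q = P s - P r" by (simp add: P_def)
        moreover have "integrable (lebesgue_on {r..s}) q" by (rule integrable_subinterval[OF q(1)]) (use that in auto)
        ultimately show ?thesis using lebesgue_integral_eq_integral[of "{r..s}" q] by simp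
      qed
      \<comment> \<open>Steps shorter than \<open>t1\<close> keep \<open>t - h\<close> nonnegative
        for all t in the interval; hence the restriction to \<open>0 < t1\<close>.\<close>
      define \<delta>' where "\<delta>' = min \<delta> t1"
      have d': "\<delta>' > 0" using d t12 by (simp add: \<delta>'_def)
      define H where "H t = E t - P t" for t
      have qs: "integrable (lebesgue_on {t1..t2}) q" by (rule integrable_subinterval[OF q(1)]) (use t12 in auto)
      have "H t2 - H t1 \<le> integral\<^sup>L (lebesgue_on {t1..t2}) (\<lambda>t. \<eta> + 3 * q t - m * E t)"
      proof (rule increment_le_integral[OF t12(2) d'])
        show "continuous_on {t1 - \<delta>'..t2} H" unfolding H_def
          by (intro continuous_on_diff continuous_on_subset[OF c] continuous_on_subset[OF Pc]) (auto simp: \<delta>'_def)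
        show "integrable (lebesgue_on {t1..t2}) (\<lambda>t. \<eta> + 3 * q t - m * E t)"
          using qs IE by (intro Bochner_Integration.integrable_diff Bochner_Integration.integrable_add integrable_mult_right) auto
        have "AE t in lebesgue. t \<in> {0..t2} \<longrightarrow> (\<forall>h. 0 < h \<longrightarrow> h < \<delta> \<longrightarrow> h \<le> t \<longrightarrow>
          E t - E (t - h) \<le> h * (\<eta> + 3 * q t - m * E t) + integral\<^sup>L (lebesgue_on {t - h..t}) q)"
          using ae by (simp add: AE_restrict_space_iff)
        then have "AE t in lebesgue. t \<in> {t1..t2} \<longrightarrow> (\<forall>h. 0 < h \<longrightarrow> h < \<delta>' \<longrightarrow> H t - H (t - h) \<le> h * (\<eta> + 3 * q t - m * E t))"
        proof eventually_elim
          case (elim t)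
          show ?case
          proof (intro impI allI)
            fix h assume t: "t \<in> {t1..t2}" and h: "0 < h" "h < \<delta>'"
            then have "E t - E (t - h) \<le> h * (\<eta> + 3 * q t - m * E t) + integral\<^sup>L (lebesgue_on {t - h..t}) q"
              using elim t12 by (auto simp: \<delta>'_def)
            moreover have "integral\<^sup>L (lebesgue_on {t - h..t}) q = P t - P (t - h)"
              by (rule Pd) (use t h in \<open>auto simp: \<delta>'_def\<close>)
            ultimately show "H t - H (t - h) \<le> h * (\<eta> + 3 * q t - m * E t)" by (simp add: H_def)
          qed
        qed
        then show "AE t in lebesgue_on {t1..t2}. \<forall>h. 0 < h \<longrightarrow> h < \<delta>' \<longrightarrow> H t - H (t - h) \<le> h * (\<eta> + 3 * q t - m * E t)"
          by (simp add: AE_restrict_space_iff)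
      qed
      also have "\<dots> = (t2 - t1) * \<eta> + 3 * integral\<^sup>L (lebesgue_on {t1..t2}) q - m * integral\<^sup>L (lebesgue_on {t1..t2}) E"
        using qs IE t12 by (simp add: measure_restrict_space)
      finally have 1: "E t2 - E t1 \<le> P t2 - P t1 + (t2 - t1) * \<eta> + 3 * integral\<^sup>L (lebesgue_on {t1..t2}) q - m * integral\<^sup>L (lebesgue_on {t1..t2}) E"
        by (simp add: H_def)
      have "integral\<^sup>L (lebesgue_on {t1..t2}) q = P t2 - P t1" using Pd t12 by simp
      moreover have "P t2 \<le> \<eta>" using Pd[of 0 t2] q(3) t12 by (simp add: P_def)
      moreover have "0 \<le> P t1" using Pd[of 0 t1] q(2) t12 by (simp add: P_def Henstock_Kurzweil_Integration.integral_nonneg integrable_on_subinterval[OF qi])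
      ultimately show ?thesis using 1 by (simp add: algebra_simps)
    qed
    show ?thesis
    proof (rule field_le_epsilon)
      fix e :: real assume "e > 0"
      then show "E t2 - E t1 \<le> - m * integral\<^sup>L (lebesgue_on {t1..t2}) E + e"
        using b[of "e / (4 + (t2 - t1))"] t12 by simp
    qed
  qed
  have mono: "E t2 \<le> E t1" if "0 < t1" "t1 < t2" for t1 t2
  proof -
    have "0 \<le> integral\<^sup>L (lebesgue_on {t1..t2}) E"
      by (intro integral_nonneg_AE AE_I2 nn) (use that in simp)
    then have "0 \<le> m * integral\<^sup>L (lebesgue_on {t1..t2}) E" using m by simp
    then show ?thesis using diss[OF that] by linarith
  qed
  \<comment> \<open>As the energy does not increase, its integral is at least the length of the
    interval times the value at the right end. It is this value that makes the step an implicit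
    one.\<close>
  have step1: "E t2 * (1 + m * (t2 - t1)) \<le> E t1" if t12: "0 < t1" "t1 < t2" for t1 t2
  proof -
    have "integrable (lebesgue_on {t1..t2}) E"
      by (rule continuous_imp_integrable_real[OF continuous_on_subset[OF c]]) (use t12 in auto)
    then have "integral\<^sup>L (lebesgue_on {t1..t2}) (\<lambda>_. E t2) \<le> integral\<^sup>L (lebesgue_on {t1..t2}) E"
    proof (intro integral_mono)
      fix x assume "x \<in> space (lebesgue_on {t1..t2})"
      then show "E t2 \<le> E x" using t12 mono[of x t2] by (cases "x = t2") auto
    qed simp
    then have "(t2 - t1) * E t2 \<le> integral\<^sup>L (lebesgue_on {t1..t2}) E"
      using t12 by (simp add: measure_restrict_space)
    then have "m * ((t2 - t1) * E t2) \<le> m * integral\<^sup>L (lebesgue_on {t1..t2}) E"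
      using m by (rule mult_left_mono)
    then show ?thesis using diss[OF t12] by (simp add: algebra_simps)
  qed
  \<comment> \<open>The excluded case \<open>t1 = 0\<close> is recovered from continuity of the
    energy at 0.\<close>
  have step: "E t2 * (1 + m * (t2 - t1)) \<le> E t1" if t12: "0 \<le> t1" "t1 < t2" for t1 t2
  proof (cases "t1 = 0")
    case True
    have "(E \<longlongrightarrow> E 0) (at 0 within {0..})" using c by (auto simp: continuous_on_def)
    then have 1: "(E \<longlongrightarrow> E 0) (at_right 0)" by (rule tendsto_within_subset) auto
    have 2: "((\<lambda>s. E t2 * (1 + m * (t2 - s))) \<longlongrightarrow> E t2 * (1 + m * (t2 - 0))) (at_right 0)"
      by (intro tendsto_intros)
    have "\<forall>\<^sub>F s in at_right 0. E t2 * (1 + m * (t2 - s)) \<le> E s"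
      using t12 True step1 by (intro eventually_at_rightI[of 0 t2]) auto
    from tendsto_le[OF _ 1 2 this] show ?thesis using True by simp
  qed (use step1 t12 in auto)
  from exp_decay_of_implicit_step[OF m step t]
  have "E t * exp (m * t) * exp (- m * t) \<le> E 0 * exp (- m * t)" by (intro mult_right_mono) auto
  moreover have "exp (m * t) * exp (- m * t) = 1" by (simp flip: exp_add)
  ultimately show ?thesis by (simp only: mult.assoc mult_1_right mult.commute[of "E 0"])
qed

section \<open>The energy inequality for weak solutions\<close>

text \<open>Completeness of Lebesgue measure absorbs the null set on which convergence fails.
  Extension by 0 moves the argument to the whole line.\<close>

lemma borel_measurable_AE_limit_lebesgue_on:
  fixes f :: "nat \<Rightarrow> real \<Rightarrow> real"
  assumes A: "A \<in> sets lebesgue" and f: "\<And>k. f k \<in> borel_measurable (lebesgue_on A)"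
    and lim: "AE s in lebesgue_on A. (\<lambda>k. f k s) \<longlonglongrightarrow> g s"
  shows "g \<in> borel_measurable (lebesgue_on A)"
proof -
  define F where "F k s = indicator A s *\<^sub>R f k s" for k s
  have A': "A \<inter> space lebesgue \<in> sets lebesgue" using A by simp
  have F: "F k \<in> borel_measurable lebesgue" for k
    using f[of k] unfolding F_def[abs_def] borel_measurable_restrict_space_iff[OF A'] by simp
  then have 1: "(\<lambda>s. lim (\<lambda>k. F k s)) \<in> borel_measurable lebesgue" by (rule borel_measurable_lim_metric)
  have "AE s in lebesgue. lim (\<lambda>k. F k s) = indicator A s *\<^sub>R g s"
  proof -
    have "AE s in lebesgue. s \<in> A \<longrightarrow> (\<lambda>k. f k s) \<longlonglongrightarrow> g s"
      using lim by (simp add: AE_restrict_space_iff[OF A'])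
    then show ?thesis
    proof eventually_elim
      case (elim s)
      then show ?case by (cases "s \<in> A") (auto simp: F_def intro: limI)
    qed
  qed
  from borel_measurable_AE[OF 1 this] show ?thesis
    by (simp add: borel_measurable_restrict_space_iff[OF A'])
qed

section \<open>Continuity in time of functions with values in L2\<close>

lemma C_L2_D: "C_L2 M u \<Longrightarrow> 0 \<le> t \<Longrightarrow> L2 M (u t)"
  by (simp add: C_L2_def)

text \<open>The convergence lemmas require every member of a family to lie in L2, whereas
  \<open>C_L2\<close> is silent about negative times. The family \<open>u (max 0 s)\<close> meets
  the requirement and agrees with \<open>u s\<close> within \<open>{0..}\<close>.\<close>

lemma C_L2_continuous_on:
  assumes u: "C_L2 M u"
    and \<Phi>: "\<And>U v F. (\<And>i::real. L2 M (U i)) \<Longrightarrow> L2 M v \<Longrightarrow> ((\<lambda>i. l2_norm M (\<lambda>x. U i x - v x)) \<longlongrightarrow> 0) F \<Longrightarrow>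
       ((\<lambda>i. \<Phi> (U i)) \<longlongrightarrow> (\<Phi> v :: real)) F"
  shows "continuous_on {0..} (\<lambda>t. \<Phi> (u t))"
  unfolding continuous_on_def
proof
  fix t :: real assume t: "t \<in> {0..}"
  have "((\<lambda>s. l2_norm M (\<lambda>x. u s x - u t x)) \<longlongrightarrow> 0) (at t within {0..})"
    using u t by (simp add: C_L2_def)
  then have "((\<lambda>s. l2_norm M (\<lambda>x. u (max 0 s) x - u t x)) \<longlongrightarrow> 0) (at t within {0..})"
    by (rule Lim_transform_eventually) (auto simp: eventually_at_filter max_def)
  then have "((\<lambda>s. \<Phi> (u (max 0 s))) \<longlongrightarrow> \<Phi> (u t)) (at t within {0..})"
    using u t by (intro \<Phi>) (auto intro: C_L2_D)
  then show "((\<lambda>s. \<Phi> (u s)) \<longlongrightarrow> \<Phi> (u t)) (at t within {0..})"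
    by (rule Lim_transform_eventually) (auto simp: eventually_at_filter max_def)
qed

lemma C_L2_norm_continuous:
  assumes "C_L2 M u" shows "continuous_on {0..} (\<lambda>t. l2_norm M (u t))"
  by (rule C_L2_continuous_on[OF assms]) (rule tendsto_l2_norm)

lemma C_L2_norm_diff_continuous:
  assumes u: "C_L2 M u" and v: "L2 M v"
  shows "continuous_on {0..} (\<lambda>t. l2_norm M (\<lambda>x. u t x - v x))"
proof (rule C_L2_continuous_on[OF u, where \<Phi> = "\<lambda>w. l2_norm M (\<lambda>x. w x - v x)"])
  fix U :: "real \<Rightarrow> 'a \<Rightarrow> real" and w F
  assume "\<And>i. L2 M (U i)" "L2 M w" "((\<lambda>i. l2_norm M (\<lambda>x. U i x - w x)) \<longlongrightarrow> 0) F"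
  then show "((\<lambda>i. l2_norm M (\<lambda>x. U i x - v x)) \<longlongrightarrow> l2_norm M (\<lambda>x. w x - v x)) F"
    by (intro tendsto_l2_norm L2_diff v) auto
qed

lemma C_L2_inner_continuous:
  assumes u: "C_L2 M u" and v: "L2 M v"
  shows "continuous_on {0..} (\<lambda>t. l2_inner M (u t) v)"
proof (rule C_L2_continuous_on[OF u, where \<Phi> = "\<lambda>w. l2_inner M w v"])
  fix U :: "real \<Rightarrow> 'a \<Rightarrow> real" and w F
  assume "\<And>i. L2 M (U i)" "L2 M w" "((\<lambda>i. l2_norm M (\<lambda>x. U i x - w x)) \<longlongrightarrow> 0) F"
  then show "((\<lambda>i. l2_inner M (U i) v) \<longlongrightarrow> l2_inner M w v) F"
    by (rule tendsto_l2_inner[OF _ v _ v]) (simp add: l2_norm_def)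
qed

lemma C_L2_damped_form_continuous:
  assumes u: "C_L2 (lebesgue_on S) u" and S: "S \<in> lmeasurable" and t: "\<tau> > 0"
  shows "continuous_on {0..} (\<lambda>t. damped_form S \<tau> (u t) (u t))"
  by (rule C_L2_continuous_on[OF u, where \<Phi> = "\<lambda>w. damped_form S \<tau> w w"]) (rule tendsto_damped_form[OF S t])

text \<open>The L2 functions are not a metric type here, so uniform continuity is applied to the
  real function \<open>f\<close> of two times. It vanishes on the diagonal, and comparing (s, t)
  with (s, s) gives the claim.\<close>

lemma C_L2_uniformly_continuous:
  assumes u: "C_L2 M u" and \<eta>: "\<eta> > 0"
  obtains \<delta> where "\<delta> > 0" "\<And>s t. s \<in> {0..T} \<Longrightarrow> t \<in> {0..T} \<Longrightarrow> \<bar>s - t\<bar> < \<delta> \<Longrightarrow> l2_norm M (\<lambda>x. u s x - u t x) < \<eta>"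
proof -
  let ?d = "\<lambda>s t. l2_norm M (\<lambda>x. u s x - u t x)"
  define f where "f p = ?d (fst p) (snd p)" for p
  have sw: "?d s t = ?d t s" for s t by (rule l2_norm_minus_commute)
  have tr: "?d a b \<le> ?d a c + ?d c b" if "0 \<le> a" "0 \<le> b" "0 \<le> c" for a b c
    by (rule l2_norm_triangle) (use that u in \<open>auto intro: C_L2_D\<close>)
  have "continuous_on ({0..T} \<times> {0..T}) f"
    unfolding continuous_on_def
  proof
    fix p :: "real \<times> real" assume p: "p \<in> {0..T} \<times> {0..T}"
    have c: "continuous_on ({0..T} \<times> {0..T}) (\<lambda>q. ?d (fst q) (fst p) + ?d (snd q) (snd p))"
      using p by (intro continuous_on_add continuous_on_compose2[OF C_L2_norm_diff_continuous[OF u C_L2_D[OF u]]] continuous_intros) auto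
    show "(f \<longlongrightarrow> f p) (at p within {0..T} \<times> {0..T})"
    proof (rule LIM_zero_cancel, rule Lim_null_comparison)
      show "\<forall>\<^sub>F q in at p within {0..T} \<times> {0..T}. norm (f q - f p) \<le> ?d (fst q) (fst p) + ?d (snd q) (snd p)"
        unfolding eventually_at_filter
      proof (intro always_eventually allI impI)
        fix q assume "q \<in> {0..T} \<times> {0..T}"
        then have nn: "0 \<le> fst q" "0 \<le> snd q" "0 \<le> fst p" "0 \<le> snd p" using p by auto
        have "f q \<le> ?d (fst q) (fst p) + f p + ?d (snd p) (snd q)"
          unfolding f_def using tr[of "fst q" "snd q" "fst p"] tr[of "fst p" "snd q" "snd p"] nn by simp
        moreover have "f p \<le> ?d (fst p) (fst q) + f q + ?d (snd q) (snd p)"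
          unfolding f_def using tr[of "fst p" "snd p" "fst q"] tr[of "fst q" "snd p" "snd q"] nn by simp
        ultimately show "norm (f q - f p) \<le> ?d (fst q) (fst p) + ?d (snd q) (snd p)"
          using sw[of "fst p" "fst q"] sw[of "snd p" "snd q"] by simp
      qed
      have "((\<lambda>q. ?d (fst q) (fst p) + ?d (snd q) (snd p)) \<longlongrightarrow> ?d (fst p) (fst p) + ?d (snd p) (snd p)) (at p within {0..T} \<times> {0..T})"
        using c p unfolding continuous_on_def by blast
      then show "((\<lambda>q. ?d (fst q) (fst p) + ?d (snd q) (snd p)) \<longlongrightarrow> 0) (at p within {0..T} \<times> {0..T})"
        by (simp add: l2_norm_def)
    qed
  qed
  then have "uniformly_continuous_on ({0..T} \<times> {0..T}) f"
    by (rule compact_uniformly_continuous) (intro compact_Times compact_Icc)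
  then obtain \<delta> where d: "\<delta> > 0" "\<And>p q. p \<in> {0..T} \<times> {0..T} \<Longrightarrow> q \<in> {0..T} \<times> {0..T} \<Longrightarrow> dist q p < \<delta> \<Longrightarrow> dist (f q) (f p) < \<eta>"
    unfolding uniformly_continuous_on_def using \<eta> by blast
  show ?thesis
  proof (rule that[OF d(1)])
    fix s t assume st: "s \<in> {0..T}" "t \<in> {0..T}" "\<bar>s - t\<bar> < \<delta>"
    have "dist (s, t) (s, s) < \<delta>" using st by (simp add: dist_Pair_Pair dist_real_def abs_minus_commute)
    then have "dist (f (s, t)) (f (s, s)) < \<eta>" using st by (intro d) auto
    moreover have "f (s, s) = 0" by (simp add: f_def l2_norm_def)
    ultimately show "?d s t < \<eta>" by (simp add: f_def dist_real_def)
  qed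
qed

section \<open>The energy argument on a single subdomain\<close>

lemma l2_norm_mono:
  assumes "L2 M u" "L2 M v" "K \<ge> 0" "\<And>x. \<bar>u x\<bar> \<le> K * \<bar>v x\<bar>"
  shows "l2_norm M u \<le> K * l2_norm M (v :: _ \<Rightarrow> real)"
proof (rule power2_le_imp_le)
  have "(\<integral>x. (u x)\<^sup>2 \<partial>M) \<le> (\<integral>x. K\<^sup>2 * (v x)\<^sup>2 \<partial>M)"
  proof (rule integral_mono)
    fix x show "(u x)\<^sup>2 \<le> K\<^sup>2 * (v x)\<^sup>2"
      using power_mono[OF assms(4), of x 2] by (simp add: power_mult_distrib)
  qed (use L2_D(2)[OF assms(1)] L2_D(2)[OF assms(2)] in auto)
  then show "(l2_norm M u)\<^sup>2 \<le> (K * l2_norm M v)\<^sup>2"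
    unfolding power_mult_distrib l2_norm_power2 l2_inner_def by (simp add: power2_eq_square)
qed (use assms in simp)

text \<open>The reaction term is kept as a source dominated pointwise by the solution, and the
  spectral gap as an inequality for test functions only, the class on which the Fourier argument
  runs.\<close>

locale dissipative_heat_solution =
  fixes S :: "'a::euclidean_space set" and u F :: "real \<Rightarrow> 'a \<Rightarrow> real" and u0 :: "'a \<Rightarrow> real" and L K :: real
  assumes S: "S \<in> lmeasurable" and sol: "weak_heat_solution S (\<lambda>t x. 0) F u0 u"
    and L: "0 \<le> L" and F_le: "\<And>t x. \<bar>F t x\<bar> \<le> L * \<bar>u t x\<bar>"
    and poincare: "\<And>\<psi>. test_function S \<psi> \<Longrightarrow> K * (l2_norm (lebesgue_on S) \<psi>)\<^sup>2 \<le> (l2_norm (lebesgue_on S) (gradient \<psi>))\<^sup>2"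
begin

abbreviation "Ms \<equiv> lebesgue_on S"
abbreviation "grad t \<equiv> weak_gradient S (u t)"
abbreviation "energy t \<equiv> (l2_norm Ms (u t))\<^sup>2"

lemma Sm: "S \<in> sets lebesgue" using S by (rule fmeasurableD)

lemma u_cont: "C_L2 Ms u" using sol by (simp add: weak_heat_solution_def)
lemmas u_L2 = C_L2_D[OF u_cont]
lemma u0_L2: "L2 Ms u0" using sol by (simp add: weak_heat_solution_def)

text \<open>The times at which the solution is itself an admissible test function and the source can
  be paired with it.\<close>

definition "good t \<longleftrightarrow> H10 S (u t) \<and> L2 Ms (F t)"

lemma AE_good: "AE t in lebesgue. 0 \<le> t \<longrightarrow> good t"
proof -
  have "AE t in lebesgue_on {0..}. H10 S (u t)" "AE t in lebesgue_on {0..}. L2 Ms (F t)"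
    using sol unfolding weak_heat_solution_def L1loc_L2_def by (auto elim: AE_mp)
  then have "AE t in lebesgue_on {0..}. good t" unfolding good_def by (rule AE_conjI)
  then show ?thesis by (simp add: AE_restrict_space_iff)
qed

lemma AE_good_on: "AE t in lebesgue_on {a..b}. 0 \<le> t \<longrightarrow> good t"
  using AE_good by (auto simp: AE_restrict_space_iff elim: AE_mp)

lemma grad_integrable: "0 \<le> T \<Longrightarrow> integrable (lebesgue_on {0..T}) (\<lambda>t. (l2_norm Ms (grad t))\<^sup>2)"
  using sol by (simp add: weak_heat_solution_def)

lemma weak_form:
  assumes "H10 S v" "0 \<le> t"
  shows "l2_inner Ms (u t) v - l2_inner Ms u0 v =
     (\<integral>s. (- l2_inner Ms (grad s) (weak_gradient S v) + l2_inner Ms (F s) v) \<partial>(lebesgue_on {0..t}))"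
  using sol assms by (simp add: weak_heat_solution_def)

lemma F_norm_le: "good t \<Longrightarrow> 0 \<le> t \<Longrightarrow> l2_norm Ms (F t) \<le> L * l2_norm Ms (u t)"
  by (rule l2_norm_mono) (use L F_le u_L2 in \<open>auto simp: good_def\<close>)

lemma norm_u_continuous: "continuous_on {0..T} (\<lambda>t. l2_norm Ms (u t))"
  by (rule continuous_on_subset[OF C_L2_norm_continuous[OF u_cont]]) auto

text \<open>The weak formulation does not assert that its integrand is integrable, and the integral
  of a non-integrable function is 0 by default. Integrability is needed to subtract the identities
  at two times and to estimate the integrand pointwise.\<close>

lemma integrand_integrable:
  assumes v: "H10 S v" and T: "0 \<le> T"
  shows "integrable (lebesgue_on {0..T}) (\<lambda>s. - l2_inner Ms (grad s) (weak_gradient S v) + l2_inner Ms (F s) v)"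
proof (intro Bochner_Integration.integrable_add Bochner_Integration.integrable_minus)
  note vL = H10_D[OF v]
  obtain \<theta> where q: "\<And>n. test_function S (\<theta> n)"
    "(\<lambda>n. l2_norm (lebesgue_on S) (\<lambda>x. \<theta> n x - v x)) \<longlonglongrightarrow> 0"
    "(\<lambda>n. l2_norm (lebesgue_on S) (\<lambda>x. gradient (\<theta> n) x - weak_gradient S v x)) \<longlonglongrightarrow> 0"
    by (rule H10_approximation[OF v]) (rule that)
  have m: "(\<lambda>s. l2_inner Ms (grad s) (weak_gradient S v)) \<in> borel_measurable (lebesgue_on {0..T})"
  proof (rule borel_measurable_AE_limit_lebesgue_on)
    show "(\<lambda>s. - l2_inner Ms (u s) (laplacian (\<theta> k))) \<in> borel_measurable (lebesgue_on {0..T})" for k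
      by (intro continuous_imp_measurable_on_sets_lebesgue continuous_on_minus
          continuous_on_subset[OF C_L2_inner_continuous[OF u_cont L2_laplacian_test_function[OF q(1) Sm]]]) auto
    show "AE s in lebesgue_on {0..T}. (\<lambda>k. - l2_inner Ms (u s) (laplacian (\<theta> k))) \<longlonglongrightarrow> l2_inner Ms (grad s) (weak_gradient S v)"
      using AE_good_on[of 0 T] AE_space
    proof eventually_elim
      case (elim s)
      then have h: "H10 S (u s)" by (simp add: good_def)
      have "- l2_inner Ms (u s) (laplacian (\<theta> k)) = l2_inner Ms (grad s) (gradient (\<theta> k))" for k
        using l2_inner_weak_gradient_test_function[OF S H10_D(1,2)[OF h] q(1)] by simp
      moreover have "(\<lambda>k. l2_inner Ms (grad s) (gradient (\<theta> k))) \<longlonglongrightarrow> l2_inner Ms (grad s) (weak_gradient S v)"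
        by (rule tendsto_l2_inner[OF H10_D(3)[OF h] test_function_gradient_L2[OF q(1) Sm] H10_D(3)[OF h] vL(3) _ q(3)]) (simp add: l2_norm_def)
      ultimately show ?case by simp
    qed
  qed simp
  show "integrable (lebesgue_on {0..T}) (\<lambda>s. l2_inner Ms (grad s) (weak_gradient S v))"
  proof (rule Bochner_Integration.integrable_bound[OF _ m])
    show "integrable (lebesgue_on {0..T}) (\<lambda>s. (l2_norm Ms (grad s))\<^sup>2 + (l2_norm Ms (weak_gradient S v))\<^sup>2)"
      by (intro Bochner_Integration.integrable_add grad_integrable T) auto
    show "AE s in lebesgue_on {0..T}. norm (l2_inner Ms (grad s) (weak_gradient S v))
       \<le> norm ((l2_norm Ms (grad s))\<^sup>2 + (l2_norm Ms (weak_gradient S v))\<^sup>2)"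
      using AE_good_on[of 0 T] AE_space
    proof eventually_elim
      case (elim s)
      then have h: "H10 S (u s)" by (simp add: good_def)
      have "\<bar>l2_inner Ms (grad s) (weak_gradient S v)\<bar> \<le> l2_norm Ms (grad s) * l2_norm Ms (weak_gradient S v)"
        by (rule l2_cauchy_schwarz[OF H10_D(3)[OF h] vL(3)])
      also have "\<dots> \<le> (l2_norm Ms (grad s))\<^sup>2 + (l2_norm Ms (weak_gradient S v))\<^sup>2"
        using sum_squares_bound[of "l2_norm Ms (grad s)" "l2_norm Ms (weak_gradient S v)"]
          mult_nonneg_nonneg[OF l2_norm_nonneg[of Ms "grad s"] l2_norm_nonneg[of Ms "weak_gradient S v"]] by linarith
      finally show ?case by simp
    qed
  qed
  have mF: "(\<lambda>s. l2_inner Ms (F s) v) \<in> borel_measurable (lebesgue_on {0..T})"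
  proof (rule measurable_restrict_mono)
    show "(\<lambda>s. l2_inner Ms (F s) v) \<in> borel_measurable (lebesgue_on {0..})"
      using sol vL(1) by (simp add: weak_heat_solution_def L1loc_L2_def)
  qed auto
  show "integrable (lebesgue_on {0..T}) (\<lambda>s. l2_inner Ms (F s) v)"
  proof (rule Bochner_Integration.integrable_bound[OF _ mF])
    show "integrable (lebesgue_on {0..T}) (\<lambda>s. L * l2_norm Ms (u s) * l2_norm Ms v)"
      by (intro continuous_imp_integrable_real continuous_intros norm_u_continuous)
    show "AE s in lebesgue_on {0..T}. norm (l2_inner Ms (F s) v) \<le> norm (L * l2_norm Ms (u s) * l2_norm Ms v)"
      using AE_good_on[of 0 T] AE_space
    proof eventually_elim
      case (elim s)
      then have g: "good s" "0 \<le> s" by auto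
      have "\<bar>l2_inner Ms (F s) v\<bar> \<le> l2_norm Ms (F s) * l2_norm Ms v"
        using g vL by (intro l2_cauchy_schwarz) (auto simp: good_def)
      also have "\<dots> \<le> L * l2_norm Ms (u s) * l2_norm Ms v" by (intro mult_right_mono F_norm_le g) auto
      finally show ?case by simp
    qed
  qed
qed

lemma energy_increment:
  assumes t: "good t" and h: "0 < h" "h \<le> t"
  shows "energy t - energy (t - h) \<le>
    2 * (\<integral>s. (- l2_inner Ms (grad s) (grad t) + l2_inner Ms (F s) (u t)) \<partial>(lebesgue_on {t - h..t}))"
proof -
  have H: "H10 S (u t)" using t by (simp add: good_def)
  have "0 \<le> t" using h by simp
  from Equivalence_Measurable_On_Borel.integral_combine[OF integrand_integrable[OF H this], of "t - h"] h
  have "(\<integral>s. (- l2_inner Ms (grad s) (grad t) + l2_inner Ms (F s) (u t)) \<partial>(lebesgue_on {t - h..t}))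
    = l2_inner Ms (u t) (u t) - l2_inner Ms (u (t - h)) (u t)"
    using weak_form[OF H, of t] weak_form[OF H, of "t - h"] by simp
  moreover have "0 \<le> (l2_norm Ms (\<lambda>x. u (t - h) x - u t x))\<^sup>2" by simp
  ultimately show ?thesis
    using l2_norm_diff_power2[OF u_L2 u_L2, of "t - h" t] h by (simp add: l2_norm_power2)
qed

text \<open>At time 0 the weak formulation says only that u(0) - u0 is orthogonal to
  \<open>H10\<close>. Density of \<open>H10\<close> in L2 is bypassed: u(t) at good times is tested
  instead, and continuity carries orthogonality to t = 0. Hence the energy at 0 is the pairing of
  u(0) with u0, and Cauchy-Schwarz concludes.\<close>

lemma energy_initial: "energy 0 \<le> (l2_norm Ms u0)\<^sup>2"
proof -
  define d where "d = (\<lambda>x. u 0 x - u0 x)"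
  have d: "L2 Ms d" unfolding d_def by (intro L2_diff u_L2 u0_L2) simp
  have vanish: "l2_inner Ms (u t) d = 0" if t: "good t" "0 \<le> t" for t
  proof -
    have "AE s in lebesgue_on {0..0::real}. - l2_inner Ms (grad s) (grad t) + l2_inner Ms (F s) (u t) = 0"
    proof -
      have "AE s in lebesgue. s \<noteq> (0::real)" by (rule AE_completion[OF AE_lborel_singleton])
      then have "AE s in lebesgue. s \<in> {0..0} \<longrightarrow> - l2_inner Ms (grad s) (grad t) + l2_inner Ms (F s) (u t) = 0"
        by eventually_elim simp
      then show ?thesis by (subst AE_restrict_space_iff) auto
    qed
    then have "(\<integral>s. (- l2_inner Ms (grad s) (grad t) + l2_inner Ms (F s) (u t)) \<partial>(lebesgue_on {0..0::real})) = 0"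
      by (rule integral_eq_zero_AE)
    moreover have "H10 S (u t)" using t by (simp add: good_def)
    ultimately have "l2_inner Ms (u 0) (u t) - l2_inner Ms u0 (u t) = 0"
      using weak_form[of "u t" 0] by simp
    then show ?thesis
      unfolding d_def using t by (subst l2_inner_commute) (simp add: l2_inner_diff_left u_L2 u0_L2)
  qed
  define \<psi> where "\<psi> t = l2_inner Ms (u (max 0 t)) d" for t
  have "continuous_on UNIV \<psi>"
    unfolding \<psi>_def by (rule continuous_on_compose2[OF C_L2_inner_continuous[OF u_cont d]]) (auto intro!: continuous_intros)
  then have cl: "closed {t. \<psi> t = 0}" by (rule closed_Collect_eq) (intro continuous_intros)
  have ae: "AE t \<in> {0<..} in lebesgue. t \<in> {t. \<psi> t = 0}"
    using AE_good by eventually_elim (auto simp: \<psi>_def vanish)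
  have "{0<..} \<subseteq> {t. \<psi> t = 0}"
    by (intro subsetI mem_closed_if_AE_lebesgue_open[OF open_greaterThan cl ae])
  then have "closure {0<..} \<subseteq> {t. \<psi> t = 0}" by (rule closure_minimal[OF _ cl])
  then have "\<psi> 0 = 0" by auto
  then have "energy 0 = l2_inner Ms (u 0) u0"
    unfolding \<psi>_def d_def l2_norm_power2 by (simp add: l2_inner_diff_right u_L2 u0_L2)
  also have "\<dots> \<le> l2_norm Ms (u 0) * l2_norm Ms u0"
    using l2_cauchy_schwarz[OF u_L2 u0_L2, of 0] by simp
  finally have le: "l2_norm Ms (u 0) * l2_norm Ms (u 0) \<le> l2_norm Ms (u 0) * l2_norm Ms u0"
    by (simp add: power2_eq_square)
  have "l2_norm Ms (u 0) \<le> l2_norm Ms u0"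
  proof (cases "l2_norm Ms (u 0) = 0")
    case False
    then have "0 < l2_norm Ms (u 0)" using l2_norm_nonneg[of Ms "u 0"] by linarith
    with le show ?thesis by simp
  qed simp
  then show ?thesis by (intro power_mono) auto
qed

lemma form_gap_integrable:
  assumes "0 \<le> T" "\<tau> > 0"
  shows "integrable (lebesgue_on {0..T}) (\<lambda>t. form_gap S \<tau> (u t) (u t))"
  unfolding form_gap_def l2_norm_power2[symmetric]
  by (intro Bochner_Integration.integrable_diff grad_integrable assms continuous_imp_integrable_real
      continuous_on_subset[OF C_L2_damped_form_continuous[OF u_cont S]]) auto

text \<open>At good times the gap lies between 0 and the squared gradient norm, which is integrable
  in time and thus a majorant for every \<tau>.\<close>

lemma form_gap_small:
  assumes T: "0 \<le> T" and \<eta>: "\<eta> > 0"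
  obtains \<tau> where "\<tau> > 0" "(\<integral>t. \<bar>form_gap S \<tau> (u t) (u t)\<bar> \<partial>(lebesgue_on {0..T})) \<le> \<eta>"
proof -
  define s where "s n = inverse (real (Suc n))" for n
  have s: "s n > 0" for n by (simp add: s_def)
  have s0: "s \<longlonglongrightarrow> 0" unfolding s_def using LIMSEQ_inverse_real_of_nat .
  have "(\<lambda>n. \<integral>t. \<bar>form_gap S (s n) (u t) (u t)\<bar> \<partial>(lebesgue_on {0..T})) \<longlonglongrightarrow> (\<integral>t. 0 \<partial>(lebesgue_on {0..T}))"
  proof (rule integral_dominated_convergence)
    show "integrable (lebesgue_on {0..T}) (\<lambda>t. (l2_norm Ms (grad t))\<^sup>2)" by (rule grad_integrable[OF T])
    show "(\<lambda>t. \<bar>form_gap S (s n) (u t) (u t)\<bar>) \<in> borel_measurable (lebesgue_on {0..T})" for n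
      using form_gap_integrable[OF T s] by measurable
    show "AE t in lebesgue_on {0..T}. (\<lambda>n. \<bar>form_gap S (s n) (u t) (u t)\<bar>) \<longlonglongrightarrow> 0"
      using AE_good_on[of 0 T] AE_space
    proof eventually_elim
      case (elim t)
      then have "H10 S (u t)" by (simp add: good_def)
      from form_gap_tendsto_0[OF S s s0 this] show ?case by (rule tendsto_rabs_zero)
    qed
    show "AE t in lebesgue_on {0..T}. norm \<bar>form_gap S (s n) (u t) (u t)\<bar> \<le> (l2_norm Ms (grad t))\<^sup>2" for n
      using AE_good_on[of 0 T] AE_space
    proof eventually_elim
      case (elim t)
      then have "H10 S (u t)" by (simp add: good_def)
      from form_gap_nonneg[OF S s this, of n] damped_form_nonneg[of S "s n" "u t"]
      show ?case by (simp add: form_gap_def l2_norm_power2)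
    qed
  qed simp
  then have "(\<lambda>n. \<integral>t. \<bar>form_gap S (s n) (u t) (u t)\<bar> \<partial>(lebesgue_on {0..T})) \<longlonglongrightarrow> 0" by simp
  from order_tendstoD(2)[OF this \<eta>] obtain n
    where "(\<integral>t. \<bar>form_gap S (s n) (u t) (u t)\<bar> \<partial>(lebesgue_on {0..T})) < \<eta>"
    by (auto simp: eventually_sequentially)
  then show ?thesis using that[OF s[of n]] by simp
qed

text \<open>The parameters are chosen in a fixed order: \<tau> from \<eta>, the constant
  \<open>C\<close> of the damped form from \<tau>, and the time step \<delta> last, from uniform
  continuity of the solution on \<open>{0..T}\<close>.\<close>

lemma energy_decay:
  assumes K: "L \<le> K" and t: "t \<ge> 0"
  shows "energy t \<le> exp (- (2 * (K - L)) * t) * energy 0"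
proof (rule exp_decay_of_energy_increments[OF _ _ _ _ t])
  show "continuous_on {0..} (\<lambda>t. energy t)"
    by (intro continuous_intros C_L2_norm_continuous u_cont)
  show "0 \<le> 2 * (K - L)" using K by simp
  fix T \<eta> :: real assume T: "0 < T" and \<eta>: "0 < \<eta>"
  then have T0: "0 \<le> T" by simp
  obtain \<tau> where \<tau>: "\<tau> > 0" and q\<eta>: "(\<integral>t. \<bar>form_gap S \<tau> (u t) (u t)\<bar> \<partial>(lebesgue_on {0..T})) \<le> \<eta>"
    by (rule form_gap_small[OF T0 \<eta>]) (rule that)
  \<comment> \<open>The absolute value makes the error nonnegative at every time; at good times it
    changes nothing.\<close>
  define Q where "Q t = \<bar>form_gap S \<tau> (u t) (u t)\<bar>" for t
  have Qi: "integrable (lebesgue_on {0..T}) Q"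
    unfolding Q_def using form_gap_integrable[OF T0 \<tau>] by simp
  obtain C where C: "C > 0" "\<And>u v. L2 Ms u \<Longrightarrow> L2 Ms v \<Longrightarrow> \<bar>damped_form S \<tau> u v\<bar> \<le> C * (l2_norm Ms u * l2_norm Ms v)"
    by (rule damped_form_bound[OF S \<tau>]) (rule that)
  have "bounded ((\<lambda>t. l2_norm Ms (u t)) ` {0..T})"
    by (intro compact_imp_bounded compact_continuous_image norm_u_continuous compact_Icc)
  then obtain B where B: "B > 0" "\<And>t. t \<in> {0..T} \<Longrightarrow> l2_norm Ms (u t) \<le> B"
    unfolding bounded_pos by auto
  \<comment> \<open>Replacing u(r) by u(t) costs a factor \<open>C\<close> in the damped form and
    \<open>L\<close> in the reaction term, each times at most \<open>B * \<omega>\<close>. The sum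
    is \<eta> / 2, which the factor 2 in \<open>energy_increment\<close> turns into \<eta>.\<close>
  define \<omega> where "\<omega> = \<eta> / (2 * ((C + L) * B))"
  have CLB: "(C + L) * B > 0" using C B L by (simp add: add_pos_nonneg)
  then have \<omega>: "\<omega> > 0" "(C + L) * B * \<omega> = \<eta> / 2" using \<eta> by (auto simp: \<omega>_def)
  obtain \<delta> where \<delta>: "\<delta> > 0" "\<And>s t. s \<in> {0..T} \<Longrightarrow> t \<in> {0..T} \<Longrightarrow> \<bar>s - t\<bar> < \<delta> \<Longrightarrow> l2_norm Ms (\<lambda>x. u s x - u t x) < \<omega>"
    by (rule C_L2_uniformly_continuous[OF u_cont \<omega>(1), of T]) (rule that)
  \<comment> \<open>The coefficient 3/2 of \<open>Q t\<close> has two sources: 1/2 from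
    \<open>form_gap_polar\<close>, which also leaves \<open>Q r / 2\<close>, and 1 from returning
    from the damped form to the gradient norm at time t, where the Poincare inequality is
    applied.\<close>
  have pointwise: "- l2_inner Ms (grad r) (grad t) + l2_inner Ms (F r) (u t)
      \<le> (\<eta> / 2 + 3 / 2 * Q t - (K - L) * energy t) + Q r / 2"
    if r: "good r" "r \<in> {0..T}" and t: "good t" "t \<in> {0..T}" and rt: "\<bar>r - t\<bar> < \<delta>" for r t
  proof -
    have H: "H10 S (u r)" "H10 S (u t)" using r t by (simp_all add: good_def)
    have L2s: "L2 Ms (u r)" "L2 Ms (u t)" using r t by (auto intro: u_L2)
    let ?d = "l2_norm Ms (\<lambda>x. u r x - u t x)" and ?n = "\<lambda>t. l2_norm Ms (u t)"
    have Qf: "Q s = form_gap S \<tau> (u s) (u s)" if "H10 S (u s)" for s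
      using form_gap_nonneg[OF S \<tau> that] by (simp add: Q_def)
    have 1: "- l2_inner Ms (grad r) (grad t) \<le> - damped_form S \<tau> (u r) (u t) + (Q r + Q t) / 2"
    proof -
      have "- l2_inner Ms (grad r) (grad t) = - damped_form S \<tau> (u r) (u t) + - form_gap S \<tau> (u r) (u t)"
        by (simp add: form_gap_def)
      also have "\<dots> \<le> - damped_form S \<tau> (u r) (u t) + (Q r + Q t) / 2"
        unfolding Qf[OF H(1)] Qf[OF H(2)] by (intro add_left_mono form_gap_polar[OF S \<tau> H])
      finally show ?thesis .
    qed
    have 2: "- damped_form S \<tau> (u r) (u t) \<le> - damped_form S \<tau> (u t) (u t) + C * (?d * ?n t)"
      using damped_form_diff_left[OF S L2s L2s(2) \<tau>] C(2)[OF L2_diff[OF L2s] L2s(2)] by simp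
    have 3: "- damped_form S \<tau> (u t) (u t) \<le> Q t - K * energy t"
      using H10_poincare[OF Sm H(2) poincare] Qf[OF H(2)] by (simp add: form_gap_def l2_norm_power2)
    have 4: "l2_inner Ms (F r) (u t) \<le> L * ?n r * ?n t"
    proof -
      have "\<bar>l2_inner Ms (F r) (u t)\<bar> \<le> l2_norm Ms (F r) * ?n t"
        using r by (intro l2_cauchy_schwarz L2s) (simp add: good_def)
      also have "\<dots> \<le> L * ?n r * ?n t" using r by (intro mult_right_mono F_norm_le) auto
      finally show ?thesis by simp
    qed
    have "?n r \<le> ?n t + ?d" using l2_norm_le_diff[OF L2s] by simp
    then have "L * ?n r * ?n t \<le> L * (?n t + ?d) * ?n t" using L by (intro mult_right_mono mult_left_mono) auto
    then have 5: "L * ?n r * ?n t \<le> L * energy t + L * (?d * ?n t)" by (simp add: power2_eq_square algebra_simps)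
    have "?d * ?n t \<le> \<omega> * B"
      using \<delta>(2)[OF r(2) t(2) rt] B(2)[OF t(2)] \<omega> by (intro mult_mono) auto
    then have "(C + L) * (?d * ?n t) \<le> (C + L) * (\<omega> * B)" using C L by (intro mult_left_mono) auto
    then have 6: "C * (?d * ?n t) + L * (?d * ?n t) \<le> \<eta> / 2" using \<omega>(2) by (simp add: algebra_simps)
    show ?thesis using 1 2 3 4 5 6 by (simp add: algebra_simps)
  qed
  have step: "energy t - energy (t - h) \<le> h * (\<eta> + 3 * Q t - 2 * (K - L) * energy t) + integral\<^sup>L (lebesgue_on {t - h..t}) Q"
    if t: "good t" "t \<in> {0..T}" and h: "0 < h" "h < \<delta>" "h \<le> t" for t h
  proof -
    have H: "H10 S (u t)" using t by (simp add: good_def)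
    have Qs: "integrable (lebesgue_on {t - h..t}) Q"
      by (rule integrable_subinterval[OF Qi]) (use t h in auto)
    let ?c = "\<eta> / 2 + 3 / 2 * Q t - (K - L) * energy t"
    have "(\<integral>s. (- l2_inner Ms (grad s) (grad t) + l2_inner Ms (F s) (u t)) \<partial>(lebesgue_on {t - h..t}))
       \<le> (\<integral>s. (?c + Q s / 2) \<partial>(lebesgue_on {t - h..t}))"
    proof (rule integral_mono_AE)
      show "integrable (lebesgue_on {t - h..t}) (\<lambda>s. - l2_inner Ms (grad s) (grad t) + l2_inner Ms (F s) (u t))"
        by (rule integrable_subinterval[OF integrand_integrable[OF H T0]]) (use t h in auto)
      show "integrable (lebesgue_on {t - h..t}) (\<lambda>s. ?c + Q s / 2)"
        by (intro Bochner_Integration.integrable_add integrable_divide Qs) auto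
      show "AE s in lebesgue_on {t - h..t}. - l2_inner Ms (grad s) (grad t) + l2_inner Ms (F s) (u t) \<le> ?c + Q s / 2"
        using AE_good_on[of "t - h" t] AE_space
        by eventually_elim (rule pointwise, use t h in auto)
    qed
    also have "\<dots> = h * ?c + integral\<^sup>L (lebesgue_on {t - h..t}) Q / 2"
      using Qs h by (simp add: measure_restrict_space)
    finally show ?thesis using energy_increment[OF t(1) h(1,3)] by (simp add: algebra_simps)
  qed
  show "\<exists>\<delta> q. 0 < \<delta> \<and> integrable (lebesgue_on {0..T}) q \<and> (\<forall>t. 0 \<le> q t) \<and>
       integral\<^sup>L (lebesgue_on {0..T}) q \<le> \<eta> \<and>
       (AE t in lebesgue_on {0..T}. \<forall>h. 0 < h \<longrightarrow> h < \<delta> \<longrightarrow> h \<le> t \<longrightarrow>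
          energy t - energy (t - h) \<le> h * (\<eta> + 3 * q t - 2 * (K - L) * energy t) + integral\<^sup>L (lebesgue_on {t - h..t}) q)"
  proof (intro exI[of _ \<delta>] exI[of _ Q] conjI allI)
    show "AE t in lebesgue_on {0..T}. \<forall>h. 0 < h \<longrightarrow> h < \<delta> \<longrightarrow> h \<le> t \<longrightarrow>
          energy t - energy (t - h) \<le> h * (\<eta> + 3 * Q t - 2 * (K - L) * energy t) + integral\<^sup>L (lebesgue_on {t - h..t}) Q"
      using AE_good_on[of 0 T] AE_space by eventually_elim (intro allI impI step, auto)
  qed (use \<delta>(1) Qi q\<eta> in \<open>auto simp: Q_def[abs_def]\<close>)
qed simp

end

section \<open>Partitions and the theorem\<close>

text \<open>Near a boundary point the frontier lies in a graph, which is the image of a hyperplane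
  under \<open>F\<close>. As \<open>F\<close> is a Lipschitz map of the whole space into itself, it
  maps this null set to a null set. The open sets on either side of the graph contain no frontier
  points.\<close>

lemma negligible_frontier_graph_boundary:
  fixes S :: "'a::euclidean_space set"
  assumes S: "open S" and b: "graph_boundary (\<lambda>g. \<exists>C. C-lipschitz_on UNIV g) S"
  shows "negligible (frontier S)"
proof (subst locally_negligible_alt, rule ballI)
  fix x assume x: "x \<in> frontier S"
  from bspec[OF b[unfolded graph_boundary_def] this]
  obtain r e g C where r: "r > 0" and e: "norm e = 1" and g: "C-lipschitz_on UNIV g"
    and eq: "S \<inter> ball x r = {y \<in> ball x r. g (y - (y \<bullet> e) *\<^sub>R e) < y \<bullet> e}"
    by (elim exE conjE) (rule that)
  define \<pi> where "\<pi> y = y - (y \<bullet> e) *\<^sub>R e" for y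
  define F where "F y = y + g y *\<^sub>R e" for y
  have gc: "continuous_on UNIV g" using g by (rule lipschitz_on_continuous_on)
  have C: "0 \<le> C" using g by (rule lipschitz_on_nonneg)
  have cp: "continuous_on UNIV (\<lambda>y. g (\<pi> y) - y \<bullet> e)"
    unfolding \<pi>_def by (intro continuous_intros continuous_on_compose2[OF gc]) auto
  have "frontier S \<inter> ball x r \<subseteq> F ` {y. e \<bullet> y = 0}"
  proof
    fix y assume y: "y \<in> frontier S \<inter> ball x r"
    have yS: "y \<notin> S" "y \<in> closure S" using y S by (auto simp: frontier_def interior_open)
    have "g (\<pi> y) = y \<bullet> e"
    proof (rule antisym)
      have "y \<notin> {y \<in> ball x r. g (y - (y \<bullet> e) *\<^sub>R e) < y \<bullet> e}" unfolding eq[symmetric] using yS by simp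
      then show "y \<bullet> e \<le> g (\<pi> y)" using y by (simp add: \<pi>_def not_less)
      show "g (\<pi> y) \<le> y \<bullet> e"
      proof (rule ccontr)
        assume "\<not> g (\<pi> y) \<le> y \<bullet> e"
        then have yV: "y \<in> {z. 0 < g (\<pi> z) - z \<bullet> e} \<inter> ball x r" using y by simp
        have V: "open ({z. 0 < g (\<pi> z) - z \<bullet> e} \<inter> ball x r)"
          by (intro open_Int open_ball open_Collect_less continuous_on_const cp)
        obtain z where z: "z \<in> S" "z \<in> ball x r" "0 < g (\<pi> z) - z \<bullet> e"
          using open_Int_closure_eq_empty[OF V, of S] yV yS(2) by auto
        then have "z \<in> {y \<in> ball x r. g (y - (y \<bullet> e) *\<^sub>R e) < y \<bullet> e}" unfolding eq[symmetric] by simp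
        with z(3) show False by (simp add: \<pi>_def)
      qed
    qed
    then have "y = F (\<pi> y)" by (simp add: F_def \<pi>_def)
    moreover have "e \<bullet> \<pi> y = 0"
      using e by (simp add: \<pi>_def inner_diff_right inner_commute power2_norm_eq_inner[symmetric])
    ultimately show "y \<in> F ` {y. e \<bullet> y = 0}" by blast
  qed
  moreover have "negligible (F ` {y. e \<bullet> y = 0})"
  proof (rule negligible_locally_Lipschitz_image)
    show "negligible {y. e \<bullet> y = 0}" using e by (intro negligible_hyperplane) auto
    fix z :: 'a assume "z \<in> {y. e \<bullet> y = 0}"
    have "norm (F y - F z) \<le> (1 + C) * norm (y - z)" for y
    proof -
      have "F y - F z = (y - z) + (g y - g z) *\<^sub>R e" by (simp add: F_def algebra_simps)
      then have "norm (F y - F z) \<le> norm (y - z) + \<bar>g y - g z\<bar>"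
        using norm_triangle_ineq[of "y - z" "(g y - g z) *\<^sub>R e"] e by simp
      moreover have "\<bar>g y - g z\<bar> \<le> C * norm (y - z)"
        using lipschitz_onD[OF g, of y z] by (simp add: dist_norm)
      ultimately show ?thesis by (simp add: algebra_simps)
    qed
    then show "\<exists>T B. open T \<and> z \<in> T \<and> (\<forall>y\<in>{y. e \<bullet> y = 0} \<inter> T. norm (F y - F z) \<le> B * norm (y - z))"
      by (intro exI[of _ UNIV] exI[of _ "1 + C"]) auto
  qed simp
  ultimately have "negligible (frontier S \<inter> ball x r)" by (rule negligible_subset[rotated])
  moreover have "openin (top_of_set (frontier S)) (frontier S \<inter> ball x r)" by (intro openin_open_Int open_ball)
  ultimately show "\<exists>U. openin (top_of_set (frontier S)) U \<and> x \<in> U \<and> negligible U"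
    using x r by (intro exI[of _ "frontier S \<inter> ball x r"]) auto
qed

lemma lipschitz_domain_lmeasurable:
  "lipschitz_domain S \<Longrightarrow> S \<in> lmeasurable" "lipschitz_domain S \<Longrightarrow> open S" "lipschitz_domain S \<Longrightarrow> 0 < measure lebesgue S"
proof -
  assume S: "lipschitz_domain S"
  then show o: "open S" by (simp add: lipschitz_domain_def Defs.domain_def)
  show m: "S \<in> lmeasurable"
    using S by (intro bounded_set_imp_lmeasurable lmeasurable_open) (auto simp: lipschitz_domain_def Defs.domain_def)
  have "S \<noteq> {}" using S by (simp add: lipschitz_domain_def Defs.domain_def)
  then have "\<not> negligible S" using o open_not_negligible by blast
  then show "0 < measure lebesgue S" using m by (simp add: negligible_iff_measure zero_less_measure_iff)
qed

text \<open>What the subdomains leave uncovered in \<open>\<Omega>\<close> lies in their frontiers.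
  Here the Lipschitz regularity of the subdomains enters, since it makes these frontiers
  null.\<close>

lemma lipschitz_partition_l2_norm:
  fixes \<Omega> :: "'a::euclidean_space set" and w :: "'a \<Rightarrow> real"
  assumes P: "lipschitz_partition \<Omega> M \<Omega>s" and w: "\<And>i. i \<in> {1..M} \<Longrightarrow> L2 (lebesgue_on (\<Omega>s i)) w"
  shows "(l2_norm (lebesgue_on \<Omega>) w)\<^sup>2 = (\<Sum>i=1..M. (l2_norm (lebesgue_on (\<Omega>s i)) w)\<^sup>2)"
proof -
  let ?U = "\<Union>i\<in>{1..M}. \<Omega>s i"
  have dom: "lipschitz_domain (\<Omega>s i)" "\<Omega>s i \<subseteq> \<Omega>" if "i \<in> {1..M}" for i
    using P that unfolding lipschitz_partition_def by auto
  have disj: "\<Omega>s i \<inter> \<Omega>s j = {}" if "i \<in> {1..M}" "j \<in> {1..M}" "i \<noteq> j" for i j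
    using P that unfolding lipschitz_partition_def by blast
  have \<Omega>: "\<Omega> = interior (closure ?U)" using P unfolding lipschitz_partition_def by blast
  have Om: "\<Omega> \<in> sets lebesgue" unfolding \<Omega> by auto
  have Oi: "\<Omega>s i \<in> sets lebesgue" if "i \<in> {1..M}" for i
    using lipschitz_domain_lmeasurable(1)[OF dom(1)[OF that]] by (rule fmeasurableD)
  have "\<Omega> - ?U \<subseteq> (\<Union>i\<in>{1..M}. frontier (\<Omega>s i))"
  proof
    fix x assume x: "x \<in> \<Omega> - ?U"
    then have "x \<in> closure ?U" using interior_subset[of "closure ?U"] unfolding \<Omega> by blast
    moreover have "closure ?U \<subseteq> (\<Union>i\<in>{1..M}. closure (\<Omega>s i))"
      by (intro closure_minimal UN_mono order_refl closure_subset closed_UN) auto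
    ultimately obtain i where i: "i \<in> {1..M}" "x \<in> closure (\<Omega>s i)" by blast
    then have "x \<in> frontier (\<Omega>s i)"
      using x lipschitz_domain_lmeasurable(2)[OF dom(1)[OF i(1)]] by (auto simp: frontier_def interior_open)
    then show "x \<in> (\<Union>i\<in>{1..M}. frontier (\<Omega>s i))" using i by blast
  qed
  moreover have "negligible (\<Union>i\<in>{1..M}. frontier (\<Omega>s i))"
    by (intro negligible_Union) (use dom in \<open>auto simp: lipschitz_domain_def Defs.domain_def intro!: negligible_frontier_graph_boundary\<close>)
  ultimately have "negligible (\<Omega> - ?U)" using negligible_subset by blast
  then have ae: "AE x in lebesgue. x \<notin> \<Omega> - ?U" unfolding negligible_iff_null_sets by (rule AE_not_in)
  let ?f = "\<lambda>x. (norm (w x))\<^sup>2"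
  have fi: "integrable lebesgue (\<lambda>x. indicator (\<Omega>s i) x *\<^sub>R ?f x)" if "i \<in> {1..M}" for i
    using L2_D(2)[OF w[OF that]] Oi[OF that] by (simp add: integrable_restrict_space)
  have eq: "AE x in lebesgue. (\<Sum>i=1..M. indicator (\<Omega>s i) x *\<^sub>R ?f x) = indicator \<Omega> x *\<^sub>R ?f x"
    using ae
  proof eventually_elim
    case (elim x)
    show ?case
    proof (cases "x \<in> \<Omega>")
      case True
      then obtain i where i: "i \<in> {1..M}" "x \<in> \<Omega>s i" using elim by blast
      have "(\<Sum>j=1..M. indicator (\<Omega>s j) x *\<^sub>R ?f x) = (\<Sum>j\<in>{i}. indicator (\<Omega>s j) x *\<^sub>R ?f x)"
      proof (rule sum.mono_neutral_right)
        show "\<forall>j\<in>{1..M} - {i}. indicator (\<Omega>s j) x *\<^sub>R ?f x = 0"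
        proof
          fix j assume "j \<in> {1..M} - {i}"
          then have "x \<notin> \<Omega>s j" using disj[of j i] i by blast
          then show "indicator (\<Omega>s j) x *\<^sub>R ?f x = 0" by simp
        qed
      qed (use i in auto)
      then show ?thesis using True i by simp
    next
      case False
      then have "x \<notin> \<Omega>s i" if "i \<in> {1..M}" for i using dom(2)[OF that] by blast
      then show ?thesis using False by (simp add: sum.neutral)
    qed
  qed
  have sm: "(\<lambda>x. \<Sum>i=1..M. indicator (\<Omega>s i) x *\<^sub>R ?f x) \<in> borel_measurable lebesgue"
    using fi by (intro borel_measurable_sum) auto
  have "(l2_norm (lebesgue_on \<Omega>) w)\<^sup>2 = (\<integral>x. indicator \<Omega> x *\<^sub>R ?f x \<partial>lebesgue)"
    using Om by (simp add: l2_norm_def integral_restrict_space)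
  also have "\<dots> = (\<integral>x. (\<Sum>i=1..M. indicator (\<Omega>s i) x *\<^sub>R ?f x) \<partial>lebesgue)"
    \<comment> \<open>\<open>w\<close> is known to be measurable only on the pieces; measurability
      on all of \<open>\<Omega>\<close> follows from completeness of the measure.\<close>
    by (rule integral_cong_AE[OF sm borel_measurable_AE[OF sm eq] eq, symmetric])
  also have "\<dots> = (\<Sum>i=1..M. \<integral>x. indicator (\<Omega>s i) x *\<^sub>R ?f x \<partial>lebesgue)"
    using fi by (rule Bochner_Integration.integral_sum)
  also have "\<dots> = (\<Sum>i=1..M. (l2_norm (lebesgue_on (\<Omega>s i)) w)\<^sup>2)"
    using Oi by (intro sum.cong) (auto simp: l2_norm_def integral_restrict_space)
  finally show ?thesis .
qed

text \<open>This identifies the constant as the Weyl constant: frequency balls are measured by the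
  normalised volume that appears in the bathtub bound.\<close>

lemma C_dim_eq_unit_ball_vol: "C_dim d = (1 / (2 * pi)) ^ d * unit_ball_vol (real d)"
proof -
  have "(4 * pi) powr (- real d / 2) = ((2 * pi) powr (- real d)) * pi powr (real d / 2)"
  proof -
    have "4 * pi = (2 * pi) powr 2 * pi powr - 1" by (simp add: powr_minus power2_eq_square field_simps)
    then have "(4 * pi) powr (- real d / 2) = ((2 * pi) powr 2 * pi powr - 1) powr (- real d / 2)" by (simp only:)
    also have "\<dots> = ((2 * pi) powr 2) powr (- real d / 2) * (pi powr - 1) powr (- real d / 2)" by (rule powr_mult)
    finally show ?thesis unfolding powr_powr by simp
  qed
  also have "(2 * pi) powr (- real d) = (1 / (2 * pi)) ^ d"
    by (simp add: powr_minus powr_realpow power_one_over inverse_eq_divide)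
  finally show ?thesis
    unfolding C_dim_def unit_ball_vol_def by (simp only: divide_inverse[of _ "Gamma _"] mult.assoc)
qed

lemma C_dim_pos: "0 < C_dim d"
  unfolding C_dim_eq_unit_ball_vol by (intro mult_pos_pos) auto

text \<open>The radius \<open>R\<close> is chosen so that the ball of radius \<open>R\<close> in frequency space has volume
  \<open>(2 * pi) ^ d / m\<close>, the optimal choice in the bathtub argument.\<close>

lemma berezin_li_yau:
  fixes m L :: real
  assumes m: "m > 0" and L: "L > 0"
    and lt: "m < inverse (C_dim DIM('a)) * (real DIM('a) / (L * (real DIM('a) + 2))) powr (real DIM('a) / 2)"
  obtains K where "L < K"
    "\<And>(S :: 'a::euclidean_space set) \<psi>. S \<in> lmeasurable \<Longrightarrow> measure lebesgue S \<le> m \<Longrightarrow> test_function S \<psi> \<Longrightarrow>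
       K * (l2_norm (lebesgue_on S) \<psi>)\<^sup>2 \<le> (l2_norm (lebesgue_on S) (gradient \<psi>))\<^sup>2"
proof -
  define d where "d = DIM('a)"
  have d: "d > 0" by (simp add: d_def)
  define C where "C = C_dim d"
  have C: "C > 0" by (simp add: C_def C_dim_pos)
  define R where "R = (1 / (C * m)) powr (1 / real d)"
  have R: "R > 0" using C m by (simp add: R_def)
  have Rd: "C * m * R ^ d = 1"
  proof -
    have "R ^ d = (1 / (C * m)) powr (1 / real d * real d)" unfolding R_def using C m
      by (simp add: powr_realpow[symmetric] powr_powr del: powr_powr_swap)
    then show ?thesis using C m d by simp
  qed
  \<comment> \<open>With \<open>C * m * R ^ d = 1\<close> the bathtub term is the fraction 2 / (d +
    2) of R^2, and this is the rest. Multiplying the volume condition by \<open>R ^ d\<close> turns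
    it into 1 < (K / L)^(d/2).\<close>
  define K where "K = R\<^sup>2 * (real d / (real d + 2))"
  show ?thesis
  proof (rule that[of K])
    have "C * m < (real d / (L * (real d + 2))) powr (real d / 2)"
      using lt C by (simp add: d_def C_def field_simps)
    then have "C * m * R ^ d < (real d / (L * (real d + 2))) powr (real d / 2) * R ^ d"
      using R by (intro mult_strict_right_mono) auto
    moreover have "R ^ d = (R\<^sup>2) powr (real d / 2)"
      using R by (simp add: powr_realpow[symmetric] powr_powr del: powr_numeral)
    moreover have "(real d / (L * (real d + 2))) powr (real d / 2) * (R\<^sup>2) powr (real d / 2) = (K / L) powr (real d / 2)"
      using L d by (subst powr_mult[symmetric]) (auto simp: K_def mult_ac)
    ultimately have "1 < (K / L) powr (real d / 2)" using Rd by (simp only:)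
    then have "1 < K / L"
      using L R d powr_le1[of "real d / 2" "K / L"] by (cases "K / L \<le> 1") (auto simp: K_def)
    then show "L < K" using L by (simp add: field_simps)
    fix S :: "'a set" and \<psi> :: "'a \<Rightarrow> real"
    assume S: "S \<in> lmeasurable" "measure lebesgue S \<le> m" and \<psi>: "test_function S \<psi>"
    have "(1 / (2 * pi)) ^ DIM('a) * measure lebesgue S * (unit_ball_vol (real DIM('a)) * (2 * R ^ (DIM('a) + 2) / (real DIM('a) + 2)))
       = (C * measure lebesgue S * R ^ d) * (R\<^sup>2 * (2 / (real d + 2)))"
      by (simp add: C_def d_def C_dim_eq_unit_ball_vol power_add power2_eq_square)
    also have "\<dots> \<le> 1 * (R\<^sup>2 * (2 / (real d + 2)))"
      unfolding Rd[symmetric] using C R S by (intro mult_right_mono mult_left_mono) auto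
    finally have "K \<le> R\<^sup>2 - (1 / (2 * pi)) ^ DIM('a) * measure lebesgue S * (unit_ball_vol (real DIM('a)) * (2 * R ^ (DIM('a) + 2) / (real DIM('a) + 2)))"
      by (simp add: K_def field_simps)
    then have "K * (l2_norm (lebesgue_on S) \<psi>)\<^sup>2 \<le> (R\<^sup>2 - (1 / (2 * pi)) ^ DIM('a) * measure lebesgue S * (unit_ball_vol (real DIM('a)) * (2 * R ^ (DIM('a) + 2) / (real DIM('a) + 2)))) * (l2_norm (lebesgue_on S) \<psi>)\<^sup>2"
      by (intro mult_right_mono) auto
    with berezin_li_yau_test_function[OF \<psi> S(1) R] show "K * (l2_norm (lebesgue_on S) \<psi>)\<^sup>2 \<le> (l2_norm (lebesgue_on S) (gradient \<psi>))\<^sup>2"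
      by linarith
  qed
qed

text \<open>The Dirichlet conditions decouple the subdomains, and the common rate lets the squared
  norms be summed. The Lipschitz bound removes \<open>g\<close> from all estimates, so the rate is
  uniform in the controls and the observer state.\<close>

lemma error_solution_decay:
  assumes P: "lipschitz_partition \<Omega> M \<Omega>s" and L: "0 \<le> L" and lip: "L-lipschitz_on UNIV f" and K: "L \<le> K"
    and poincare: "\<And>i \<psi>. i \<in> {1..M} \<Longrightarrow> test_function (\<Omega>s i) \<psi> \<Longrightarrow>
       K * (l2_norm (lebesgue_on (\<Omega>s i)) \<psi>)\<^sup>2 \<le> (l2_norm (lebesgue_on (\<Omega>s i)) (gradient \<psi>))\<^sup>2"
    and sol: "error_solution f M \<Omega>s g e0 e" and t: "t \<ge> 0"
  shows "l2_norm (lebesgue_on \<Omega>) (e t) \<le> exp (- (K - L) * t) * l2_norm (lebesgue_on \<Omega>) e0"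
proof (rule power2_le_imp_le)
  have loc: "dissipative_heat_solution (\<Omega>s i) e (\<lambda>t x. f (g t x + e t x) - f (g t x)) e0 L K" if i: "i \<in> {1..M}" for i
  proof
    show "\<Omega>s i \<in> lmeasurable"
      using P i by (intro lipschitz_domain_lmeasurable) (simp add: lipschitz_partition_def)
    show "weak_heat_solution (\<Omega>s i) (\<lambda>t x. 0) (\<lambda>t x. f (g t x + e t x) - f (g t x)) e0 e"
      using sol i by (simp add: error_solution_def)
    show "\<bar>f (g t x + e t x) - f (g t x)\<bar> \<le> L * \<bar>e t x\<bar>" for t x
      using lipschitz_onD[OF lip, of "g t x + e t x" "g t x"] by (simp add: dist_real_def)
  qed (use L poincare i in auto)
  have L2s: "L2 (lebesgue_on (\<Omega>s i)) (e t)" "L2 (lebesgue_on (\<Omega>s i)) e0" if i: "i \<in> {1..M}" for i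
    using dissipative_heat_solution.u_L2[OF loc[OF i] t] dissipative_heat_solution.u0_L2[OF loc[OF i]] by auto
  have "(l2_norm (lebesgue_on \<Omega>) (e t))\<^sup>2 = (\<Sum>i=1..M. (l2_norm (lebesgue_on (\<Omega>s i)) (e t))\<^sup>2)"
    by (rule lipschitz_partition_l2_norm[OF P L2s(1)])
  also have "\<dots> \<le> (\<Sum>i=1..M. exp (- (2 * (K - L)) * t) * (l2_norm (lebesgue_on (\<Omega>s i)) e0)\<^sup>2)"
  proof (rule sum_mono)
    fix i assume i: "i \<in> {1..M}"
    interpret dissipative_heat_solution "\<Omega>s i" e "\<lambda>t x. f (g t x + e t x) - f (g t x)" e0 L K by (rule loc[OF i])
    show "energy t \<le> exp (- (2 * (K - L)) * t) * (l2_norm (lebesgue_on (\<Omega>s i)) e0)\<^sup>2"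
      by (rule order_trans[OF energy_decay[OF K t]]) (intro mult_left_mono energy_initial, simp)
  qed
  also have "\<dots> = exp (- (2 * (K - L)) * t) * (\<Sum>i=1..M. (l2_norm (lebesgue_on (\<Omega>s i)) e0)\<^sup>2)"
    by (rule sum_distrib_left[symmetric])
  also have "(\<Sum>i=1..M. (l2_norm (lebesgue_on (\<Omega>s i)) e0)\<^sup>2) = (l2_norm (lebesgue_on \<Omega>) e0)\<^sup>2"
    by (rule lipschitz_partition_l2_norm[OF P L2s(2), symmetric])
  also have "exp (- (2 * (K - L)) * t) = (exp (- (K - L) * t))\<^sup>2"
    by (simp add: power2_eq_square algebra_simps flip: exp_add)
  finally show "(l2_norm (lebesgue_on \<Omega>) (e t))\<^sup>2 \<le> (exp (- (K - L) * t) * l2_norm (lebesgue_on \<Omega>) e0)\<^sup>2"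
    by (simp only: power_mult_distrib)
qed simp

theorem theorem2:
  fixes \<Omega> \<Gamma>1 \<Gamma>2 :: "'a::euclidean_space set"
    and f :: "real \<Rightarrow> real" and L :: real
    and M :: nat and \<Omega>s :: "nat \<Rightarrow> 'a set"
    and N :: nat and lam :: "nat \<Rightarrow> real" and phi :: "nat \<Rightarrow> 'a \<Rightarrow> real"
  assumes "smooth_bounded_domain \<Omega>"
    and "frontier \<Omega> = \<Gamma>1 \<union> \<Gamma>2" and "\<Gamma>1 \<inter> \<Gamma>2 = {}"
    and "\<Gamma>1 \<in> sets borel" and "emeasure surface_measure \<Gamma>1 > 0"
    and "L > 0" and "L-lipschitz_on UNIV f" and "f 0 = 0"
    and "lipschitz_partition \<Omega> M \<Omega>s"
    and "N \<ge> 1" and "dirichlet_eigensystem \<Omega> lam phi"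
    and "(MAX i\<in>{1..M}. measure lebesgue (\<Omega>s i))
           < inverse (C_dim DIM('a))
             * (real DIM('a) / (L * (real DIM('a) + 2))) powr (real DIM('a) / 2)"
  shows "\<exists>\<kappa>1>0. \<exists>\<kappa>2>0.
    \<forall>(U :: nat \<Rightarrow> real \<Rightarrow> 'a \<Rightarrow> real) dU z0 z p0 p phat0 phat \<epsilon>.
      (\<forall>i\<in>{1..N}. has_L2_time_derivative (surface_on \<Gamma>1) (U i) (dU i)) \<longrightarrow>
      plant_solution \<Omega> \<Gamma>1 f (\<lambda>t x. \<Sum>i=1..N. U i t x) z0 z \<longrightarrow>
      (\<forall>t\<ge>0. \<forall>x\<in>\<Omega>. p t x = z t x - lifted_control \<Omega> \<Gamma>1 lam phi N U t x) \<longrightarrow>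
      weak_heat_solution \<Omega> (\<lambda>t x. 0) (lifted_source \<Omega> \<Gamma>1 f lam phi N U dU p) p0 p \<longrightarrow>
      observer_solution \<Omega> \<Gamma>1 f lam phi N U dU M \<Omega>s z phat0 phat \<longrightarrow>
      (\<forall>t\<ge>0. \<forall>x\<in>\<Omega>. \<epsilon> t x = p t x - phat t x) \<longrightarrow>
      error_solution f M \<Omega>s (\<lambda>t x. phat t x + lifted_control \<Omega> \<Gamma>1 lam phi N U t x)
        (\<lambda>x. p0 x - phat0 x) \<epsilon> \<longrightarrow>
      (\<forall>t\<ge>0. l2_norm (lebesgue_on \<Omega>) (\<epsilon> t)
         \<le> \<kappa>1 * exp (- \<kappa>2 * t) * l2_norm (lebesgue_on \<Omega>) (\<lambda>x. p0 x - phat0 x))"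
proof -
  note P = \<open>lipschitz_partition \<Omega> M \<Omega>s\<close>
  let ?m = "MAX i\<in>{1..M}. measure lebesgue (\<Omega>s i)"
  have M: "1 \<in> {1..M}" using P by (simp add: lipschitz_partition_def)
  have dom: "lipschitz_domain (\<Omega>s i)" if "i \<in> {1..M}" for i
    using P that by (simp add: lipschitz_partition_def)
  have le: "measure lebesgue (\<Omega>s i) \<le> ?m" if "i \<in> {1..M}" for i
    using that by (intro Max_ge) auto
  have "0 < measure lebesgue (\<Omega>s 1)" by (rule lipschitz_domain_lmeasurable(3)[OF dom[OF M]])
  with le[OF M] have m: "0 < ?m" by linarith
  obtain K where K: "L < K" "\<And>(S :: 'a set) \<psi>. S \<in> lmeasurable \<Longrightarrow> measure lebesgue S \<le> ?m \<Longrightarrow> test_function S \<psi> \<Longrightarrow>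
       K * (l2_norm (lebesgue_on S) \<psi>)\<^sup>2 \<le> (l2_norm (lebesgue_on S) (gradient \<psi>))\<^sup>2"
    by (rule berezin_li_yau[OF m \<open>L > 0\<close> assms(12)]) (rule that)
  \<comment> \<open>The witnesses are 1 and \<open>K - L\<close>. \<open>K\<close> comes from the
    largest volume alone, so both can be fixed before the controls, the states and the initial
    data.\<close>
  have decay: "l2_norm (lebesgue_on \<Omega>) (\<epsilon> t) \<le> 1 * exp (- (K - L) * t) * l2_norm (lebesgue_on \<Omega>) e0"
    if "error_solution f M \<Omega>s g e0 \<epsilon>" "t \<ge> 0" for g e0 \<epsilon> t
    using error_solution_decay[OF P _ \<open>L-lipschitz_on UNIV f\<close> _ K(2)[OF lipschitz_domain_lmeasurable(1)[OF dom] le] that]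
      \<open>L > 0\<close> K(1) by simp
  show ?thesis
    by (intro exI[of _ 1] exI[of _ "K - L"] conjI allI impI decay) (use K(1) in auto)
qed

end
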